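(* Let $d=3$, $T>0$, and let $(u,h)$ be a weak solution of the inviscid Hall-MHD equations $$\begin{aligned}&u_{t}+u\cdot\nabla u-h\cdot\nabla h+\nabla\Pi =0,\\ &h_{t}+u\cdot\nabla h-h\cdot\nabla u+\nabla\times\big[(\nabla\times h)\times h\big]=0,\\ &\mathrm{div}\,u=\mathrm{div}\,h=0\end{aligned}$$ on $\mathbb{T}^3$ with $h\in C([0,T];L^3(\mathbb{T}^3))$. If $$u\in L^{3}(0,T;L^{3}(\mathbb{T}^{3}))\quad\text{and}\quad h\in L^{3}(0,T;\underline{B}^{1/3}_{3,VMO}(\mathbb{T}^3)),$$ then for any $t\in[0,T]$ the magnetic helicity is constant, i.e. $$\int_{\mathbb{T}^3}H(x,t)\cdot\mathrm{curl}\,H(x,t)\,dx=\int_{\mathbb{T}^3}H_0\cdot\mathrm{curl}\,H_0\,dx ,$$ where $H=\mathrm{curl}^{-1}h$ and $H_0=H(\cdot,0)$.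
   Context: $\mathbb{T}^3$ is the three-dimensional torus (periodic boundary conditions). The ion inertial length is normalized to $1$. $H=\mathrm{curl}^{-1}h$ is the magnetic vector potential: the divergence-free (mean-zero) field with $\mathrm{curl}\,H=h$; for this to be defined on the torus, $h$ is taken to have zero spatial mean. The potential satisfies, for some scalar $p$, the equation $H_t+h\times u+(\nabla\times h)\times h+\nabla p=0$, $\mathrm{div}\,H=0$, in the weak sense. Weak solution of the inviscid Hall-MHD equations: a pair $(u,h)$ that is (at least weakly) continuous from $[0,T]$ into $L^2(\mathbb{T}^3)$, with $u,h$ divergence-free in the sense of distributions, such that for every divergence-free test vector field $\varphi\in C_0^\infty((0,T)\times\mathbb{T}^3)$, $$\int_0^T\!\!\int_{\mathbb{T}^3}\Big(\partial_t\varphi\cdot u+\sum_{i,k}\partial_k\varphi_i\,(u_iu_k-h_ih_k)\Big)dx\,dt=0,$$ $$\int_0^T\!\!\int_{\mathbb{T}^3}\Big(\partial_t\varphi\cdot h+\sum_{i,k}\partial_k\varphi_i\,(h_iu_k-u_ih_k)+\sum_{i,k}h_ih_k\,\partial_k(\nabla\times\varphi)_i\Big)dx\,dt=0.$$ The Besov-VMO space $L^r(0,T;\underline{B}^{\alpha}_{q,VMO}(\mathbb{T}^d))$ consists of $f\in L^r(0,T;L^q(\mathbb{T}^d))$ with $$\lim_{\varepsilon\to0}\frac1{\varepsilon^\alpha}\left(\int_0^T\Big[\int_{\mathbb{T}^d}\frac{1}{|B_\varepsilon(0)|}\int_{B_\varepsilon(0)}|f(x,t)-f(x-y,t)|^q\,dy\,dx\Big]^{r/q}dt\right)^{1/r}=0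 .$$ *)

theory Defs
  imports "HOL-Analysis.Analysis"
begin

text \<open>
  The torus is the quotient of \<open>real ^ 'n\<close> by the integer lattice: functions on it are
  functions on \<open>real ^ 'n\<close> of period 1 in each coordinate, integrated over the unit cube.
  Elements of the Lebesgue spaces are represented by Borel functions.  Time-dependent fields are
  written \<open>f t x\<close>, and only their values for \<open>t \<in> {0..T}\<close> matter.
\<close>

definition periodic :: "(real ^ 'n \<Rightarrow> 'b) \<Rightarrow> bool" where
  "periodic f \<longleftrightarrow> (\<forall>x i. f (x + axis i 1) = f x)"

abbreviation torus :: "(real ^ 'n) set" where
  "torus \<equiv> cbox 0 One"

primrec times_cont_differentiable ::
    "nat \<Rightarrow> ('a::real_normed_vector \<Rightarrow> 'b::real_normed_vector) \<Rightarrow> bool" where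
  "times_cont_differentiable 0 f \<longleftrightarrow> continuous_on UNIV f"
| "times_cont_differentiable (Suc k) f \<longleftrightarrow>
     (\<forall>x. f differentiable (at x)) \<and>
     (\<forall>v. times_cont_differentiable k (\<lambda>x. frechet_derivative f (at x) v))"

definition smooth :: "('a::real_normed_vector \<Rightarrow> 'b::real_normed_vector) \<Rightarrow> bool" where
  "smooth f \<longleftrightarrow> (\<forall>k. times_cont_differentiable k f)"


subsection \<open>Lebesgue and Besov-VMO spaces\<close>

definition torus_Lp :: "real \<Rightarrow> (real ^ 'n \<Rightarrow> 'b::euclidean_space) \<Rightarrow> bool" where
  "torus_Lp q f \<longleftrightarrow> f \<in> borel_measurable borel \<and> periodic f \<and>
     set_integrable lborel torus (\<lambda>x. norm (f x) powr q)"

definition torus_Lp_norm :: "real \<Rightarrow> (real ^ 'n \<Rightarrow> 'b::euclidean_space) \<Rightarrow> real" where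
  "torus_Lp_norm q f = (LINT x:torus|lborel. norm (f x) powr q) powr (1 / q)"

definition jointly_measurable ::
    "real \<Rightarrow> (real \<Rightarrow> real ^ 'n \<Rightarrow> 'b::euclidean_space) \<Rightarrow> bool" where
  "jointly_measurable T f \<longleftrightarrow>
     set_borel_measurable borel ({0..T} \<times> UNIV) (\<lambda>(t, x). f t x)"

definition Lr_Lq ::
    "real \<Rightarrow> real \<Rightarrow> real \<Rightarrow> (real \<Rightarrow> real ^ 'n \<Rightarrow> 'b::euclidean_space) \<Rightarrow> bool" where
  "Lr_Lq T r q f \<longleftrightarrow> jointly_measurable T f \<and>
     (AE t in lborel. t \<in> {0..T} \<longrightarrow> torus_Lp q (f t)) \<and>
     set_integrable lborel {0..T} (\<lambda>t. torus_Lp_norm q (f t) powr r)"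

definition C_Lq ::
    "real \<Rightarrow> real \<Rightarrow> (real \<Rightarrow> real ^ 'n \<Rightarrow> 'b::euclidean_space) \<Rightarrow> bool" where
  "C_Lq T q f \<longleftrightarrow> (\<forall>t\<in>{0..T}. torus_Lp q (f t)) \<and>
     (\<forall>s\<in>{0..T}. ((\<lambda>t. torus_Lp_norm q (\<lambda>x. f t x - f s x)) \<longlongrightarrow> 0) (at s within {0..T}))"

definition weakly_continuous_L2 ::
    "real \<Rightarrow> (real \<Rightarrow> real ^ 'n \<Rightarrow> 'b::euclidean_space) \<Rightarrow> bool" where
  "weakly_continuous_L2 T f \<longleftrightarrow> (\<forall>t\<in>{0..T}. torus_Lp 2 (f t)) \<and>
     (\<forall>w. torus_Lp 2 w \<longrightarrow>
       continuous_on {0..T} (\<lambda>t. LINT x:torus|lborel. f t x \<bullet> w x))"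

definition Lr_Besov_VMO ::
    "real \<Rightarrow> real \<Rightarrow> real \<Rightarrow> real \<Rightarrow> (real \<Rightarrow> real ^ 'n \<Rightarrow> 'b::euclidean_space) \<Rightarrow> bool" where
  "Lr_Besov_VMO T r \<alpha> q f \<longleftrightarrow> Lr_Lq T r q f \<and>
     ((\<lambda>\<epsilon>. 1 / \<epsilon> powr \<alpha> *
        (LINT t:{0..T}|lborel.
          (LINT x:torus|lborel.
            1 / measure lborel (ball (0 :: real ^ 'n) \<epsilon>) *
              (LINT y:ball 0 \<epsilon>|lborel. norm (f t x - f t (x - y)) powr q))
          powr (r / q))
        powr (1 / r)) \<longlongrightarrow> 0) (at_right 0)"


subsection \<open>Differential operators\<close>

definition partial :: "'n \<Rightarrow> (real ^ 'n \<Rightarrow> 'b::real_normed_vector) \<Rightarrow> real ^ 'n \<Rightarrow> 'b" where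
  "partial k f x = frechet_derivative f (at x) (axis k 1)"

definition grad :: "(real ^ 'n \<Rightarrow> real) \<Rightarrow> real ^ 'n \<Rightarrow> real ^ 'n" where
  "grad f x = (\<chi> k. partial k f x)"

definition divergence :: "(real ^ 'n \<Rightarrow> real ^ 'n) \<Rightarrow> real ^ 'n \<Rightarrow> real" where
  "divergence f x = (\<Sum>k\<in>UNIV. partial k (\<lambda>z. f z $ k) x)"

definition curl :: "(real ^ 3 \<Rightarrow> real ^ 3) \<Rightarrow> real ^ 3 \<Rightarrow> real ^ 3" where
  "curl f x = vector
     [partial 2 (\<lambda>z. f z $ 3) x - partial 3 (\<lambda>z. f z $ 2) x,
      partial 3 (\<lambda>z. f z $ 1) x - partial 1 (\<lambda>z. f z $ 3) x,
      partial 1 (\<lambda>z. f z $ 2) x - partial 2 (\<lambda>z. f z $ 1) x]"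

definition weakly_div_free :: "(real ^ 'n \<Rightarrow> real ^ 'n) \<Rightarrow> bool" where
  "weakly_div_free f \<longleftrightarrow>
     (\<forall>\<psi>. smooth \<psi> \<and> periodic \<psi> \<longrightarrow> (LINT x:torus|lborel. f x \<bullet> grad \<psi> x) = 0)"

definition mean_zero :: "(real ^ 'n \<Rightarrow> 'b::euclidean_space) \<Rightarrow> bool" where
  "mean_zero f \<longleftrightarrow> (LINT x:torus|lborel. f x) = 0"

definition has_weak_curl :: "(real ^ 3 \<Rightarrow> real ^ 3) \<Rightarrow> (real ^ 3 \<Rightarrow> real ^ 3) \<Rightarrow> bool" where
  "has_weak_curl f w \<longleftrightarrow> torus_Lp 2 f \<and> torus_Lp 2 w \<and>
     (\<forall>\<psi>. smooth \<psi> \<and> periodic \<psi> \<longrightarrow>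
       (LINT x:torus|lborel. f x \<bullet> curl \<psi> x) = (LINT x:torus|lborel. w x \<bullet> \<psi> x))"

text \<open>A weak curl is unique only up to null sets; \<open>weak_curl f\<close> is an arbitrary version.\<close>

definition weak_curl :: "(real ^ 3 \<Rightarrow> real ^ 3) \<Rightarrow> real ^ 3 \<Rightarrow> real ^ 3" where
  "weak_curl f = (SOME w. has_weak_curl f w)"

text \<open>
  \<open>is_curl_inverse h H\<close> says that \<open>H\<close> is (a version of) the field \<open>curl\<^sup>-\<^sup>1 h\<close>.  It is a relation
  because \<open>H\<close> is determined by \<open>h\<close> only up to null sets.
\<close>

definition is_curl_inverse :: "(real ^ 3 \<Rightarrow> real ^ 3) \<Rightarrow> (real ^ 3 \<Rightarrow> real ^ 3) \<Rightarrow> bool" where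
  "is_curl_inverse h H \<longleftrightarrow> has_weak_curl H h \<and> weakly_div_free H \<and> mean_zero H"

definition magnetic_helicity :: "(real ^ 3 \<Rightarrow> real ^ 3) \<Rightarrow> real" where
  "magnetic_helicity H = (LINT x:torus|lborel. H x \<bullet> weak_curl H x)"


subsection \<open>Weak solutions of the inviscid Hall-MHD equations\<close>

text \<open>
  Test fields in \<open>C\<^sub>0\<^sup>\<infinity>((0,T) \<times> torus)\<close> are extended by zero to all times, so that they
  are smooth on the whole of \<open>real \<times> real ^ 3\<close>.
\<close>

definition div_free_test_field :: "real \<Rightarrow> (real \<Rightarrow> real ^ 3 \<Rightarrow> real ^ 3) \<Rightarrow> bool" where
  "div_free_test_field T \<phi> \<longleftrightarrow>
     smooth (\<lambda>(t, x). \<phi> t x) \<and>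
     (\<forall>t. periodic (\<phi> t)) \<and>
     (\<exists>a b. 0 < a \<and> a \<le> b \<and> b < T \<and> (\<forall>t x. t \<notin> {a..b} \<longrightarrow> \<phi> t x = 0)) \<and>
     (\<forall>t x. divergence (\<phi> t) x = 0)"

definition time_deriv :: "(real \<Rightarrow> real ^ 3 \<Rightarrow> real ^ 3) \<Rightarrow> real \<Rightarrow> real ^ 3 \<Rightarrow> real ^ 3" where
  "time_deriv \<phi> t x = vector_derivative (\<lambda>s. \<phi> s x) (at t)"

definition Hall_MHD_weak_solution ::
    "real \<Rightarrow> (real \<Rightarrow> real ^ 3 \<Rightarrow> real ^ 3) \<Rightarrow> (real \<Rightarrow> real ^ 3 \<Rightarrow> real ^ 3) \<Rightarrow> bool" where
  "Hall_MHD_weak_solution T u h \<longleftrightarrow>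
     jointly_measurable T u \<and> jointly_measurable T h \<and>
     weakly_continuous_L2 T u \<and> weakly_continuous_L2 T h \<and>
     (\<forall>t\<in>{0..T}. weakly_div_free (u t) \<and> weakly_div_free (h t)) \<and>
     (\<forall>\<phi>. div_free_test_field T \<phi> \<longrightarrow>
       (LINT t:{0..T}|lborel. (LINT x:torus|lborel.
          time_deriv \<phi> t x \<bullet> u t x +
          (\<Sum>i\<in>UNIV. \<Sum>k\<in>UNIV. partial k (\<lambda>z. \<phi> t z $ i) x *
             (u t x $ i * u t x $ k - h t x $ i * h t x $ k)))) = 0 \<and>
       (LINT t:{0..T}|lborel. (LINT x:torus|lborel.
          time_deriv \<phi> t x \<bullet> h t x +
          (\<Sum>i\<in>UNIV. \<Sum>k\<in>UNIV. partial k (\<lambda>z. \<phi> t z $ i) x *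
             (h t x $ i * u t x $ k - u t x $ i * h t x $ k)) +
          (\<Sum>i\<in>UNIV. \<Sum>k\<in>UNIV. h t x $ i * h t x $ k *
             partial k (\<lambda>z. curl (\<phi> t) z $ i) x))) = 0)"

end

theory Submission
  imports Defs
begin

text \<open>
  Mollify \<open>h\<close> in space with an even kernel \<open>\<rho>\<close> at scale \<open>\<epsilon>\<close>. The mollified helicity
  \<open>Q t = \<integral> H t \<bullet> (\<rho> * h t)\<close> is the diagonal of the symmetric form \<open>B r q = \<integral> h q \<bullet> (\<rho> * H r)\<close>,
  so \<open>Q t - Q s = (B t t - B t s) + (B s t - B s s)\<close>, and each bracket is an increment of the
  induction equation tested with a fixed smooth field \<open>\<rho> * H r\<close>: it is the time integral of a
  flux \<open>\<Phi> \<tau> (h r)\<close> in which only the curl \<open>\<rho> * h r\<close> of the test field occurs. As \<open>h\<close> is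
  continuous in time, on short intervals \<open>h r\<close> may be replaced by \<open>h \<tau>\<close>, and subdividing the
  interval gives \<open>\<bar>Q t - Q 0\<bar> \<le> 2 \<integral> \<bar>\<Phi> \<tau> (h \<tau>)\<bar>\<close>; no mollification in time is needed.

  In \<open>\<Phi> \<tau> (h \<tau>)\<close> the transport term is \<open>\<integral> (\<rho> * h - h) \<bullet> (u \<times> h)\<close> because \<open>h \<bullet> (u \<times> h) = 0\<close>, and
  the Hall term is a third-order structure function, a quarter of
  \<open>\<integral>\<integral> \<nabla>\<rho> \<bullet> \<delta> * \<bar>\<delta>\<bar>\<^sup>2\<close> with \<open>\<delta> = h (x - y) - h x\<close>. The gradient costs \<open>1 / \<epsilon>\<close>, which is exactly
  what the cube of the Besov-VMO modulus of exponent \<open>1 / 3\<close> compensates as \<open>\<epsilon> \<rightarrow> 0\<close>.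
\<close>


subsection \<open>Smooth functions\<close>

text \<open>Helicity pairs \<open>h\<close> with a field one derivative smoother, so in the flux
  only the Hall term differentiates the mollified field: it alone pays \<open>1 / \<epsilon>\<close>
  and needs the exponent \<open>1 / 3\<close>. The transport term needs only convergence of the
  mollified \<open>h\<close> in \<open>L^3\<close>, so \<open>u\<close> enters through its cubic
  mass, without any regularity. As that mass does not shrink with \<epsilon>, it receives a small
  weight \<open>e\<close>, at the price of \<open>1 / e^2\<close> on the modulus of
  \<open>h\<close>.

  The obstacle to differentiating the mollified helicity directly is that \<open>H t\<close> is no
  admissible test field: its dependence on time is only as good as that of \<open>h\<close>.
  Freezing it at the ends of a short interval leaves an error whose bound depends on the mollifier.
  This dictates the order of choices: \<open>e\<close>, then \<epsilon>, and only with the mollifier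
  fixed does the length of the intervals go to 0.

  Since \<open>weak_curl\<close> picks an arbitrary version, the helicity must also be identified
  with the integral of \<open>H \<bullet> h\<close>; this is done by pairing with mollified fields
  as well.\<close>

lemma times_cont_differentiable_SucI:
  assumes "\<And>x. (f has_derivative f' x) (at x)"
    and "\<And>v. times_cont_differentiable k (\<lambda>x. f' x v)"
  shows "times_cont_differentiable (Suc k) f"
proof -
  have "frechet_derivative f (at x) = f' x" for x
    using frechet_derivative_at[OF assms(1)] by simp
  then show ?thesis using assms by (auto simp: differentiable_def)
qed

lemma times_cont_differentiable_SucD:
  assumes "times_cont_differentiable (Suc k) f"
  shows "(f has_derivative frechet_derivative f (at x)) (at x)"
    and "times_cont_differentiable k (\<lambda>x. frechet_derivative f (at x) v)"
  using assms by (auto simp: frechet_derivative_works)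

lemma times_cont_differentiable_continuous:
  "times_cont_differentiable k f \<Longrightarrow> continuous_on UNIV f"
  by (cases k)
    (auto intro!: continuous_at_imp_continuous_on differentiable_imp_continuous_within)

lemma times_cont_differentiable_Suc_lower:
  "times_cont_differentiable (Suc k) f \<Longrightarrow> times_cont_differentiable k f"
proof (induction k arbitrary: f)
  case 0
  then show ?case using times_cont_differentiable_continuous by fastforce
next
  case (Suc k)
  then show ?case by (metis times_cont_differentiable.simps(2))
qed

lemma times_cont_differentiable_const: "times_cont_differentiable k (\<lambda>x. c)"
proof (induction k arbitrary: c)
  case (Suc k)
  show ?case by (rule times_cont_differentiable_SucI[where f' = "\<lambda>x v. 0"]) (use Suc in auto)
qed simp

lemma times_cont_differentiable_add:
  "times_cont_differentiable k f \<Longrightarrow> times_cont_differentiable k g \<Longrightarrow>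
   times_cont_differentiable k (\<lambda>x. f x + g x)"
proof (induction k arbitrary: f g)
  case (Suc k)
  show ?case
    by (rule times_cont_differentiable_SucI,
        rule has_derivative_add[OF times_cont_differentiable_SucD(1)[OF Suc.prems(1)]
          times_cont_differentiable_SucD(1)[OF Suc.prems(2)]])
      (intro Suc.IH times_cont_differentiable_SucD(2) Suc.prems)
qed (auto intro!: continuous_intros)

text \<open>The product rule pairs each factor with a derivative of the other, so the induction also
  uses that order \<open>Suc k\<close> implies order \<open>k\<close>.\<close>

lemma times_cont_differentiable_bilinear:
  assumes "bounded_bilinear B"
  shows "times_cont_differentiable k f \<Longrightarrow> times_cont_differentiable k g \<Longrightarrow>
   times_cont_differentiable k (\<lambda>x. B (f x) (g x))"
proof (induction k arbitrary: f g)
  case 0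
  then show ?case using bounded_bilinear.continuous_on[OF assms] by auto
next
  case (Suc k)
  show ?case
    by (rule times_cont_differentiable_SucI,
        rule bounded_bilinear.FDERIV[OF assms times_cont_differentiable_SucD(1)[OF Suc.prems(1)]
          times_cont_differentiable_SucD(1)[OF Suc.prems(2)]])
      (rule times_cont_differentiable_add[OF
          Suc.IH[OF times_cont_differentiable_Suc_lower[OF Suc.prems(1)]
            times_cont_differentiable_SucD(2)[OF Suc.prems(2)]]
          Suc.IH[OF times_cont_differentiable_SucD(2)[OF Suc.prems(1)]
            times_cont_differentiable_Suc_lower[OF Suc.prems(2)]]])
qed

lemma times_cont_differentiable_linear_compose:
  assumes "bounded_linear L"
  shows "times_cont_differentiable k f \<Longrightarrow> times_cont_differentiable k (\<lambda>x. L (f x))"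
proof (induction k arbitrary: f)
  case 0
  then show ?case using bounded_linear.continuous_on[OF assms] by auto
next
  case (Suc k)
  show ?case
    by (rule times_cont_differentiable_SucI,
        rule bounded_linear.has_derivative[OF assms times_cont_differentiable_SucD(1)[OF Suc.prems]])
      (intro Suc.IH times_cont_differentiable_SucD(2) Suc.prems)
qed

lemma times_cont_differentiable_compose_linear:
  assumes "bounded_linear L"
  shows "times_cont_differentiable k f \<Longrightarrow> times_cont_differentiable k (\<lambda>x. f (L x))"
proof (induction k arbitrary: f)
  case 0
  have "continuous_on UNIV L" using assms by (simp add: linear_continuous_on)
  then show ?case using 0 by (auto intro: continuous_on_compose2)
next
  case (Suc k)
  show ?case
  proof (rule times_cont_differentiable_SucI)
    show "((\<lambda>x. f (L x)) has_derivative (\<lambda>v. frechet_derivative f (at (L x)) (L v))) (at x)" for x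
      by (rule has_derivative_compose[OF bounded_linear.has_derivative[OF assms has_derivative_ident]
            times_cont_differentiable_SucD(1)[OF Suc.prems]])
    show "times_cont_differentiable k (\<lambda>x. frechet_derivative f (at (L x)) (L v))" for v
      using Suc.IH[OF times_cont_differentiable_SucD(2)[OF Suc.prems]] .
  qed
qed

text \<open>A real inner function makes the chain rule a product: the derivative of \<open>f\<close>
  in a real direction is that direction times its value at 1, so the bilinear rule for scaling
  closes the induction.\<close>

lemma times_cont_differentiable_compose_real:
  fixes g :: "_ \<Rightarrow> real"
  shows "times_cont_differentiable k f \<Longrightarrow> times_cont_differentiable k g \<Longrightarrow>
   times_cont_differentiable k (\<lambda>x. f (g x))"
proof (induction k arbitrary: f g)
  case 0
  then show ?case by (auto intro: continuous_on_compose2)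
next
  case (Suc k)
  show ?case
  proof (rule times_cont_differentiable_SucI)
    show "((\<lambda>x. f (g x)) has_derivative
        (\<lambda>v. frechet_derivative f (at (g x)) (frechet_derivative g (at x) v))) (at x)" for x
      by (rule has_derivative_compose[OF times_cont_differentiable_SucD(1)[OF Suc.prems(2)]
            times_cont_differentiable_SucD(1)[OF Suc.prems(1)]])
    have "linear (frechet_derivative f (at y))" for y
      using times_cont_differentiable_SucD(1)[OF Suc.prems(1)] has_derivative_linear by blast
    then have scale: "frechet_derivative f (at y) z = z *\<^sub>R frechet_derivative f (at y) 1" for y z
      by (metis linear_scale mult.right_neutral real_scaleR_def)
    have "times_cont_differentiable k
        (\<lambda>x. frechet_derivative g (at x) v *\<^sub>R frechet_derivative f (at (g x)) 1)" for v
      by (rule times_cont_differentiable_bilinear[OF bounded_bilinear_scaleR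
            times_cont_differentiable_SucD(2)[OF Suc.prems(2)]
            Suc.IH[OF times_cont_differentiable_SucD(2)[OF Suc.prems(1)]
              times_cont_differentiable_Suc_lower[OF Suc.prems(2)]]])
    then show "times_cont_differentiable k
        (\<lambda>x. frechet_derivative f (at (g x)) (frechet_derivative g (at x) v))" for v
      unfolding scale[of _ "frechet_derivative g (at _) v"] .
  qed
qed

lemma times_cont_differentiable_bounded_linear:
  assumes "bounded_linear L" shows "times_cont_differentiable k L"
proof (cases k)
  case 0
  then show ?thesis using assms by (simp add: linear_continuous_on)
next
  case (Suc j)
  have "times_cont_differentiable (Suc j) L"
    by (rule times_cont_differentiable_SucI[OF bounded_linear_imp_has_derivative[OF assms]
          times_cont_differentiable_const])
  then show ?thesis using Suc by simp
qed

section \<open>Closure properties of smooth functions\<close>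

lemma smooth_const: "smooth (\<lambda>x. c)"
  unfolding smooth_def by (rule allI, rule times_cont_differentiable_const)

lemma smooth_add: "smooth f \<Longrightarrow> smooth g \<Longrightarrow> smooth (\<lambda>x. f x + g x)"
  unfolding smooth_def by (rule allI, rule times_cont_differentiable_add; (assumption | erule allE))

lemma smooth_bilinear:
  "bounded_bilinear B \<Longrightarrow> smooth f \<Longrightarrow> smooth g \<Longrightarrow> smooth (\<lambda>x. B (f x) (g x))"
  unfolding smooth_def by (rule allI, rule times_cont_differentiable_bilinear; (assumption | erule allE))

lemma smooth_linear_compose: "bounded_linear L \<Longrightarrow> smooth f \<Longrightarrow> smooth (\<lambda>x. L (f x))"
  unfolding smooth_def by (rule allI, rule times_cont_differentiable_linear_compose; (assumption | erule allE))

lemma smooth_compose_linear: "bounded_linear L \<Longrightarrow> smooth f \<Longrightarrow> smooth (\<lambda>x. f (L x))"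
  unfolding smooth_def by (rule allI, rule times_cont_differentiable_compose_linear; (assumption | erule allE))

lemma smooth_compose_real:
  fixes g :: "_ \<Rightarrow> real"
  shows "smooth f \<Longrightarrow> smooth g \<Longrightarrow> smooth (\<lambda>x. f (g x))"
  unfolding smooth_def by (rule allI, rule times_cont_differentiable_compose_real; (assumption | erule allE))

lemma smooth_bounded_linear: "bounded_linear L \<Longrightarrow> smooth L"
  unfolding smooth_def by (rule allI, rule times_cont_differentiable_bounded_linear; (assumption | erule allE))

lemma smooth_has_derivative:
  "smooth f \<Longrightarrow> (f has_derivative frechet_derivative f (at x)) (at x)"
  unfolding smooth_def by (rule times_cont_differentiable_SucD(1)[of 0]) (erule allE)

lemma smooth_frechet_derivative:
  "smooth f \<Longrightarrow> smooth (\<lambda>x. frechet_derivative f (at x) v)"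
  unfolding smooth_def by (rule allI, rule times_cont_differentiable_SucD(2), erule allE)

lemma smooth_continuous: "smooth f \<Longrightarrow> continuous_on S f"
  unfolding smooth_def
  by (rule continuous_on_subset[OF times_cont_differentiable_continuous[of 0]]) auto

text \<open>Serves for primitives given by an integral, where the first derivative is all that is
  known in closed form.\<close>

lemma smooth_real_derivativeI:
  fixes f :: "real \<Rightarrow> real"
  assumes "\<And>x. (f has_real_derivative f' x) (at x)" and "smooth f'"
  shows "smooth f"
  unfolding smooth_def
proof
  fix k
  show "times_cont_differentiable k f"
  proof (rule times_cont_differentiable_Suc_lower, rule times_cont_differentiable_SucI)
    show "(f has_derivative (\<lambda>v. f' x * v)) (at x)" for x
      using assms(1) by (simp add: has_field_derivative_def)
    show "times_cont_differentiable k (\<lambda>x. f' x * v)" for v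
      by (rule times_cont_differentiable_linear_compose[OF bounded_linear_mult_left])
        (use assms(2) in \<open>simp add: smooth_def\<close>)
  qed
qed


subsection \<open>Flat functions and mollifiers\<close>

text \<open>The classical function \<open>exp (- 1 / x)\<close> extended by 0, together with its
  products with powers of \<open>1 / x\<close>. With the powers the family is closed under
  differentiation, and smoothness follows by induction for all \<open>n\<close> at once.\<close>

definition flat :: "nat \<Rightarrow> real \<Rightarrow> real" where
  "flat n x = (if 0 < x then inverse x ^ n * exp (- inverse x) else 0)"

lemma flat_nonneg: "0 \<le> flat n x"
  by (simp add: flat_def)

lemma flat_nonpos: "x \<le> 0 \<Longrightarrow> flat n x = 0"
  by (simp add: flat_def)

lemma flat_0_le_1: "flat 0 x \<le> 1"
  by (simp add: flat_def)

text \<open>From \<open>y^2 / 2 \<le> exp y\<close> at \<open>y = 1 / x\<close>. As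
  \<open>flat 2\<close> is the derivative of \<open>flat 0\<close>, this is the Lipschitz bound
  behind the gradient estimate of the mollifier.\<close>

lemma flat_2_le_2: "flat 2 x \<le> 2"
proof (cases "0 < x")
  case True
  have "1 + inverse x + (inverse x)\<^sup>2 / 2 \<le> exp (inverse x)"
    by (rule exp_lower_Taylor_quadratic) (use True in simp)
  moreover have "0 < inverse x" using True by simp
  ultimately have "(inverse x)\<^sup>2 / 2 \<le> exp (inverse x)" by linarith
  then show ?thesis using True by (simp add: flat_def exp_minus field_simps)
qed (simp add: flat_def)

lemma flat_tendsto_0: "(flat n \<longlongrightarrow> 0) (at 0)"
proof (rule filterlim_split_at)
  have "((\<lambda>y. y ^ n * exp (- y)) \<longlongrightarrow> (0::real)) at_top"
    using tendsto_power_div_exp_0[of n] by (simp add: exp_minus divide_inverse)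
  from filterlim_compose[OF this filterlim_inverse_at_top_right]
  have "((\<lambda>x::real. inverse x ^ n * exp (- inverse x)) \<longlongrightarrow> 0) (at_right 0)" .
  moreover have "\<forall>\<^sub>F x in at_right 0. inverse x ^ n * exp (- inverse x) = flat n x"
    by (auto simp: flat_def eventually_at_filter)
  ultimately show "(flat n \<longlongrightarrow> 0) (at_right 0)" by (rule Lim_transform_eventually)
  have "\<forall>\<^sub>F x in at_left 0. 0 = flat n x"
    by (auto simp: flat_def eventually_at_filter)
  then show "(flat n \<longlongrightarrow> 0) (at_left 0)" by (rule Lim_transform_eventually[rotated]) simp
qed

lemma flat_has_derivative:
  "(flat n has_real_derivative (flat (n + 2) x - real n * flat (n + 1) x)) (at x)"
proof -
  consider "x < 0" | "x = 0" | "0 < x" by linarith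
  then show ?thesis
  proof cases
    case 1
    have "((\<lambda>x. 0) has_real_derivative 0) (at x)" by simp
    then have "(flat n has_real_derivative 0) (at x)"
      by (rule has_field_derivative_transform_within_open[of _ _ _ "{..<0}"])
        (use 1 in \<open>auto simp: flat_def\<close>)
    then show ?thesis using 1 by (simp add: flat_def)
  next
    case 2
    have "\<forall>\<^sub>F h in at 0. flat (n + 1) h = flat n h / h"
      by (auto simp: flat_def eventually_at_filter divide_inverse)
    \<comment> \<open>At the origin the difference quotient of \<open>flat n\<close> is again a flat
      function, of index \<open>n + 1\<close>, so its limit is already known.\<close>
    with flat_tendsto_0[of "n + 1"] have "((\<lambda>h. flat n h / h) \<longlongrightarrow> 0) (at 0)"
      by (rule Lim_transform_eventually)
    then show ?thesis using 2 by (simp add: DERIV_def flat_def)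
  next
    case 3
    have "((\<lambda>x. inverse x ^ n * exp (- inverse x)) has_real_derivative
        inverse x ^ (n + 2) * exp (- inverse x) - real n * (inverse x ^ (n + 1) * exp (- inverse x))) (at x)"
    proof (rule DERIV_cong)
      show "((\<lambda>x. inverse x ^ n * exp (- inverse x)) has_real_derivative
          (of_nat n * (- (inverse x ^ Suc (Suc 0)) * inverse x ^ (n - Suc 0))) * exp (- inverse x) +
          (exp (- inverse x) * (- (- (inverse x ^ Suc (Suc 0))))) * inverse x ^ n) (at x)"
        by (intro DERIV_mult DERIV_power DERIV_fun_exp DERIV_minus DERIV_inverse) (use 3 in simp_all)
    qed (cases n; simp add: algebra_simps)
    then have "(flat n has_real_derivative
        inverse x ^ (n + 2) * exp (- inverse x) - real n * (inverse x ^ (n + 1) * exp (- inverse x))) (at x)"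
      by (rule has_field_derivative_transform_within_open[of _ _ _ "{0<..}"])
        (use 3 in \<open>auto simp: flat_def\<close>)
    then show ?thesis using 3 by (simp add: flat_def)
  qed
qed

lemma smooth_flat: "smooth (flat n)"
  unfolding smooth_def
proof
  fix k
  show "times_cont_differentiable k (flat n)"
  proof (induction k arbitrary: n)
    case 0
    show ?case
      using DERIV_isCont[OF flat_has_derivative] by (simp add: continuous_at_imp_continuous_on)
  next
    case (Suc k)
    show ?case
    proof (rule times_cont_differentiable_SucI)
      show "(flat n has_derivative (\<lambda>v. (flat (n + 2) x + (- real n) * flat (n + 1) x) * v)) (at x)"
        for x using flat_has_derivative[of n x] by (simp add: has_field_derivative_def)
      show "times_cont_differentiable k (\<lambda>x. (flat (n + 2) x + (- real n) * flat (n + 1) x) * v)"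
        for v
        by (rule times_cont_differentiable_linear_compose[OF bounded_linear_mult_left
              times_cont_differentiable_add[OF Suc.IH
                times_cont_differentiable_linear_compose[OF bounded_linear_mult_right Suc.IH]]])
    qed
  qed
qed

text \<open>The step is the normalized primitive of the bump
  \<open>flat 0 x * flat 0 (1 - x)\<close>. It is used for cutoffs in time: the rescaled
  \<open>S\<close> switches an interval on or off, and the rescaled \<beta> averages over a short
  interval at its end.\<close>

lemma smooth_step_exists:
  obtains S \<beta> :: "real \<Rightarrow> real" where
    "smooth S" "\<And>x. (S has_real_derivative \<beta> x) (at x)" "\<And>x. 0 \<le> \<beta> x"
    "\<And>x. x \<le> 0 \<Longrightarrow> S x = 0" "\<And>x. 1 \<le> x \<Longrightarrow> S x = 1"
    "\<And>x. x \<notin> {0<..<1} \<Longrightarrow> \<beta> x = 0" "continuous_on UNIV \<beta>"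
proof -
  define b where "b x = flat 0 x * flat 0 (1 - x)" for x
  have "smooth (\<lambda>x. 1 + - x :: real)"
    by (rule smooth_add[OF smooth_const smooth_bounded_linear]) (rule bounded_linear_minus[OF bounded_linear_ident])
  then have sb: "smooth b" unfolding b_def
    using smooth_bilinear[OF bounded_bilinear_mult smooth_flat[of 0]
        smooth_compose_real[OF smooth_flat[of 0]]] by simp
  have cb: "continuous_on S b" for S by (rule smooth_continuous[OF sb])
  define F where "F u = (LBINT y=ereal 0..ereal u. b y)" for u :: real
  have dF: "(F has_real_derivative b x) (at x)" for x
  proof -
    \<comment> \<open>The fundamental theorem gives a derivative within a compact interval; this one
      has \<open>x\<close> in its interior, so the derivative is a full one.\<close>
    have "((\<lambda>u. LBINT y=ereal 0..ereal u. b y) has_vector_derivative b x)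
        (at x within {- \<bar>x\<bar> - 1..\<bar>x\<bar> + 1})"
      by (rule interval_integral_FTC2) (auto intro: cb)
    moreover have "at x within {- \<bar>x\<bar> - 1..\<bar>x\<bar> + 1} = at x"
      by (rule at_within_interior) (auto simp: abs_if)
    ultimately show ?thesis
      unfolding F_def by (simp add: has_real_derivative_iff_has_vector_derivative)
  qed
  have sF: "smooth F" by (rule smooth_real_derivativeI[OF dF sb])
  have b0: "b x = 0" if "x \<notin> {0<..<1}" for x using that by (auto simp: b_def flat_def)
  have bnn: "0 \<le> b x" for x by (simp add: b_def flat_nonneg)
  have const: "F y = F x" if "x \<le> y" "{x..y} \<inter> {0<..<1} = {}" for x y
  proof (cases "x = y")
    case False
    show ?thesis
    proof (rule DERIV_isconst_end[of x y F])
      show "continuous_on {x..y} F" by (rule smooth_continuous[OF sF])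
      show "(F has_real_derivative 0) (at z)" if "x < z" "z < y" for z
      proof -
        have "z \<in> {x..y}" using that by simp
        then have "z \<notin> {0<..<1}" using \<open>{x..y} \<inter> {0<..<1} = {}\<close> by blast
        then have "b z = 0" by (rule b0)
        then show ?thesis using dF[of z] by simp
      qed
    qed (use False that in simp)
  qed simp
  have F0: "F x = 0" if "x \<le> 0" for x
  proof -
    have "F 0 = F x" by (rule const) (use that in auto)
    then show ?thesis by (simp add: F_def)
  qed
  have F1: "F x = F 1" if "1 \<le> x" for x by (rule const) (use that in auto)
  have pos: "0 < F 1"
  proof -
    have "F 0 < F 1"
    proof (rule DERIV_pos_imp_increasing_open[of 0 1 F])
      show "\<exists>y. (F has_real_derivative y) (at x) \<and> 0 < y" if "0 < x" "x < 1" for x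
        using dF[of x] that by (intro exI[of _ "b x"]) (auto simp: b_def flat_def)
      show "continuous_on {0..1} F" by (rule smooth_continuous[OF sF])
    qed simp
    then show ?thesis using F0 by simp
  qed
  show thesis
  proof
    show "smooth (\<lambda>x. F x * inverse (F 1))"
      by (rule smooth_linear_compose[OF bounded_linear_mult_left sF])
    show "((\<lambda>x. F x * inverse (F 1)) has_real_derivative b x * inverse (F 1)) (at x)" for x
      by (rule DERIV_cmult_right[OF dF])
    show "continuous_on UNIV (\<lambda>x. b x * inverse (F 1))"
      by (rule continuous_on_mult_right[OF cb])
    show "F x * inverse (F 1) = 1" if "1 \<le> x" for x using pos by (simp add: F1[OF that])
  qed (use bnn pos F0 b0 in auto)
qed

section \<open>Mollifiers at scale \<epsilon>\<close>

text \<open>Both size bounds are relative to the volume of the \<epsilon>-ball: \<rho> and its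
  derivative are then dominated by \<open>C\<close> and \<open>C / \<epsilon>\<close> times the
  uniform density over which the Besov-VMO modulus averages, with one \<open>C\<close> for all
  scales. Evenness makes convolution self-adjoint and the derivative kernels odd.\<close>

definition mollifier :: "real \<Rightarrow> real \<Rightarrow> ('a::euclidean_space \<Rightarrow> real) \<Rightarrow> bool" where
  "mollifier C \<epsilon> \<rho> \<longleftrightarrow> smooth \<rho> \<and> integrable lborel \<rho> \<and> integral\<^sup>L lborel \<rho> = 1 \<and>
     (\<forall>x. \<rho> (- x) = \<rho> x) \<and> (\<forall>x. \<epsilon> \<le> norm x \<longrightarrow> \<rho> x = 0) \<and>
     (\<forall>x. 0 \<le> \<rho> x \<and> \<rho> x \<le> C / measure lborel (ball (0::'a) \<epsilon>)) \<and>
     (\<forall>x v. \<bar>frechet_derivative \<rho> (at x) v\<bar> \<le> C / (\<epsilon> * measure lborel (ball (0::'a) \<epsilon>)) * norm v)"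

lemma mollifier_exists:
  obtains C where "C > 0" "\<And>\<epsilon>. \<epsilon> > 0 \<Longrightarrow> \<exists>\<rho>::'a::euclidean_space \<Rightarrow> real. mollifier C \<epsilon> \<rho>"
proof -
  \<comment> \<open>\<open>3/4\<close> is the value of \<open>1 - |x|^2 / \<epsilon>^2\<close> on
    the sphere of radius \<open>\<epsilon> / 2\<close>, so \<open>m\<close> bounds the bump from
    below on the ball of half the radius, whose volume is the fraction
    \<open>1 / 2 ^ DIM('a)\<close> of the whole.\<close>
  define m where "m = flat 0 (3/4)"
  have m: "0 < m" by (simp add: m_def flat_def)
  define K where "K = 2 ^ DIM('a) / m"
  have K: "0 < K" using m by (simp add: K_def)
  have "\<exists>\<rho>::'a \<Rightarrow> real. mollifier (4 * K) \<epsilon> \<rho>" if \<epsilon>: "\<epsilon> > 0" for \<epsilon>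
  proof -
    define \<eta> where "\<eta> x = flat 0 (1 + (- inverse (\<epsilon>\<^sup>2)) * (x \<bullet> x))" for x :: 'a
    have sarg: "smooth (\<lambda>x::'a. 1 + (- inverse (\<epsilon>\<^sup>2)) * (x \<bullet> x))"
      by (rule smooth_add[OF smooth_const smooth_linear_compose[OF bounded_linear_mult_right
              smooth_bilinear[OF bounded_bilinear_inner]]])
        (rule smooth_bounded_linear[OF bounded_linear_ident])+
    have s\<eta>: "smooth \<eta>" unfolding \<eta>_def by (rule smooth_compose_real[OF smooth_flat sarg])
    have out: "1 + (- inverse (\<epsilon>\<^sup>2)) * (x \<bullet> x) \<le> 0" if "\<epsilon> \<le> norm x" for x :: 'a
      using power_mono[OF that, of 2] \<epsilon> by (simp add: power2_norm_eq_inner field_simps)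
    have \<eta>0: "\<eta> x = 0" if "\<epsilon> \<le> norm x" for x
      using out[OF that] by (simp add: \<eta>_def flat_def)
    have \<eta>b: "0 \<le> \<eta> x" "\<eta> x \<le> 1" for x by (simp_all add: \<eta>_def flat_nonneg flat_0_le_1)
    have d\<eta>: "frechet_derivative \<eta> (at x) v =
        (- 2 * inverse (\<epsilon>\<^sup>2) * (x \<bullet> v)) * flat 2 (1 + (- inverse (\<epsilon>\<^sup>2)) * (x \<bullet> x))" for x v
    proof -
      have 1: "((\<lambda>x::'a. 1 + (- inverse (\<epsilon>\<^sup>2)) * (x \<bullet> x)) has_derivative
          (\<lambda>v. - 2 * inverse (\<epsilon>\<^sup>2) * (x \<bullet> v))) (at x)"
      proof -
        have "((\<lambda>x::'a. x \<bullet> x) has_derivative (\<lambda>v. x \<bullet> v + v \<bullet> x)) (at x)"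
          by (rule has_derivative_inner[OF has_derivative_ident has_derivative_ident])
        from has_derivative_add[OF has_derivative_const[of 1]
            bounded_linear.has_derivative[OF bounded_linear_mult_right[of "- inverse (\<epsilon>\<^sup>2)"] this]]
        show ?thesis
          by (rule has_derivative_eq_rhs) (simp add: fun_eq_iff inner_commute algebra_simps)
      qed
      have "(flat 0 has_derivative (*) (flat 2 y)) (at y)" for y
        using flat_has_derivative[of 0 y] by (simp add: has_field_derivative_def numeral_2_eq_2)
      from has_derivative_compose[OF 1 this]
      have "(\<eta> has_derivative (\<lambda>v. flat 2 (1 + (- inverse (\<epsilon>\<^sup>2)) * (x \<bullet> x)) *
          (- 2 * inverse (\<epsilon>\<^sup>2) * (x \<bullet> v)))) (at x)"
        unfolding \<eta>_def .
      then show ?thesis by (simp add: frechet_derivative_at[symmetric])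
    qed
    \<comment> \<open>The 4 collects the 2 from the derivative of \<open>x \<bullet> x\<close> and
      the bound 2 of \<open>flat 2\<close>; one of the two factors \<open>1 / \<epsilon>\<close> is
      cancelled by \<open>norm x < \<epsilon>\<close>.\<close>
    have d\<eta>b: "\<bar>frechet_derivative \<eta> (at x) v\<bar> \<le> 4 / \<epsilon> * norm v" for x v
    proof (cases "\<epsilon> \<le> norm x")
      case True
      then show ?thesis using out[OF True] \<epsilon> by (simp add: d\<eta> flat_nonpos)
    next
      case False
      have "\<bar>frechet_derivative \<eta> (at x) v\<bar> \<le> (2 * inverse (\<epsilon>\<^sup>2) * (\<epsilon> * norm v)) * 2"
        unfolding d\<eta> abs_mult
      proof (intro mult_mono)
        have "\<bar>x \<bullet> v\<bar> \<le> norm x * norm v" by (rule Cauchy_Schwarz_ineq2)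
        also have "\<dots> \<le> \<epsilon> * norm v" using False by (intro mult_right_mono) auto
        finally show "\<bar>x \<bullet> v\<bar> \<le> \<epsilon> * norm v" .
      qed (use \<epsilon> flat_2_le_2 flat_nonneg in auto)
      then show ?thesis using \<epsilon> by (simp add: field_simps power2_eq_square)
    qed
    have int: "integrable lborel \<eta>"
    proof -
      have "integrable lborel (\<lambda>x. indicator (cball 0 \<epsilon>) x *\<^sub>R \<eta> x)"
        by (intro borel_integrable_compact smooth_continuous[OF s\<eta>]) auto
      moreover have "(\<lambda>x. indicator (cball 0 \<epsilon>) x *\<^sub>R \<eta> x) = \<eta>"
        using \<eta>0 by (auto simp: indicator_def fun_eq_iff)
      ultimately show ?thesis by simp
    qed
    define B where "B = measure lborel (ball (0::'a) \<epsilon>)"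
    have B: "0 < B" using \<epsilon> by (simp add: B_def content_ball_pos)
    define N where "N = integral\<^sup>L lborel \<eta>"
    have mN: "m * (B / 2 ^ DIM('a)) \<le> N"
    proof -
      have "B / 2 ^ DIM('a) = measure lborel (ball (0::'a) (\<epsilon> / 2))"
        using \<epsilon> content_ball_conv_unit_ball[of \<epsilon> "0::'a"] content_ball_conv_unit_ball[of "\<epsilon>/2" "0::'a"]
        by (simp add: B_def power_divide)
      then have "m * (B / 2 ^ DIM('a)) = (LINT x|lborel. m * indicator (ball (0::'a) (\<epsilon> / 2)) x)"
        by simp
      also have "\<dots> \<le> N" unfolding N_def
      proof (rule integral_mono[OF _ int])
        show "integrable lborel (\<lambda>x. m * indicator (ball (0::'a) (\<epsilon> / 2)) x)"
          by (intro integrable_mult_right integrable_real_indicator emeasure_bounded_finite) auto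
        show "m * indicator (ball 0 (\<epsilon> / 2)) x \<le> \<eta> x" for x
        proof (cases "norm x < \<epsilon> / 2")
          case True
          have "x \<bullet> x \<le> (\<epsilon>/2)\<^sup>2"
            using power_mono[of "norm x" "\<epsilon>/2" 2] True by (simp add: power2_norm_eq_inner)
          then have "3/4 \<le> 1 + (- inverse (\<epsilon>\<^sup>2)) * (x \<bullet> x)"
            using \<epsilon> by (simp add: field_simps power2_eq_square)
          then have "m \<le> \<eta> x"
            using le_imp_inverse_le[of "3/4" "1 + (- inverse (\<epsilon>\<^sup>2)) * (x \<bullet> x)"]
            by (simp add: m_def \<eta>_def flat_def)
          then show ?thesis using \<eta>b[of x] by (auto simp: indicator_def)
        qed (use \<eta>b in \<open>auto simp: indicator_def\<close>)
      qed
      finally show ?thesis .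
    qed
    have "0 < m * (B / 2 ^ DIM('a))" using m B by simp
    with mN have N0: "0 < N" by linarith
    have "1 / N \<le> 1 / (m * (B / 2 ^ DIM('a)))"
      by (rule divide_left_mono[OF mN]) (use m B N0 in auto)
    also have "\<dots> = K / B" by (simp add: K_def)
    finally have N: "0 < N" "1 / N \<le> K / B" using N0 by auto
    define \<rho> where "\<rho> x = \<eta> x * inverse N" for x
    have s\<rho>: "smooth \<rho>"
      unfolding \<rho>_def by (rule smooth_linear_compose[OF bounded_linear_mult_left s\<eta>])
    have d\<rho>: "frechet_derivative \<rho> (at x) v = frechet_derivative \<eta> (at x) v * inverse N" for x v
    proof -
      have "(\<rho> has_derivative (\<lambda>v. frechet_derivative \<eta> (at x) v * inverse N)) (at x)"
        unfolding \<rho>_def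
        by (rule bounded_linear.has_derivative[OF bounded_linear_mult_left smooth_has_derivative[OF s\<eta>]])
      then show ?thesis by (simp add: frechet_derivative_at[symmetric])
    qed
    have "mollifier (4 * K) \<epsilon> \<rho>"
      unfolding mollifier_def B_def[symmetric]
    proof (intro conjI allI impI)
      show "integral\<^sup>L lborel \<rho> = 1"
        unfolding \<rho>_def using N(1) by (simp add: N_def[symmetric])
      show "\<rho> x \<le> 4 * K / B" for x
      proof -
        have "\<rho> x \<le> 1 / N" using \<eta>b[of x] N by (simp add: \<rho>_def field_simps)
        also have "\<dots> \<le> K / B" by (rule N)
        also have "\<dots> \<le> 4 * K / B" using K B by (simp add: divide_right_mono)
        finally show ?thesis .
      qed
      show "\<bar>frechet_derivative \<rho> (at x) v\<bar> \<le> 4 * K / (\<epsilon> * B) * norm v" for x v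
      proof -
        have "\<bar>frechet_derivative \<rho> (at x) v\<bar> \<le> (4 / \<epsilon> * norm v) * (K / B)"
          unfolding d\<rho> abs_mult using N d\<eta>b \<epsilon> by (intro mult_mono) (auto simp: divide_inverse)
        then show ?thesis by (simp add: field_simps)
      qed
      show "integrable lborel \<rho>" unfolding \<rho>_def by (rule integrable_mult_left[OF int])
      show "\<rho> (- x) = \<rho> x" for x by (simp add: \<rho>_def \<eta>_def)
      show "0 \<le> \<rho> x" for x using \<eta>b N by (simp add: \<rho>_def)
      show "\<rho> x = 0" if "\<epsilon> \<le> norm x" for x using \<eta>0[OF that] by (simp add: \<rho>_def)
    qed (rule s\<rho>)
    then show ?thesis by blast
  qed
  then show thesis using that[of "4 * K"] K by auto
qed


subsection \<open>Integration over the torus\<close>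

lemma torus_iff: "x \<in> (torus :: (real ^ 'n) set) \<longleftrightarrow> (\<forall>i. 0 \<le> x $ i \<and> x $ i \<le> 1)"
proof -
  have "(One :: real ^ 'n) $ i = 1" for i
  proof -
    have "(One :: real ^ 'n) \<bullet> axis i (1::real) = 1"
      by (rule inner_sum_Basis) simp
    then show ?thesis by (simp add: inner_axis del: inner_sum_Basis)
  qed
  then show ?thesis by (simp add: mem_box_cart)
qed

lemma torus_iff_split:
  "x \<in> (torus :: (real ^ 'n) set) \<longleftrightarrow>
    (\<forall>j. j \<noteq> i \<longrightarrow> 0 \<le> x $ j \<and> x $ j \<le> 1) \<and> 0 \<le> x $ i \<and> x $ i \<le> 1"
  unfolding torus_iff by metis

lemma AE_lborel_nth_neq: "AE x in (lborel :: (real ^ 'n) measure). x $ i \<noteq> c"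
proof (rule AE_I')
  have "closed {x :: real ^ 'n. x $ i = c}" by (intro closed_Collect_eq continuous_intros)
  then show "{x :: real ^ 'n. x $ i = c} \<in> null_sets lborel"
    using negligible_hyperplane[of "axis i (1::real)" c]
    by (simp add: negligible_iff_null_sets null_sets_completion_iff inner_axis' axis_eq_0_iff)
qed auto

section \<open>Translation and reflection of Lebesgue measure\<close>

lemma distr_lborel_diff: "distr lborel borel (\<lambda>x. c - x) = (lborel :: 'a::euclidean_space measure)"
  using lborel_affine[where c = "-1" and t = c] by (simp add: density_1)

lemma distr_lborel_add: "distr lborel borel (\<lambda>x. x + c) = (lborel :: 'a::euclidean_space measure)"
proof -
  have "(\<lambda>x. x + c) = (+) c" by (simp add: fun_eq_iff add.commute)
  then show ?thesis using lborel_distr_plus[of c] by simp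
qed

lemma nn_integral_lborel_diff:
  fixes f :: "'a::euclidean_space \<Rightarrow> ennreal"
  assumes [measurable]: "f \<in> borel_measurable borel"
  shows "(\<integral>\<^sup>+x. f (c - x) \<partial>lborel) = (\<integral>\<^sup>+x. f x \<partial>lborel)"
  by (subst (2) distr_lborel_diff[of c, symmetric]) (simp add: nn_integral_distr)

lemma nn_integral_lborel_add:
  fixes f :: "'a::euclidean_space \<Rightarrow> ennreal"
  assumes [measurable]: "f \<in> borel_measurable borel"
  shows "(\<integral>\<^sup>+x. f (x + c) \<partial>lborel) = (\<integral>\<^sup>+x. f x \<partial>lborel)"
  by (subst (2) distr_lborel_add[of c, symmetric]) (simp add: nn_integral_distr)

lemma integral_lborel_diff:
  fixes f :: "'a::euclidean_space \<Rightarrow> 'b::{banach, second_countable_topology}"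
  assumes [measurable]: "f \<in> borel_measurable borel"
  shows "(LINT x|lborel. f (c - x)) = (LINT x|lborel. f x)"
  by (subst (2) distr_lborel_diff[of c, symmetric]) (simp add: integral_distr)

lemma integrable_lborel_diff:
  fixes f :: "'a::euclidean_space \<Rightarrow> 'b::{banach, second_countable_topology}"
  assumes [measurable]: "f \<in> borel_measurable borel"
  shows "integrable lborel (\<lambda>x. f (c - x)) \<longleftrightarrow> integrable lborel f"
  by (subst (2) distr_lborel_diff[of c, symmetric]) (simp add: integrable_distr_eq)

section \<open>The torus measure and its invariance under translation\<close>

text \<open>Lebesgue measure on the closed unit cube, as a finite measure on the whole space. A
  density leaves the Borel sets unchanged, so measurability and Fubini arguments do not see the
  cube; opposite faces, identified in the quotient, are null.\<close>

definition torus_measure :: "(real ^ 'n) measure" (\<open>\<mu>\<close>) where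
  "\<mu> = density lborel (\<lambda>x. ennreal (indicator torus x))"

lemma sets_torus_measure [simp, measurable_cong]: "sets \<mu> = sets borel"
  by (simp add: torus_measure_def)

lemma space_torus_measure [simp]: "space \<mu> = UNIV"
  by (simp add: torus_measure_def)

lemma prob_torus_measure: "emeasure \<mu> (UNIV :: (real ^ 'n) set) = 1"
proof -
  have "emeasure \<mu> (UNIV :: (real ^ 'n) set) = emeasure lborel (torus :: (real ^ 'n) set)"
    by (simp add: torus_measure_def emeasure_density ennreal_indicator)
  also have "\<dots> = 1" by (simp add: emeasure_lborel_cbox_eq)
  finally show ?thesis .
qed

interpretation torus_measure: finite_measure \<mu>
  by standard (simp add: prob_torus_measure)

interpretation torus_lborel: pair_sigma_finite \<mu> lborel
  by standard

lemma nn_integral_torus_measure: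
  assumes [measurable]: "f \<in> borel_measurable borel"
  shows "(\<integral>\<^sup>+x. f x \<partial>\<mu>) = (\<integral>\<^sup>+x. f x * indicator torus x \<partial>lborel)"
  by (simp add: torus_measure_def nn_integral_density ennreal_indicator mult.commute)

lemma integral_torus_measure:
  fixes f :: "real ^ 'n \<Rightarrow> 'b::{banach, second_countable_topology}"
  assumes "f \<in> borel_measurable borel"
  shows "integral\<^sup>L \<mu> f = (LINT x:torus|lborel. f x)"
  using assms by (simp add: torus_measure_def integral_density set_lebesgue_integral_def)

lemma integrable_torus_measure:
  fixes f :: "real ^ 'n \<Rightarrow> 'b::{banach, second_countable_topology}"
  assumes "f \<in> borel_measurable borel"
  shows "integrable \<mu> f \<longleftrightarrow> set_integrable lborel torus f"
  using assms by (simp add: torus_measure_def integrable_density set_integrable_def)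

lemma periodic_int:
  assumes "periodic g"
  shows "g (x + of_int n *\<^sub>R axis i 1) = g x"
proof (induction n arbitrary: x rule: int_induct[where k = 0])
  case (step1 n)
  have "g (x + of_int (n + 1) *\<^sub>R axis i 1) = g ((x + of_int n *\<^sub>R axis i 1) + axis i 1)"
    by (simp add: scaleR_add_left add.assoc)
  then show ?case using assms step1 by (simp add: periodic_def)
next
  case (step2 n)
  have "g (x + of_int (n - 1) *\<^sub>R axis i 1) = g ((x + of_int (n - 1) *\<^sub>R axis i 1) + axis i 1)"
    using assms by (simp add: periodic_def)
  also have "(x + of_int (n - 1) *\<^sub>R axis i 1) + axis i 1 = x + of_int n *\<^sub>R axis i 1"
    by (simp add: scaleR_diff_left)
  finally show ?case using step2 by simp
qed simp

lemma periodic_translate: "periodic g \<Longrightarrow> periodic (\<lambda>x. g (x + a))"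
  unfolding periodic_def by (simp add: add.assoc add.commute[of "axis _ _" a]) (simp flip: add.assoc)

lemma vec_sum_axis: "(a :: real ^ 'n) = (\<Sum>i\<in>UNIV. (a $ i) *\<^sub>R axis i 1)"
  using basis_expansion[of a] by (simp add: scalar_mult_eq_scaleR)

lemma periodic_int_vec:
  assumes "periodic g"
  shows "g (x + (\<Sum>i\<in>I. of_int (n i) *\<^sub>R axis i 1)) = g x"
proof (cases "finite I")
  case True
  then show ?thesis
  proof (induction I arbitrary: x)
    case (insert j I)
    have "g (x + (\<Sum>i\<in>insert j I. of_int (n i) *\<^sub>R axis i 1)) =
        g ((x + of_int (n j) *\<^sub>R axis j 1) + (\<Sum>i\<in>I. of_int (n i) *\<^sub>R axis i 1))"
      using insert by (simp add: add.assoc)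
    then show ?case using insert periodic_int[OF assms] by simp
  qed simp
qed simp

text \<open>Subtracting the integer parts of the coordinates gives one representative for all
  periodic functions at once.\<close>

lemma torus_representative:
  obtains z where "z \<in> (torus :: (real ^ 'n) set)"
    "\<And>g :: real ^ 'n \<Rightarrow> 'b. periodic g \<Longrightarrow> g x = g z"
proof
  define z where "z = (\<chi> i. frac (x $ i))"
  show "z \<in> torus" by (simp add: torus_iff z_def frac_ge_0 frac_lt_1 less_imp_le)
  have "x = z + (\<Sum>i\<in>UNIV. of_int \<lfloor>x $ i\<rfloor> *\<^sub>R axis i 1)"
    by (simp add: vec_eq_iff z_def frac_def axis_def if_distrib cong: if_cong)
  then show "g x = g z" if "periodic g" for g :: "real ^ 'n \<Rightarrow> 'b"
    using periodic_int_vec[OF that, of z "\<lambda>i. \<lfloor>x $ i\<rfloor>" UNIV] by simp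
qed

text \<open>The shifted cube is cut at height 1 in the coordinate \<open>i\<close>, and the part
  above is moved down by one period; the two slabs fill the cube again. They overlap only in
  hyperplanes, hence the almost everywhere congruences.\<close>

lemma nn_integral_torus_shift_axis:
  fixes g :: "real ^ 'n \<Rightarrow> ennreal"
  assumes [measurable]: "g \<in> borel_measurable borel" and g: "periodic g" and s: "0 \<le> s" "s \<le> 1"
  shows "(\<integral>\<^sup>+x. g (x + s *\<^sub>R axis i 1) \<partial>\<mu>) = (\<integral>\<^sup>+x. g x \<partial>\<mu>)"
proof -
  define S where "S I = {x :: real ^ 'n. (\<forall>j. j \<noteq> i \<longrightarrow> 0 \<le> x $ j \<and> x $ j \<le> 1) \<and> x $ i \<in> I}" for I
  have S_meas: "S {c..d} \<in> sets borel" for c d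
  proof -
    have "S {c..d} = cbox (\<chi> j. if j = i then c else 0) (\<chi> j. if j = i then d else 1)"
    proof -
      have all: "(\<forall>j. P j) \<longleftrightarrow> (\<forall>j. j \<noteq> i \<longrightarrow> P j) \<and> P i" for P by metis
      show ?thesis
        unfolding set_eq_iff mem_box_cart S_def mem_Collect_eq
        by (subst all) simp
    qed
    then show ?thesis by simp
  qed
  note [measurable] = S_meas[of 0 s] S_meas[of s 1] S_meas[of 1 "1 + s"]
  let ?e = "axis i 1 :: real ^ 'n"
  have "(\<integral>\<^sup>+x. g (x + s *\<^sub>R ?e) \<partial>\<mu>) =
      (\<integral>\<^sup>+x. g (x + s *\<^sub>R ?e) * indicator torus ((x + s *\<^sub>R ?e) - s *\<^sub>R ?e) \<partial>lborel)"
    by (simp add: nn_integral_torus_measure)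
  also have "\<dots> = (\<integral>\<^sup>+x. g x * indicator torus (x - s *\<^sub>R ?e) \<partial>lborel)"
    by (rule nn_integral_lborel_add[of "\<lambda>x. g x * indicator torus (x - s *\<^sub>R ?e)"]) simp
  also have "\<dots> = (\<integral>\<^sup>+x. g x * indicator (S {s..1}) x + g x * indicator (S {1..1+s}) x \<partial>lborel)"
  proof (rule nn_integral_cong_AE)
    show "AE x in lborel. g x * indicator torus (x - s *\<^sub>R ?e) =
        g x * indicator (S {s..1}) x + g x * indicator (S {1..1+s}) x"
      using AE_lborel_nth_neq[of i 1]
    proof eventually_elim
      case (elim x)
      have "x - s *\<^sub>R ?e \<in> torus \<longleftrightarrow> x \<in> S {s..1} \<or> x \<in> S {1..1+s}"
        using s by (auto simp: torus_iff_split[of _ i] S_def axis_def)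
      moreover have "\<not> (x \<in> S {s..1} \<and> x \<in> S {1..1+s})" using elim by (auto simp: S_def)
      ultimately show ?case by (auto simp: indicator_def)
    qed
  qed
  also have "\<dots> = (\<integral>\<^sup>+x. g x * indicator (S {s..1}) x \<partial>lborel) +
      (\<integral>\<^sup>+x. g x * indicator (S {1..1+s}) x \<partial>lborel)"
    by (rule nn_integral_add) auto
  also have "(\<integral>\<^sup>+x. g x * indicator (S {1..1+s}) x \<partial>lborel) =
      (\<integral>\<^sup>+x. g (x + ?e) * indicator (S {1..1+s}) (x + ?e) \<partial>lborel)"
    by (rule nn_integral_lborel_add[symmetric]) simp
  also have "\<dots> = (\<integral>\<^sup>+x. g x * indicator (S {0..s}) x \<partial>lborel)"
  proof (rule nn_integral_cong)
    fix x
    have "x + ?e \<in> S {1..1+s} \<longleftrightarrow> x \<in> S {0..s}"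
      unfolding S_def by (auto simp: axis_def)
    then show "g (x + ?e) * indicator (S {1..1+s}) (x + ?e) = g x * indicator (S {0..s}) x"
      using g by (simp add: periodic_def indicator_def)
  qed
  also have "(\<integral>\<^sup>+x. g x * indicator (S {s..1}) x \<partial>lborel) +
      (\<integral>\<^sup>+x. g x * indicator (S {0..s}) x \<partial>lborel) =
      (\<integral>\<^sup>+x. g x * indicator (S {s..1}) x + g x * indicator (S {0..s}) x \<partial>lborel)"
    by (rule nn_integral_add[symmetric]) auto
  also have "\<dots> = (\<integral>\<^sup>+x. g x * indicator torus x \<partial>lborel)"
  proof (rule nn_integral_cong_AE)
    show "AE x in lborel. g x * indicator (S {s..1}) x + g x * indicator (S {0..s}) x =
        g x * indicator torus x"
      using AE_lborel_nth_neq[of i s]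
    proof eventually_elim
      case (elim x)
      have "x \<in> torus \<longleftrightarrow> x \<in> S {s..1} \<or> x \<in> S {0..s}"
        using s by (auto simp: torus_iff_split[of _ i] S_def)
      moreover have "\<not> (x \<in> S {s..1} \<and> x \<in> S {0..s})" using elim by (auto simp: S_def)
      ultimately show ?case by (auto simp: indicator_def)
    qed
  qed
  finally show ?thesis by (simp add: nn_integral_torus_measure)
qed

text \<open>A full period changes nothing, so each coordinate of the shift reduces to its fractional
  part, and the coordinates are treated one after another. Nonnegative integrands come first since
  they raise no question of integrability.\<close>

lemma nn_integral_torus_shift:
  fixes g :: "real ^ 'n \<Rightarrow> ennreal"
  assumes "g \<in> borel_measurable borel" and "periodic g"
  shows "(\<integral>\<^sup>+x. g (x + a) \<partial>\<mu>) = (\<integral>\<^sup>+x. g x \<partial>\<mu>)"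
proof -
  have axis: "(\<integral>\<^sup>+x. g (x + s *\<^sub>R axis i 1) \<partial>\<mu>) = (\<integral>\<^sup>+x. g x \<partial>\<mu>)"
    if g: "g \<in> borel_measurable borel" "periodic g" for g :: "real ^ 'n \<Rightarrow> ennreal" and s i
  proof -
    have "g (x + s *\<^sub>R axis i 1) = g (x + frac s *\<^sub>R axis i 1)" for x
      using periodic_int[OF g(2), of "x + frac s *\<^sub>R axis i 1" "\<lfloor>s\<rfloor>" i]
      by (simp add: frac_def add.assoc flip: scaleR_add_left)
    then show ?thesis
      using nn_integral_torus_shift_axis[OF g, of "frac s" i]
      by (simp add: frac_ge_0 frac_lt_1 less_imp_le)
  qed
  have "(\<integral>\<^sup>+x. g (x + (\<Sum>i\<in>I. (a $ i) *\<^sub>R axis i 1)) \<partial>\<mu>) = (\<integral>\<^sup>+x. g x \<partial>\<mu>)"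
    if "finite I" for I
    using that
  proof (induction I)
    case (insert j I)
    let ?b = "\<Sum>i\<in>I. (a $ i) *\<^sub>R axis i 1 :: real ^ 'n"
    have "(\<integral>\<^sup>+x. g (x + (\<Sum>i\<in>insert j I. (a $ i) *\<^sub>R axis i 1)) \<partial>\<mu>) =
        (\<integral>\<^sup>+x. g ((x + (a $ j) *\<^sub>R axis j 1) + ?b) \<partial>\<mu>)"
      using insert by (simp add: add.assoc)
    also have "\<dots> = (\<integral>\<^sup>+x. g (x + ?b) \<partial>\<mu>)"
      by (rule axis[of "\<lambda>x. g (x + ?b)"]) (use assms periodic_translate in auto)
    finally show ?case using insert by simp
  qed simp
  from this[OF finite_class.finite_UNIV] show ?thesis using vec_sum_axis[of a] by simp
qed

lemma torus_shift:
  fixes g :: "real ^ 'n \<Rightarrow> real"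
  assumes [measurable]: "g \<in> borel_measurable borel" and g: "periodic g"
  shows integrable_torus_shift: "integrable \<mu> (\<lambda>x. g (x + a)) \<longleftrightarrow> integrable \<mu> g"
    and integral_torus_shift: "(LINT x|\<mu>. g (x + a)) = (LINT x|\<mu>. g x)"
proof -
  have *: "(\<integral>\<^sup>+x. ennreal (f (g (x + a))) \<partial>\<mu>) = (\<integral>\<^sup>+x. ennreal (f (g x)) \<partial>\<mu>)"
    if [measurable]: "f \<in> borel_measurable borel" for f :: "real \<Rightarrow> real"
    by (rule nn_integral_torus_shift[of "\<lambda>x. ennreal (f (g x))"]) (use g in \<open>auto simp: periodic_def\<close>)
  show i: "integrable \<mu> (\<lambda>x. g (x + a)) \<longleftrightarrow> integrable \<mu> g"
    using *[of norm] by (simp add: integrable_iff_bounded)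
  show "(LINT x|\<mu>. g (x + a)) = (LINT x|\<mu>. g x)"
  proof (cases "integrable \<mu> g")
    case True
    then show ?thesis
      using i *[of "\<lambda>x. x"] *[of uminus] by (simp add: real_lebesgue_integral_def)
  next
    case False
    then show ?thesis using i by (simp add: not_integrable_integral_eq)
  qed
qed


subsection \<open>Convolution on the torus\<close>

text \<open>Tonelli with \<open>x\<close> innermost: for fixed \<open>y\<close> the translation in
  the second argument disappears by periodicity of \<open>q\<close>, and the double integral factors
  into the \<open>L^1\<close> norm of \<open>K\<close> and a bound independent of \<open>y\<close>.
  The additive majorant suits products estimated by Young's inequality.\<close>

lemma kernel_integrable:
  fixes K :: "real ^ 'n \<Rightarrow> real" and \<Theta> :: "real ^ 'n \<Rightarrow> real ^ 'n \<Rightarrow> real"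
  assumes K: "integrable lborel K"
    and [measurable]: "case_prod \<Theta> \<in> borel_measurable (borel \<Otimes>\<^sub>M borel)"
    and bound: "\<And>x z. \<bar>\<Theta> x z\<bar> \<le> p x + q z"
    and p: "integrable \<mu> p" "\<And>x. 0 \<le> p x"
    and q: "integrable \<mu> q" "\<And>x. 0 \<le> q x" "periodic q"
  shows "integrable (\<mu> \<Otimes>\<^sub>M lborel) (\<lambda>(x, y). K y * \<Theta> x (x - y))"
proof (rule integrableI_bounded)
  have [measurable]: "K \<in> borel_measurable borel" "p \<in> borel_measurable borel" "q \<in> borel_measurable borel"
    using borel_measurable_integrable[OF K] borel_measurable_integrable[OF p(1)]
      borel_measurable_integrable[OF q(1)] by simp_all
  show "(\<lambda>(x, y). K y * \<Theta> x (x - y)) \<in> borel_measurable (\<mu> \<Otimes>\<^sub>M lborel)"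
    by measurable
  have "(\<integral>\<^sup>+z. ennreal (norm (case z of (x, y) \<Rightarrow> K y * \<Theta> x (x - y))) \<partial>(\<mu> \<Otimes>\<^sub>M lborel)) =
      (\<integral>\<^sup>+y. (\<integral>\<^sup>+x. ennreal \<bar>K y * \<Theta> x (x - y)\<bar> \<partial>\<mu>) \<partial>lborel)"
    by (subst torus_lborel.nn_integral_snd[symmetric]) (auto simp: split_beta)
  also have "\<dots> \<le> (\<integral>\<^sup>+y. ennreal \<bar>K y\<bar> *
      ((\<integral>\<^sup>+x. ennreal (p x) \<partial>\<mu>) + (\<integral>\<^sup>+x. ennreal (q x) \<partial>\<mu>)) \<partial>lborel)"
  proof (rule nn_integral_mono)
    fix y
    have "(\<integral>\<^sup>+x. ennreal \<bar>K y * \<Theta> x (x - y)\<bar> \<partial>\<mu>) \<le>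
        (\<integral>\<^sup>+x. ennreal \<bar>K y\<bar> * (ennreal (p x) + ennreal (q (x + - y))) \<partial>\<mu>)"
      using bound p q by (intro nn_integral_mono)
        (simp add: abs_mult ennreal_mult mult_left_mono flip: ennreal_plus)
    also have "\<dots> = ennreal \<bar>K y\<bar> *
      ((\<integral>\<^sup>+x. ennreal (p x) \<partial>\<mu>) + (\<integral>\<^sup>+x. ennreal (q (x + - y)) \<partial>\<mu>))"
      by (simp add: nn_integral_cmult nn_integral_add)
    also have "(\<integral>\<^sup>+x. ennreal (q (x + - y)) \<partial>\<mu>) = (\<integral>\<^sup>+x. ennreal (q x) \<partial>\<mu>)"
      by (rule nn_integral_torus_shift[of "\<lambda>x. ennreal (q x)"]) (use q in \<open>auto simp: periodic_def\<close>)
    finally show "(\<integral>\<^sup>+x. ennreal \<bar>K y * \<Theta> x (x - y)\<bar> \<partial>\<mu>) \<le> ennreal \<bar>K y\<bar> *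
      ((\<integral>\<^sup>+x. ennreal (p x) \<partial>\<mu>) + (\<integral>\<^sup>+x. ennreal (q x) \<partial>\<mu>))" .
  qed
  also have "\<dots> = (\<integral>\<^sup>+y. ennreal \<bar>K y\<bar> \<partial>lborel) *
      ((\<integral>\<^sup>+x. ennreal (p x) \<partial>\<mu>) + (\<integral>\<^sup>+x. ennreal (q x) \<partial>\<mu>))"
    by (rule nn_integral_multc) simp
  also have "\<dots> < \<infinity>"
    using K p q by (auto simp: integrable_iff_bounded ennreal_mult_less_top)
  finally show "(\<integral>\<^sup>+z. ennreal (norm (case z of (x, y) \<Rightarrow> K y * \<Theta> x (x - y)))
      \<partial>(\<mu> \<Otimes>\<^sub>M lborel)) < \<infinity>" .
qed

text \<open>Exchange of the points \<open>x\<close> and \<open>x - y\<close>: after Fubini,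
  translate \<open>x\<close> by \<open>y\<close> and reflect \<open>y\<close>. For even kernels this
  yields self-adjointness, for odd ones the antisymmetry behind integration by parts and behind the
  Hall estimate.\<close>

lemma kernel_swap:
  fixes K :: "real ^ 'n \<Rightarrow> real" and \<Theta> :: "real ^ 'n \<Rightarrow> real ^ 'n \<Rightarrow> real"
  assumes K: "integrable lborel K"
    and M [measurable]: "case_prod \<Theta> \<in> borel_measurable (borel \<Otimes>\<^sub>M borel)"
    and bound: "\<And>x z. \<bar>\<Theta> x z\<bar> \<le> p x + q z"
    and p: "integrable \<mu> p" "\<And>x. 0 \<le> p x" "periodic p"
    and q: "integrable \<mu> q" "\<And>x. 0 \<le> q x" "periodic q"
    and per: "\<And>x z i. \<Theta> (x + axis i 1) (z + axis i 1) = \<Theta> x z"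
  shows "(LINT x|\<mu>. (LINT y|lborel. K y * \<Theta> x (x - y))) =
    (LINT x|\<mu>. (LINT y|lborel. K (- y) * \<Theta> (x - y) x))"
proof -
  have mK [measurable]: "K \<in> borel_measurable borel"
    using borel_measurable_integrable[OF K] by simp
  have K': "integrable lborel (\<lambda>y. K (- y))"
    using integrable_lborel_diff[of K 0] K by simp
  have M' [measurable]: "(\<lambda>(x, z). \<Theta> z x) \<in> borel_measurable (borel \<Otimes>\<^sub>M borel)"
    by measurable
  have "(LINT x|\<mu>. (LINT y|lborel. K y * \<Theta> x (x - y))) =
      (LINT y|lborel. (LINT x|\<mu>. K y * \<Theta> x (x - y)))"
    by (rule torus_lborel.Fubini_integral[symmetric])
      (rule kernel_integrable[OF K M bound p(1,2) q])
  also have "\<dots> = (LINT y|lborel. (LINT x|\<mu>. K y * \<Theta> (x + y) x))"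
  proof (rule Bochner_Integration.integral_cong[OF refl])
    fix y
    have "(LINT x|\<mu>. K y * \<Theta> (x + y) ((x + y) - y)) = (LINT x|\<mu>. K y * \<Theta> x (x - y))"
      by (rule integral_torus_shift[of "\<lambda>x. K y * \<Theta> x (x - y)"])
        (use per[of _ _ "_ - y"] in \<open>auto simp: periodic_def diff_add_eq[symmetric] per\<close>)
    then show "(LINT x|\<mu>. K y * \<Theta> x (x - y)) = (LINT x|\<mu>. K y * \<Theta> (x + y) x)"
      unfolding add_diff_cancel_right' by (rule sym)
  qed
  also have "\<dots> = (LINT y|lborel. (LINT x|\<mu>. K (- y) * \<Theta> (x - y) x))"
  proof -
    have "(\<lambda>y. \<integral>x. K y * \<Theta> (x + y) x \<partial>\<mu>) \<in> borel_measurable borel"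
      by measurable
    from integral_lborel_diff[OF this, of 0] show ?thesis by simp
  qed
  also have "\<dots> = (LINT x|\<mu>. (LINT y|lborel. K (- y) * \<Theta> (x - y) x))"
  proof (rule torus_lborel.Fubini_integral)
    show "integrable (\<mu> \<Otimes>\<^sub>M lborel) (\<lambda>(x, y). K (- y) * \<Theta> (x - y) x)"
      by (rule kernel_integrable[OF K' M', of q p])
        (use bound p q in \<open>auto simp: add.commute\<close>)
  qed
  finally show ?thesis .
qed

section \<open>Convolution of periodic functions with kernels of small support\<close>

definition conv :: "(real ^ 'n \<Rightarrow> real) \<Rightarrow> (real ^ 'n \<Rightarrow> 'b::euclidean_space) \<Rightarrow> real ^ 'n \<Rightarrow> 'b" where
  "conv K f x = (LINT y|lborel. K y *\<^sub>R f (x - y))"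

text \<open>The support stays strictly inside the ball of radius \<open>1/4\<close>: the gap lets
  derivative kernels keep the same support, and a kernel shifted by less than \<open>1/4\<close>
  still lives in the ball of radius \<open>1/2\<close>, hence in one period cell. The kernel is not
  periodized; periodicity sits in the convolved function.\<close>

definition kernel :: "(real ^ 'n \<Rightarrow> real) \<Rightarrow> bool" where
  "kernel K \<longleftrightarrow> smooth K \<and> (\<exists>r<1/4. \<forall>y. r < norm y \<longrightarrow> K y = 0)"

definition torus_L1 :: "(real ^ 'n \<Rightarrow> 'b::euclidean_space) \<Rightarrow> bool" where
  "torus_L1 f \<longleftrightarrow> f \<in> borel_measurable borel \<and> periodic f \<and> integrable \<mu> f"

lemma torus_L1D:
  assumes "torus_L1 f"
  shows "f \<in> borel_measurable borel" "periodic f" "integrable \<mu> f"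
  using assms by (simp_all add: torus_L1_def)

text \<open>The ball of radius \<open>1/2\<close> lies in a cube of side 1, so the support meets
  each point of the torus essentially at most once, and the integral over the whole space is
  controlled by the one over the torus.\<close>

lemma conv_integrable_bound:
  fixes f :: "real ^ 'n \<Rightarrow> 'b::euclidean_space"
  assumes [measurable]: "K \<in> borel_measurable borel" and B: "\<And>y. \<bar>K y\<bar> \<le> B"
    and supp: "\<And>y. 1/2 < norm y \<Longrightarrow> K y = 0" and f: "torus_L1 f"
  shows "integrable lborel (\<lambda>y. K y *\<^sub>R f (x - y))"
    and "norm (conv K f x) \<le> B * (LINT x|\<mu>. norm (f x))"
proof -
  note [measurable] = torus_L1D(1)[OF f]
  have B0: "0 \<le> B" using B[of 0] by linarith
  let ?h = "(\<chi> i. 1/2) :: real ^ 'n"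
  have "(\<integral>\<^sup>+y. ennreal (norm (K y *\<^sub>R f (x - y))) \<partial>lborel) \<le>
      (\<integral>\<^sup>+y. ennreal B * (ennreal (norm (f (?h - y + (x - ?h)))) * indicator torus (?h - y)) \<partial>lborel)"
  proof (rule nn_integral_mono)
    fix y
    show "ennreal (norm (K y *\<^sub>R f (x - y))) \<le>
        ennreal B * (ennreal (norm (f (?h - y + (x - ?h)))) * indicator torus (?h - y))"
    proof (cases "1/2 < norm y")
      case False
      have "?h - y \<in> torus"
        unfolding torus_iff
      proof
        fix i
        have "\<bar>y $ i\<bar> \<le> 1/2" using component_le_norm_cart[of y i] False by linarith
        moreover have "(?h - y) $ i = 1/2 - y $ i" by simp
        ultimately show "0 \<le> (?h - y) $ i \<and> (?h - y) $ i \<le> 1" by linarith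
      qed
      moreover have "ennreal (norm (K y *\<^sub>R f (x - y))) \<le> ennreal (B * norm (f (x - y)))"
        using B[of y] by (intro ennreal_leI) (simp add: mult_right_mono)
      ultimately show ?thesis using B0 by (simp add: ennreal_mult)
    qed (simp add: supp)
  qed
  also have "\<dots> = (\<integral>\<^sup>+w. ennreal B * (ennreal (norm (f (w + (x - ?h)))) * indicator torus w) \<partial>lborel)"
    by (rule nn_integral_lborel_diff[of "\<lambda>w. ennreal B * (ennreal (norm (f (w + (x - ?h)))) * indicator torus w)"])
      simp
  also have "\<dots> = ennreal B * (\<integral>\<^sup>+w. ennreal (norm (f (w + (x - ?h)))) \<partial>\<mu>)"
    by (simp add: nn_integral_cmult nn_integral_torus_measure)
  also have "(\<integral>\<^sup>+w. ennreal (norm (f (w + (x - ?h)))) \<partial>\<mu>) =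
      (\<integral>\<^sup>+w. ennreal (norm (f w)) \<partial>\<mu>)"
    by (rule nn_integral_torus_shift[of "\<lambda>w. ennreal (norm (f w))"])
      (use torus_L1D(2)[OF f] in \<open>auto simp: periodic_def\<close>)
  also have "\<dots> = ennreal (LINT w|\<mu>. norm (f w))"
    by (rule nn_integral_eq_integral) (use torus_L1D(3)[OF f] in auto)
  finally have *: "(\<integral>\<^sup>+y. ennreal (norm (K y *\<^sub>R f (x - y))) \<partial>lborel) \<le>
      ennreal (B * (LINT w|\<mu>. norm (f w)))"
    using B0 by (simp add: ennreal_mult)
  show 1: "integrable lborel (\<lambda>y. K y *\<^sub>R f (x - y))"
  proof (rule integrableI_bounded)
    show "(\<integral>\<^sup>+y. ennreal (norm (K y *\<^sub>R f (x - y))) \<partial>lborel) < \<infinity>"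
      using * by (rule order_le_less_trans) simp
  qed simp
  have "ennreal (norm (conv K f x)) \<le> (\<integral>\<^sup>+y. ennreal (norm (K y *\<^sub>R f (x - y))) \<partial>lborel)"
    unfolding conv_def by (rule integral_norm_bound_ennreal[OF 1])
  with * have "ennreal (norm (conv K f x)) \<le> ennreal (B * (LINT w|\<mu>. norm (f w)))"
    by (rule order_trans[rotated])
  then show "norm (conv K f x) \<le> B * (LINT x|\<mu>. norm (f x))"
    using B0 by (simp add: ennreal_le_iff)
qed

lemma mollifier_kernel:
  assumes "mollifier C \<epsilon> \<rho>" "\<epsilon> < 1/4" shows "kernel \<rho>"
proof -
  have "smooth \<rho>" "\<forall>y. \<epsilon> < norm y \<longrightarrow> \<rho> y = 0" using assms(1) unfolding mollifier_def by auto
  then show ?thesis unfolding kernel_def using assms(2) by blast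
qed

lemma kernel_smooth: "kernel K \<Longrightarrow> smooth K"
  by (simp add: kernel_def)

lemma kernel_measurable: "kernel K \<Longrightarrow> K \<in> borel_measurable borel"
  by (rule borel_measurable_continuous_onI[OF smooth_continuous[OF kernel_smooth]])

lemma kernel_support:
  assumes "kernel K" "1/4 \<le> norm y" shows "K y = 0"
proof -
  from assms(1) obtain r where "r < 1/4" "\<forall>y. r < norm y \<longrightarrow> K y = 0"
    unfolding kernel_def by blast
  with assms(2) show ?thesis by simp
qed

lemma kernel_bounded:
  assumes "kernel K" obtains B where "0 \<le> B" "\<And>y. \<bar>K y\<bar> \<le> B"
proof -
  have "compact (K ` cball 0 1)"
    by (intro compact_continuous_image smooth_continuous kernel_smooth assms compact_cball)
  from compact_imp_bounded[OF this] obtain B where B: "\<forall>z\<in>K ` cball 0 1. norm z \<le> B"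
    unfolding bounded_iff by blast
  have "\<bar>K y\<bar> \<le> \<bar>B\<bar>" for y
  proof (cases "norm y \<le> 1")
    case True
    then show ?thesis using B[rule_format, of "K y"] by auto
  qed (use kernel_support[OF assms, of y] in simp)
  then show thesis using that[of "\<bar>B\<bar>"] by simp
qed

lemma kernel_lborel_integrable:
  assumes "kernel K" shows "integrable lborel K"
proof -
  have "integrable lborel (\<lambda>x. indicator (cball 0 1) x *\<^sub>R K x)"
    by (intro borel_integrable_compact smooth_continuous kernel_smooth assms compact_cball)
  moreover have "(\<lambda>x. indicator (cball 0 1) x *\<^sub>R K x) = K"
    using kernel_support[OF assms] by (auto simp: indicator_def fun_eq_iff)
  ultimately show ?thesis by simp
qed

lemma kernel_frechet:
  assumes "kernel K" shows "kernel (\<lambda>y. frechet_derivative K (at y) v)"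
proof -
  from assms obtain r where r: "r < 1/4" "\<And>y. r < norm y \<Longrightarrow> K y = 0"
    unfolding kernel_def by blast
  have "frechet_derivative K (at y) v = 0" if "r < norm y" for y
  proof -
    have "open {y::real ^ 'a. r < norm y}" by (intro open_Collect_less continuous_intros)
    then have "(K has_derivative (\<lambda>v. 0)) (at y)"
      by (rule has_derivative_transform_within_open[OF has_derivative_const[of 0]])
        (use that r in auto)
    then show ?thesis by (simp add: frechet_derivative_at[symmetric])
  qed
  then show ?thesis
    using r(1) smooth_frechet_derivative[OF kernel_smooth[OF assms]] unfolding kernel_def by blast
qed

lemma conv_integrable:
  assumes "kernel K" "torus_L1 f"
  shows "integrable lborel (\<lambda>y. K y *\<^sub>R f (x - y))"
proof -
  obtain B where "\<And>y. \<bar>K y\<bar> \<le> B" using kernel_bounded[OF assms(1)] by blast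
  then show ?thesis
    using assms by (intro conv_integrable_bound(1)[of K B]) (auto simp: kernel_measurable kernel_support)
qed

lemma conv_bound:
  assumes "kernel K" "torus_L1 f" "\<And>y. \<bar>K y\<bar> \<le> B"
  shows "norm (conv K f x) \<le> B * (LINT x|\<mu>. norm (f x))"
  using assms by (intro conv_integrable_bound(2)) (auto simp: kernel_measurable kernel_support)

text \<open>Kernel mass one turns the mollification error into an average of increments, the form in
  which the regularity of \<open>h\<close> is given.\<close>

lemma conv_increment:
  fixes g :: "real ^ 'n \<Rightarrow> 'b::euclidean_space"
  assumes K: "kernel K" "integral\<^sup>L lborel K = 1" and g: "torus_L1 g"
  shows "v \<bullet> conv K g x - v \<bullet> g x = (LINT y|lborel. K y * (v \<bullet> (g (x - y) - g x)))"
proof -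
  have i1: "integrable lborel (\<lambda>y. K y *\<^sub>R g (x - y))" by (rule conv_integrable[OF K(1) g])
  have i2: "integrable lborel (\<lambda>y. K y *\<^sub>R g x)" using kernel_lborel_integrable[OF K(1)] by simp
  have "conv K g x - g x = (LINT y|lborel. K y *\<^sub>R (g (x - y) - g x))"
    using i1 i2 K kernel_lborel_integrable[OF K(1)] by (simp add: conv_def scaleR_diff_right)
  then have "v \<bullet> (conv K g x - g x) = v \<bullet> (LINT y|lborel. K y *\<^sub>R (g (x - y) - g x))"
    by (rule arg_cong)
  also have "\<dots> = (LINT y|lborel. v \<bullet> (K y *\<^sub>R (g (x - y) - g x)))"
    by (rule integral_inner_right[symmetric]) (use i1 i2 in \<open>simp add: scaleR_diff_right\<close>)
  finally show ?thesis by (simp add: inner_diff_right)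
qed

lemma conv_diff:
  assumes "kernel K" "torus_L1 f" "torus_L1 g"
  shows "conv K (\<lambda>x. f x - g x) x = conv K f x - conv K g x"
  unfolding conv_def scaleR_diff_right
  by (rule Bochner_Integration.integral_diff) (intro conv_integrable assms)+

lemma conv_alt:
  assumes "K \<in> borel_measurable borel" "torus_L1 f"
  shows "conv K f x = (LINT z|lborel. K (x - z) *\<^sub>R f z)"
    and "integrable lborel (\<lambda>y. K y *\<^sub>R f (x - y)) \<longleftrightarrow> integrable lborel (\<lambda>z. K (x - z) *\<^sub>R f z)"
proof -
  note [measurable] = assms(1) torus_L1D(1)[OF assms(2)]
  have m: "(\<lambda>y. K y *\<^sub>R f (x - y)) \<in> borel_measurable borel" by simp
  show "conv K f x = (LINT z|lborel. K (x - z) *\<^sub>R f z)"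
    unfolding conv_def using integral_lborel_diff[OF m, of x] by simp
  show "integrable lborel (\<lambda>y. K y *\<^sub>R f (x - y)) \<longleftrightarrow> integrable lborel (\<lambda>z. K (x - z) *\<^sub>R f z)"
    using integrable_lborel_diff[OF m, of x] by simp
qed

text \<open>The shift of the argument is moved to the kernel, since only the kernel can be
  differentiated. Integrability is stated separately because the shifted kernel may leave the ball
  of radius \<open>1/4\<close>.\<close>

lemma conv_translate:
  assumes "kernel K" "torus_L1 f"
  shows "conv K f (x + v) = conv (\<lambda>w. K (w + v)) f x"
    and "integrable lborel (\<lambda>y. K (y + v) *\<^sub>R f (x - y))"
proof -
  note [measurable] = kernel_measurable[OF assms(1)]
  have m: "(\<lambda>w. K (w + v)) \<in> borel_measurable borel" by simp
  have e: "K (x + v - z) = K (x - z + v)" for z by (simp add: algebra_simps)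
  show "conv K f (x + v) = conv (\<lambda>w. K (w + v)) f x"
    unfolding conv_alt(1)[OF m assms(2)] conv_alt(1)[OF kernel_measurable[OF assms(1)] assms(2)]
    by (simp add: e)
  show "integrable lborel (\<lambda>y. K (y + v) *\<^sub>R f (x - y))"
    using conv_integrable[OF assms, of "x + v"]
    unfolding conv_alt(2)[OF m assms(2)] conv_alt(2)[OF kernel_measurable[OF assms(1)] assms(2)]
    by (simp add: e)
qed

lemma periodic_conv: "periodic f \<Longrightarrow> periodic (conv K f)"
  unfolding periodic_def conv_def
proof (intro allI)
  fix x i assume "\<forall>x i. f (x + axis i 1) = f x"
  then have "f (x + axis i 1 - y) = f (x - y)" for y
    by (simp add: diff_add_eq[symmetric])
  then show "(LINT y|lborel. K y *\<^sub>R f (x + axis i 1 - y)) = (LINT y|lborel. K y *\<^sub>R f (x - y))"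
    by simp
qed

section \<open>Differentiation of convolutions\<close>

lemma frechet_inner_gradient:
  fixes K :: "'a::euclidean_space \<Rightarrow> real"
  assumes "smooth K"
  shows "frechet_derivative K (at y) v = (\<Sum>b\<in>Basis. frechet_derivative K (at y) b *\<^sub>R b) \<bullet> v"
proof -
  have lin: "linear (frechet_derivative K (at y))"
    using smooth_has_derivative[OF assms] has_derivative_linear by blast
  have "frechet_derivative K (at y) v = frechet_derivative K (at y) (\<Sum>b\<in>Basis. (v \<bullet> b) *\<^sub>R b)"
    by (simp add: euclidean_representation)
  also have "\<dots> = (\<Sum>b\<in>Basis. (v \<bullet> b) *\<^sub>R frechet_derivative K (at y) b)"
    by (simp add: linear_sum[OF lin] linear_scale[OF lin])
  finally show ?thesis by (simp add: inner_sum_left inner_commute[of v] mult.commute)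
qed

text \<open>The gradient is continuous with compact support, hence uniformly continuous; the mean
  value theorem along the segment from \<open>w\<close> to \<open>w + v\<close> makes the
  first-order expansion uniform in \<open>w\<close>.\<close>

lemma kernel_uniform_deriv:
  assumes K: "kernel K" and e: "0 < e"
  shows "\<exists>d>0. \<forall>v w. norm v < d \<longrightarrow>
    \<bar>K (w + v) - K w - frechet_derivative K (at w) v\<bar> \<le> e * norm v"
proof -
  define G where "G y = (\<Sum>b\<in>Basis. frechet_derivative K (at y) b *\<^sub>R b)" for y
  have sK: "smooth K" by (rule kernel_smooth[OF K])
  have GK: "frechet_derivative K (at y) v = G y \<bullet> v" for y v
    unfolding G_def by (rule frechet_inner_gradient[OF sK])
  have "continuous_on S (\<lambda>y. frechet_derivative K (at y) b)" for S b
    by (rule smooth_continuous[OF smooth_frechet_derivative[OF sK]])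
  then have "continuous_on (cball 0 1) G" unfolding G_def by (intro continuous_intros)
  then have "uniformly_continuous_on (cball 0 1) G"
    by (rule compact_uniformly_continuous) simp
  then obtain d where d: "d > 0"
    "\<forall>x\<in>cball 0 1. \<forall>y\<in>cball 0 1. dist y x < d \<longrightarrow> dist (G y) (G x) < e"
    using e unfolding uniformly_continuous_on_def by blast
  have G0: "G y = 0" if "1/4 \<le> norm y" for y
    using kernel_support[OF kernel_frechet[OF K] that] by (simp add: G_def)
  \<comment> \<open>Uniform continuity on the unit ball serves the points near the support. Farther
    out both gradients vanish: a move of less than \<open>1/4\<close> from outside radius
    \<open>1/2\<close> stays outside radius \<open>1/4\<close>.\<close>
  have unif: "norm (G z - G w) \<le> e" if "norm (z - w) < min d (1/4)" for z w
  proof (cases "norm w \<le> 1/2")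
    case True
    have "norm z \<le> norm w + norm (z - w)" using norm_triangle_ineq[of w "z - w"] by simp
    moreover have "norm (z - w) < 1/4" using that by simp
    ultimately have "norm z \<le> 1" using True by linarith
    then show ?thesis using d(2)[rule_format, of w z] True that by (simp add: dist_norm)
  next
    case False
    have "norm w - norm z \<le> norm (z - w)" using norm_triangle_ineq2[of w z] by (simp add: norm_minus_commute)
    with that False have "1/4 \<le> norm z" "1/4 \<le> norm w" by auto
    then show ?thesis using G0 e by simp
  qed
  have "\<bar>K (w + v) - K w - frechet_derivative K (at w) v\<bar> \<le> e * norm v"
    if v: "norm v < min d (1/4)" for v w
  proof -
    define R where "R s = K (w + s *\<^sub>R v) - s * (G w \<bullet> v)" for s
    have "(R has_real_derivative (G (w + s *\<^sub>R v) \<bullet> v - G w \<bullet> v)) (at s)" for s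
    proof -
      have 1: "((\<lambda>s. w + s *\<^sub>R v) has_derivative (\<lambda>h. h *\<^sub>R v)) (at s)"
      proof -
        have "((\<lambda>s. w + s *\<^sub>R v) has_derivative (\<lambda>h. 0 + h *\<^sub>R v)) (at s)"
          by (rule has_derivative_add[OF has_derivative_const
                bounded_linear_imp_has_derivative[OF bounded_linear_scaleR_left]])
        then show ?thesis by simp
      qed
      have "((\<lambda>s. K (w + s *\<^sub>R v)) has_derivative (\<lambda>h. G (w + s *\<^sub>R v) \<bullet> (h *\<^sub>R v))) (at s)"
        using has_derivative_compose[OF 1 smooth_has_derivative[OF sK]] by (simp only: GK)
      moreover have "((\<lambda>s. s * (G w \<bullet> v)) has_derivative (\<lambda>h. h * (G w \<bullet> v))) (at s)"
        by (rule bounded_linear_imp_has_derivative[OF bounded_linear_mult_left])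
      ultimately have "(R has_derivative (\<lambda>h. G (w + s *\<^sub>R v) \<bullet> (h *\<^sub>R v) - h * (G w \<bullet> v))) (at s)"
        unfolding R_def by (rule has_derivative_diff)
      then show ?thesis
        unfolding has_field_derivative_def by (rule has_derivative_eq_rhs) (auto simp: fun_eq_iff algebra_simps)
    qed
    then obtain s where s: "0 < s" "s < 1" "R 1 - R 0 = (1 - 0) * (G (w + s *\<^sub>R v) \<bullet> v - G w \<bullet> v)"
      using MVT2[of 0 1 R "\<lambda>s. G (w + s *\<^sub>R v) \<bullet> v - G w \<bullet> v"] by auto
    have "\<bar>R 1 - R 0\<bar> = \<bar>(G (w + s *\<^sub>R v) - G w) \<bullet> v\<bar>" using s(3) by (simp add: inner_diff_left)
    also have "\<dots> \<le> norm (G (w + s *\<^sub>R v) - G w) * norm v" by (rule Cauchy_Schwarz_ineq2)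
    also have "\<dots> \<le> e * norm v"
    proof (intro mult_right_mono unif)
      have "s * norm v \<le> 1 * norm v" using s by (intro mult_right_mono) auto
      then show "norm (w + s *\<^sub>R v - w) < min d (1/4)" using v s by simp
    qed simp
    finally show ?thesis by (simp add: R_def GK)
  qed
  moreover have "0 < min d (1/4)" using d(1) by simp
  ultimately show ?thesis by blast
qed

text \<open>The remainder of the convolution is the convolution with the remainder of the kernel,
  which is uniformly small and, for \<open>norm v < 1/4\<close>, supported in the ball of radius
  \<open>1/2\<close>. So \<open>f\<close> in \<open>L^1\<close> is enough.\<close>

lemma conv_has_derivative:
  fixes f :: "real ^ 'n \<Rightarrow> 'b::euclidean_space"
  assumes K: "kernel K" and f: "torus_L1 f"
  shows "(conv K f has_derivative (\<lambda>v. conv (\<lambda>y. frechet_derivative K (at y) v) f x)) (at x)"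
  unfolding has_derivative_at_alt
proof (intro conjI allI impI)
  let ?D = "\<lambda>v. conv (\<lambda>y. frechet_derivative K (at y) v) f x"
  have lin: "linear (frechet_derivative K (at y))" for y
    using smooth_has_derivative[OF kernel_smooth[OF K]] has_derivative_linear by blast
  have int: "integrable lborel (\<lambda>y. frechet_derivative K (at y) v *\<^sub>R f (x - y))" for v
    by (rule conv_integrable[OF kernel_frechet[OF K] f])
  have "linear ?D"
  proof (rule linearI)
    show "?D (v + w) = ?D v + ?D w" for v w
      unfolding conv_def linear_add[OF lin] scaleR_add_left
      by (rule Bochner_Integration.integral_add[OF int int])
    show "?D (c *\<^sub>R v) = c *\<^sub>R ?D v" for c v
      unfolding conv_def linear_scale[OF lin] real_scaleR_def
      by (simp only: scaleR_scaleR[symmetric] integral_scaleR_right)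
  qed
  then show "bounded_linear ?D" by (simp add: linear_conv_bounded_linear)
  fix e :: real assume e: "0 < e"
  define N where "N = (LINT x|\<mu>. norm (f x))"
  have N: "0 \<le> N" by (simp add: N_def)
  \<comment> \<open>The added 1 avoids dividing by zero when \<open>f\<close> has norm zero.\<close>
  define e' where "e' = e / (N + 1)"
  have e': "0 < e'" using e N by (simp add: e'_def)
  obtain d where d: "d > 0" "\<And>v w. norm v < d \<Longrightarrow>
      \<bar>K (w + v) - K w - frechet_derivative K (at w) v\<bar> \<le> e' * norm v"
    using kernel_uniform_deriv[OF K e'] by blast
  show "\<exists>d>0. \<forall>y. norm (y - x) < d \<longrightarrow>
      norm (conv K f y - conv K f x - ?D (y - x)) \<le> e * norm (y - x)"
  proof (intro exI[of _ "min d (1/4)"] conjI allI impI)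
    show "0 < min d (1/4)" using d by simp
    fix y assume y: "norm (y - x) < min d (1/4)"
    define v where "v = y - x"
    let ?E = "\<lambda>w. K (w + v) - K w - frechet_derivative K (at w) v"
    note [measurable] = kernel_measurable[OF K] kernel_measurable[OF kernel_frechet[OF K]]
    have a: "conv K f y - conv K f x - ?D v = conv ?E f x"
    proof -
      have "conv K f y = conv (\<lambda>w. K (w + v)) f x"
        using conv_translate(1)[OF K f, of x v] by (simp add: v_def)
      then show ?thesis
        unfolding \<open>conv K f y = _\<close>
        using conv_translate(2)[OF K f, of v x] conv_integrable[OF K f, of x] int[of v]
        unfolding conv_def scaleR_diff_left by simp
    qed
    have "norm (conv ?E f x) \<le> (e' * norm v) * N"
      unfolding N_def
    proof (rule conv_integrable_bound(2))
      show "?E \<in> borel_measurable borel" by measurable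
      show "\<bar>?E w\<bar> \<le> e' * norm v" for w using d(2)[of v w] y by (simp add: v_def)
      show "?E w = 0" if "1/2 < norm w" for w
      proof -
        have "norm w - norm (w + v) \<le> norm v"
          using norm_triangle_ineq2[of w "w + v"] by simp
        then have "1/4 \<le> norm (w + v)" using that y by (simp add: v_def)
        then show ?thesis
          using that kernel_support[OF K, of w] kernel_support[OF K, of "w + v"]
            kernel_support[OF kernel_frechet[OF K], of w] by simp
      qed
    qed (rule f)
    moreover have "e' * norm v * N \<le> e * norm v"
    proof -
      have "e' * N \<le> e" using e N by (simp add: e'_def field_simps)
      from mult_right_mono[OF this norm_ge_zero[of v]] show ?thesis by (simp add: ac_simps)
    qed
    ultimately show "norm (conv K f y - conv K f x - ?D (y - x)) \<le> e * norm (y - x)"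
      unfolding v_def[symmetric] a by linarith
  qed
qed

text \<open>Each derivative is a convolution with a derivative kernel, so the induction runs over
  all kernels.\<close>

lemma smooth_conv:
  assumes K: "kernel K" and f: "torus_L1 f"
  shows "smooth (conv K f)"
  unfolding smooth_def
proof
  fix k
  show "times_cont_differentiable k (conv K f)" using K
  proof (induction k arbitrary: K)
    case 0
    show ?case
      using has_derivative_continuous[OF conv_has_derivative[OF 0 f]]
      by (simp add: continuous_at_imp_continuous_on)
  next
    case (Suc k)
    show ?case
      by (rule times_cont_differentiable_SucI[OF conv_has_derivative[OF Suc.prems f]])
        (rule Suc.IH[OF kernel_frechet[OF Suc.prems]])
  qed
qed

lemma conv_measurable: "kernel K \<Longrightarrow> torus_L1 f \<Longrightarrow> conv K f \<in> borel_measurable borel"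
  by (rule borel_measurable_continuous_onI[OF smooth_continuous[OF smooth_conv]])

lemma conv_nth:
  fixes f :: "real ^ 'n \<Rightarrow> real ^ 'm"
  assumes "kernel K" "torus_L1 f"
  shows "conv K f x $ i = conv K (\<lambda>x. f x $ i) x"
  unfolding conv_def
  using integral_bounded_linear[OF bounded_linear_vec_nth conv_integrable[OF assms]] by simp

lemma partial_conv:
  assumes "kernel K" "torus_L1 f"
  shows "partial k (conv K f) x = conv (\<lambda>y. frechet_derivative K (at y) (axis k 1)) f x"
  unfolding partial_def frechet_derivative_at[OF conv_has_derivative[OF assms], symmetric] ..

lemma torus_L1_nth:
  fixes f :: "real ^ 'n \<Rightarrow> real ^ 'm"
  assumes "torus_L1 f" shows "torus_L1 (\<lambda>x. f x $ i)"
  unfolding torus_L1_def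
proof (intro conjI)
  have "(\<lambda>v :: real ^ 'm. v $ i) \<in> borel_measurable borel"
    by (intro borel_measurable_continuous_onI continuous_intros)
  from measurable_compose[OF torus_L1D(1)[OF assms] this]
  show "(\<lambda>x. f x $ i) \<in> borel_measurable borel" .
  show "periodic (\<lambda>x. f x $ i)" using torus_L1D(2)[OF assms] by (simp add: periodic_def)
  show "integrable \<mu> (\<lambda>x. f x $ i)"
    by (rule integrable_bounded_linear[OF bounded_linear_vec_nth torus_L1D(3)[OF assms]])
qed

lemma partial_conv_nth:
  fixes f :: "real ^ 'n \<Rightarrow> real ^ 'm"
  assumes "kernel K" "torus_L1 f"
  shows "partial k (\<lambda>z. conv K f z $ i) x =
    conv (\<lambda>y. frechet_derivative K (at y) (axis k 1)) (\<lambda>x. f x $ i) x"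
  unfolding conv_nth[OF assms] by (rule partial_conv[OF assms(1) torus_L1_nth[OF assms(2)]])

section \<open>Square-integrable fields and the adjoint of convolution\<close>

lemma powr_numeral_nonneg: "0 \<le> x \<Longrightarrow> x powr numeral n = (x::real) ^ numeral n"
  by (cases "x = 0") (simp_all add: powr_numeral)

lemma torus_Lp_numeral:
  "torus_Lp (numeral n) f \<longleftrightarrow>
    f \<in> borel_measurable borel \<and> periodic f \<and> integrable \<mu> (\<lambda>x. norm (f x) ^ numeral n)"
proof -
  have "set_integrable lborel torus (\<lambda>x. norm (f x) ^ numeral n) \<longleftrightarrow>
      integrable \<mu> (\<lambda>x. norm (f x) ^ numeral n)"
    if [measurable]: "f \<in> borel_measurable borel"
    by (rule integrable_torus_measure[symmetric]) measurable
  then show ?thesis unfolding torus_Lp_def powr_numeral_nonneg[OF norm_ge_zero] by blast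
qed

lemma torus_L2_L1:
  assumes "torus_Lp 2 f" shows "torus_L1 f"
proof -
  have f: "f \<in> borel_measurable borel" "periodic f" "integrable \<mu> (\<lambda>x. (norm (f x))\<^sup>2)"
    using assms by (simp_all add: torus_Lp_numeral)
  have "integrable \<mu> f"
  proof (rule Bochner_Integration.integrable_bound)
    show "integrable \<mu> (\<lambda>x. 1 + (norm (f x))\<^sup>2)" using f(3) by simp
    have "norm (f x) \<le> norm (1 + (norm (f x))\<^sup>2)" for x
    proof -
      have "2 * norm (f x) \<le> 1 + (norm (f x))\<^sup>2"
        using zero_le_power2[of "norm (f x) - 1"] by (simp add: power2_diff algebra_simps)
      with norm_ge_zero[of "f x"] have "norm (f x) \<le> 1 + (norm (f x))\<^sup>2" by linarith
      then show ?thesis by simp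
    qed
    then show "AE x in \<mu>. norm (f x) \<le> norm (1 + (norm (f x))\<^sup>2)" by simp
    show "f \<in> borel_measurable \<mu>" using f(1) by simp
  qed
  then show ?thesis using f by (simp add: torus_L1_def)
qed

lemma continuous_torus_Lp2:
  fixes f :: "real ^ 'n \<Rightarrow> 'b::euclidean_space"
  assumes "continuous_on UNIV f" "periodic f" shows "torus_Lp 2 f"
proof -
  have f: "f \<in> borel_measurable borel" by (rule borel_measurable_continuous_onI[OF assms(1)])
  have "set_integrable lborel (torus :: (real ^ 'n) set) (\<lambda>x. (norm (f x))\<^sup>2)"
    unfolding set_integrable_def
    by (rule borel_integrable_compact) (auto intro!: continuous_intros continuous_on_subset[OF assms(1)])
  moreover have "(\<lambda>x. (norm (f x))\<^sup>2) \<in> borel_measurable borel" using f by simp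
  ultimately have "integrable \<mu> (\<lambda>x. (norm (f x))\<^sup>2)"
    by (simp add: integrable_torus_measure)
  then show ?thesis using f assms by (simp add: torus_Lp_numeral)
qed

lemma inner_le_squares: "\<bar>a \<bullet> b\<bar> \<le> (norm a)\<^sup>2 + (norm b)\<^sup>2" for a b :: "'b::real_inner"
proof -
  have "\<bar>a \<bullet> b\<bar> \<le> norm a * norm b" by (rule Cauchy_Schwarz_ineq2)
  moreover have "2 * (norm a * norm b) \<le> (norm a)\<^sup>2 + (norm b)\<^sup>2"
    using sum_squares_bound[of "norm a" "norm b"] by simp
  moreover have "0 \<le> norm a * norm b" by simp
  ultimately show ?thesis by linarith
qed

lemma integrable_inner_Lp2:
  assumes "torus_Lp 2 f" "torus_Lp 2 g"
  shows "integrable \<mu> (\<lambda>x. f x \<bullet> g x)"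
proof (rule Bochner_Integration.integrable_bound)
  show "integrable \<mu> (\<lambda>x. (norm (f x))\<^sup>2 + (norm (g x))\<^sup>2)"
    using assms by (simp add: torus_Lp_numeral)
  have [measurable]: "f \<in> borel_measurable borel" "g \<in> borel_measurable borel"
    using assms by (simp_all add: torus_Lp_numeral)
  show "(\<lambda>x. f x \<bullet> g x) \<in> borel_measurable \<mu>" by measurable
  have "norm (f x \<bullet> g x) \<le> norm ((norm (f x))\<^sup>2 + (norm (g x))\<^sup>2)" for x
    using inner_le_squares[of "f x" "g x"] by simp
  then show "AE x in \<mu>. norm (f x \<bullet> g x) \<le> norm ((norm (f x))\<^sup>2 + (norm (g x))\<^sup>2)"
    by simp
qed

lemma torus_Lp2_nth:
  fixes f :: "real ^ 'n \<Rightarrow> real ^ 'm"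
  assumes "torus_Lp 2 f" shows "torus_Lp 2 (\<lambda>x. f x $ i)"
proof -
  have L1: "torus_L1 (\<lambda>x. f x $ i)" by (rule torus_L1_nth[OF torus_L2_L1[OF assms]])
  note [measurable] = torus_L1D(1)[OF L1]
  have "integrable \<mu> (\<lambda>x. (norm (f x $ i))\<^sup>2)"
  proof (rule Bochner_Integration.integrable_bound)
    show "integrable \<mu> (\<lambda>x. (norm (f x))\<^sup>2)"
      using assms by (simp add: torus_Lp_numeral)
    have "norm ((norm (f x $ i))\<^sup>2) \<le> norm ((norm (f x))\<^sup>2)" for x
    proof -
      have "(norm (f x $ i))\<^sup>2 \<le> (norm (f x))\<^sup>2" by (rule power_mono) (simp_all add: component_le_norm_cart)
      then show ?thesis by simp
    qed
    then show "AE x in \<mu>. norm ((norm (f x $ i))\<^sup>2) \<le> norm ((norm (f x))\<^sup>2)" by simp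
  qed measurable
  then show ?thesis using torus_L1D[OF L1] by (simp add: torus_Lp_numeral)
qed

lemma torus_Lp2_conv:
  assumes "kernel K" "torus_L1 f" shows "torus_Lp 2 (conv K f)"
  by (intro continuous_torus_Lp2 smooth_continuous[OF smooth_conv] periodic_conv torus_L1D(2) assms)

lemma kernel_reflect:
  assumes "kernel K" shows "kernel (\<lambda>y. K (- y))"
proof -
  have "smooth (\<lambda>y. K (- y))"
    by (rule smooth_compose_linear[OF _ kernel_smooth[OF assms]])
      (rule bounded_linear_minus[OF bounded_linear_ident])
  moreover obtain r where "r < 1/4" "\<And>y. r < norm y \<Longrightarrow> K y = 0"
    using assms unfolding kernel_def by blast
  ultimately show ?thesis unfolding kernel_def by (auto intro!: exI[of _ r])
qed

lemma conv_adjoint: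
  fixes f g :: "real ^ 'n \<Rightarrow> 'b::euclidean_space"
  assumes K: "kernel K" and f: "torus_Lp 2 f" and g: "torus_Lp 2 g"
  shows "(LINT x|\<mu>. f x \<bullet> conv K g x) = (LINT x|\<mu>. conv (\<lambda>y. K (- y)) f x \<bullet> g x)"
proof -
  have fF: "f \<in> borel_measurable borel" "periodic f" "integrable \<mu> (\<lambda>x. (norm (f x))\<^sup>2)"
    and gF: "g \<in> borel_measurable borel" "periodic g" "integrable \<mu> (\<lambda>x. (norm (g x))\<^sup>2)"
    using f g by (simp_all add: torus_Lp_numeral)
  note [measurable] = fF(1) gF(1)
  have 1: "f x \<bullet> conv K g x = (LINT y|lborel. K y * (f x \<bullet> g (x - y)))" for x
    unfolding conv_def
    by (subst integral_inner_right[symmetric])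
      (auto intro: conv_integrable[OF K torus_L2_L1[OF g]] simp: inner_scaleR_right)
  have 2: "conv (\<lambda>y. K (- y)) f x \<bullet> g x = (LINT y|lborel. K (- y) * (f (x - y) \<bullet> g x))" for x
    unfolding conv_def
    by (subst integral_inner_left[symmetric])
      (auto intro: conv_integrable[OF kernel_reflect[OF K] torus_L2_L1[OF f]] simp: inner_scaleR_left)
  show ?thesis unfolding 1 2
  proof (rule kernel_swap[where \<Theta> = "\<lambda>x z. f x \<bullet> g z" and p = "\<lambda>x. (norm (f x))\<^sup>2" and q = "\<lambda>x. (norm (g x))\<^sup>2"])
    show "(\<lambda>(x, z). f x \<bullet> g z) \<in> borel_measurable (borel \<Otimes>\<^sub>M borel)" by measurable
    show "\<bar>f x \<bullet> g z\<bar> \<le> (norm (f x))\<^sup>2 + (norm (g z))\<^sup>2" for x z by (rule inner_le_squares)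
  qed (use fF gF kernel_lborel_integrable[OF K] in \<open>auto simp: periodic_def\<close>)
qed

lemma frechet_derivative_even:
  assumes "smooth K" "\<And>y. K (- y) = K y"
  shows "frechet_derivative K (at (- y)) v = - frechet_derivative K (at y) v"
proof -
  have "((\<lambda>y. K (- y)) has_derivative (\<lambda>v. frechet_derivative K (at (- y)) (- v))) (at y)"
    by (rule has_derivative_compose[OF has_derivative_minus[OF has_derivative_ident]
          smooth_has_derivative[OF assms(1)]])
  then have "(K has_derivative (\<lambda>v. frechet_derivative K (at (- y)) (- v))) (at y)"
    by (simp add: assms(2))
  from frechet_derivative_at[OF this]
  have "frechet_derivative K (at y) (- v) = frechet_derivative K (at (- y)) v" by (metis minus_minus)
  moreover have "linear (frechet_derivative K (at y))"
    using has_derivative_linear[OF smooth_has_derivative[OF assms(1)]] .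
  ultimately show ?thesis by (simp add: linear_neg)
qed

text \<open>Integration by parts on the torus: the derivative of an even kernel is odd, so passing
  to the adjoint reverses the sign.\<close>

lemma conv_deriv_adjoint:
  fixes f g :: "real ^ 'n \<Rightarrow> real" and v
  assumes K: "kernel K" "\<And>y. K (- y) = K y" and f: "torus_Lp 2 f" and g: "torus_Lp 2 g"
  defines "D \<equiv> \<lambda>y. frechet_derivative K (at y) v"
  shows "(LINT x|\<mu>. f x * conv D g x) = - (LINT x|\<mu>. conv D f x * g x)"
proof -
  have "kernel D" unfolding D_def by (rule kernel_frechet[OF K(1)])
  have "D (- y) = - D y" for y
    unfolding D_def by (rule frechet_derivative_even[OF kernel_smooth[OF K(1)] K(2)])
  then have "conv (\<lambda>y. D (- y)) f x = - conv D f x" for x by (simp add: conv_def)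
  then show ?thesis using conv_adjoint[OF \<open>kernel D\<close> f g] by simp
qed

section \<open>Divergence and curl of mollified weak fields\<close>

text \<open>By periodicity a nonzero value also occurs in the closed cube, possibly on its boundary.
  The open set of nonzero values then meets the closure of the open cube, hence the open cube
  itself, in a nonempty open set; such a set cannot be null.\<close>

lemma continuous_periodic_zero:
  fixes f :: "real ^ 'n \<Rightarrow> 'b::euclidean_space"
  assumes c: "continuous_on UNIV f" and p: "periodic f"
    and int: "(LINT x|\<mu>. (norm (f x))\<^sup>2) = 0"
  shows "f x = 0"
proof (rule ccontr)
  assume "f x \<noteq> 0"
  obtain z where z: "z \<in> (torus :: (real ^ 'n) set)" "f x = f z"
    using torus_representative[of x] p by metis
  have fF: "f \<in> borel_measurable borel" "integrable \<mu> (\<lambda>x. (norm (f x))\<^sup>2)"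
    using continuous_torus_Lp2[OF c p] by (simp_all add: torus_Lp_numeral)
  note [measurable] = fF(1)
  have "AE x in \<mu>. (norm (f x))\<^sup>2 = 0"
    using int integral_nonneg_eq_0_iff_AE[OF fF(2)] by simp
  then have "AE x in lborel. x \<in> (torus :: (real ^ 'n) set) \<longrightarrow> f x = 0"
    unfolding torus_measure_def by (subst (asm) AE_density) (auto simp: indicator_def)
  moreover define S where "S = {x. f x \<noteq> 0} \<inter> box 0 (One :: real ^ 'n)"
  ultimately have AE: "AE x in lborel. x \<notin> S" using box_subset_cbox[of 0 "One :: real ^ 'n"] by auto
  have oS: "open S" unfolding S_def
    by (intro open_Int open_box open_Collect_neq c continuous_on_const)
  have "S \<in> null_sets lborel" using AE AE_iff_null_sets[of S lborel] oS by simp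
  then have "negligible S" by (simp add: negligible_iff_null_sets null_sets_completionI)
  then have "S = {}" using oS open_not_negligible by blast
  moreover have "box 0 (One :: real ^ 'n) \<noteq> {}" by (simp add: box_ne_empty)
  then have "z \<in> closure (box 0 One)" using z(1) by (simp add: closure_box)
  moreover have "open {x. f x \<noteq> 0}" by (intro open_Collect_neq c continuous_on_const)
  ultimately show False
    using open_Int_closure_eq_empty[of "{x. f x \<noteq> 0}" "box 0 (One :: real ^ 'n)"] z(2) \<open>f x \<noteq> 0\<close>
    unfolding S_def by auto
qed

text \<open>The defect of the mollified equation is itself a smooth periodic field, so the weak
  equation may be tested with its mollification; this shows that the defect has norm zero.\<close>

lemma divergence_conv:
  fixes f :: "real ^ 'n \<Rightarrow> real ^ 'n"
  assumes K: "kernel K" "\<And>y. K (- y) = K y" and f: "torus_Lp 2 f" "weakly_div_free f"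
  shows "(\<Sum>k\<in>UNIV. conv (\<lambda>y. frechet_derivative K (at y) (axis k 1)) (\<lambda>x. f x $ k) x) = 0"
proof -
  define c :: "'n \<Rightarrow> (real ^ 'n \<Rightarrow> real) \<Rightarrow> real ^ 'n \<Rightarrow> real" where
    "c k = conv (\<lambda>y. frechet_derivative K (at y) (axis k 1))" for k
  define D where "D x = (\<Sum>k\<in>UNIV. c k (\<lambda>x. f x $ k) x)" for x
  have fk: "torus_Lp 2 (\<lambda>x. f x $ k)" for k by (rule torus_Lp2_nth[OF f(1)])
  have Dc: "continuous_on UNIV D" unfolding D_def c_def
    by (intro continuous_on_sum smooth_continuous[OF smooth_conv] kernel_frechet K torus_L2_L1 fk)
  have Dp: "periodic D"
    using periodic_conv[OF torus_L1D(2)[OF torus_L2_L1[OF fk]]] unfolding D_def c_def periodic_def by simp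
  have D2: "torus_Lp 2 D" by (rule continuous_torus_Lp2[OF Dc Dp])
  have cL2: "torus_Lp 2 (c k g)" if "torus_Lp 2 g" for k g
    unfolding c_def by (intro torus_Lp2_conv kernel_frechet K torus_L2_L1 that)
  have gr: "grad (conv K D) x = (\<chi> k. c k D x)" for x
    unfolding grad_def c_def by (simp add: partial_conv[OF K(1) torus_L2_L1[OF D2]])
  have "0 = (LINT x:torus|lborel. f x \<bullet> grad (conv K D) x)"
    using f(2) smooth_conv[OF K(1) torus_L2_L1[OF D2]] periodic_conv[OF Dp]
    unfolding weakly_div_free_def by simp
  also have "\<dots> = (LINT x|\<mu>. f x \<bullet> grad (conv K D) x)"
  proof (rule integral_torus_measure[symmetric])
    have [measurable]: "(\<lambda>x. grad (conv K D) x) \<in> borel_measurable borel"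
      unfolding gr c_def
      by (intro borel_measurable_continuous_onI continuous_on_vec_lambda
          smooth_continuous[OF smooth_conv] kernel_frechet K torus_L2_L1 D2)
    have [measurable]: "f \<in> borel_measurable borel" using f(1) by (simp add: torus_Lp_numeral)
    show "(\<lambda>x. f x \<bullet> grad (conv K D) x) \<in> borel_measurable borel" by measurable
  qed
  also have "\<dots> = (LINT x|\<mu>. (\<Sum>k\<in>UNIV. f x $ k * c k D x))"
    by (simp add: gr inner_vec_def)
  also have "\<dots> = (\<Sum>k\<in>UNIV. \<integral>x. f x $ k * c k D x \<partial>\<mu>)"
    using integrable_inner_Lp2[OF fk cL2[OF D2]] by (simp add: Bochner_Integration.integral_sum)
  also have "\<dots> = (\<Sum>k\<in>UNIV. - (LINT x|\<mu>. c k (\<lambda>x. f x $ k) x * D x))"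
    unfolding c_def by (intro sum.cong refl conv_deriv_adjoint K fk D2)
  also have "\<dots> = - (LINT x|\<mu>. (\<Sum>k\<in>UNIV. c k (\<lambda>x. f x $ k) x * D x))"
    using integrable_inner_Lp2[OF cL2[OF fk] D2]
    by (simp add: Bochner_Integration.integral_sum sum_negf)
  also have "\<dots> = - (LINT x|\<mu>. (norm (D x))\<^sup>2)"
    by (simp add: D_def power2_eq_square flip: sum_distrib_right)
  finally have "D x = 0" by (intro continuous_periodic_zero[OF Dc Dp]) simp
  then show ?thesis by (simp add: D_def c_def)
qed

lemma curl_conv_eq:
  assumes "kernel K" "torus_L1 f"
  defines "c \<equiv> \<lambda>k i x. conv (\<lambda>y. frechet_derivative K (at y) (axis k 1)) (\<lambda>x. f x $ i) x"
  shows "curl (conv K f) x = vector [c 2 3 x - c 3 2 x, c 3 1 x - c 1 3 x, c 1 2 x - c 2 1 x]"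
  unfolding curl_def c_def by (simp add: partial_conv_nth[OF assms(1,2)])

text \<open>Curl and convolution with an even kernel are both symmetric for the \<open>L^2\<close>
  pairing, so the weak curl tested with \<open>conv \<rho> W\<close> computes the pairing of both
  sides with the defect \<open>W\<close>.\<close>

lemma curl_conv:
  assumes K: "kernel K" "\<And>y. K (- y) = K y" and w: "has_weak_curl H h"
  shows "curl (conv K H) x = conv K h x"
proof -
  have H: "torus_Lp 2 H" and h: "torus_Lp 2 h"
    and test: "\<And>\<psi>. smooth \<psi> \<Longrightarrow> periodic \<psi> \<Longrightarrow>
       (LINT x:torus|lborel. H x \<bullet> curl \<psi> x) = (LINT x:torus|lborel. h x \<bullet> \<psi> x)"
    using w unfolding has_weak_curl_def by auto
  define c :: "3 \<Rightarrow> (real ^ 3 \<Rightarrow> real) \<Rightarrow> real ^ 3 \<Rightarrow> real" where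
    "c k = conv (\<lambda>y. frechet_derivative K (at y) (axis k 1))" for k
  have curl_c: "curl (conv K f) x = vector
      [c 2 (\<lambda>x. f x $ 3) x - c 3 (\<lambda>x. f x $ 2) x, c 3 (\<lambda>x. f x $ 1) x - c 1 (\<lambda>x. f x $ 3) x,
       c 1 (\<lambda>x. f x $ 2) x - c 2 (\<lambda>x. f x $ 1) x]" if "torus_L1 f" for f x
    unfolding curl_conv_eq[OF K(1) that] c_def ..
  have cL2: "torus_Lp 2 (c k g)" if "torus_Lp 2 g" for k g
    unfolding c_def by (intro torus_Lp2_conv kernel_frechet K torus_L2_L1 that)
  have cc: "continuous_on UNIV (c k g)" if "torus_Lp 2 g" for k g
    unfolding c_def by (intro smooth_continuous[OF smooth_conv] kernel_frechet K torus_L2_L1 that)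
  have cp: "periodic (c k g)" if "torus_Lp 2 g" for k g
    unfolding c_def by (intro periodic_conv torus_L1D(2) torus_L2_L1 that)
  have curl_cont: "continuous_on UNIV (curl (conv K f))" and curl_per: "periodic (curl (conv K f))"
    if "torus_Lp 2 f" for f
  proof -
    have eq: "curl (conv K f) = (\<lambda>x. \<chi> i. if i = 1 then c 2 (\<lambda>x. f x $ 3) x - c 3 (\<lambda>x. f x $ 2) x
       else if i = 2 then c 3 (\<lambda>x. f x $ 1) x - c 1 (\<lambda>x. f x $ 3) x
       else c 1 (\<lambda>x. f x $ 2) x - c 2 (\<lambda>x. f x $ 1) x)"
      by (simp add: fun_eq_iff curl_c[OF torus_L2_L1[OF that]] vec_eq_iff forall_3)
    have fi: "torus_Lp 2 (\<lambda>x. f x $ i)" for i by (rule torus_Lp2_nth[OF that])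
    show "continuous_on UNIV (curl (conv K f))"
      unfolding eq
    proof (rule continuous_on_vec_lambda)
      fix i :: 3
      show "continuous_on UNIV (\<lambda>x. if i = 1 then c 2 (\<lambda>x. f x $ 3) x - c 3 (\<lambda>x. f x $ 2) x
         else if i = 2 then c 3 (\<lambda>x. f x $ 1) x - c 1 (\<lambda>x. f x $ 3) x
         else c 1 (\<lambda>x. f x $ 2) x - c 2 (\<lambda>x. f x $ 1) x)"
        by (cases "i = 1"; cases "i = 2") (simp_all add: continuous_on_diff cc[OF fi])
    qed
    have per: "c k (\<lambda>x. f x $ j) (x + axis i 1) = c k (\<lambda>x. f x $ j) x" for k j i x
      using cp[OF fi] by (simp add: periodic_def)
    show "periodic (curl (conv K f))"
      unfolding eq periodic_def per by simp
  qed
  define W where "W x = curl (conv K H) x - conv K h x" for x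
  have Wc: "continuous_on UNIV W" unfolding W_def
    by (intro continuous_on_diff curl_cont H smooth_continuous[OF smooth_conv] K torus_L2_L1 h)
  have Wp: "periodic W"
    using curl_per[OF H] periodic_conv[OF torus_L1D(2)[OF torus_L2_L1[OF h]], of K]
    unfolding W_def periodic_def by simp
  have W: "torus_Lp 2 W" by (rule continuous_torus_Lp2[OF Wc Wp])
  have Hi: "torus_Lp 2 (\<lambda>x. H x $ i)" and Wi: "torus_Lp 2 (\<lambda>x. W x $ i)" for i
    by (rule torus_Lp2_nth[OF H], rule torus_Lp2_nth[OF W])
  have adj: "(LINT x|\<mu>. H x $ i * c k (\<lambda>x. W x $ j) x) =
      - (LINT x|\<mu>. c k (\<lambda>x. H x $ i) x * W x $ j)" for i j k
    unfolding c_def by (rule conv_deriv_adjoint[OF K Hi Wi])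
  have int1: "integrable \<mu> (\<lambda>x. H x $ i * c k (\<lambda>x. W x $ j) x)"
    and int2: "integrable \<mu> (\<lambda>x. c k (\<lambda>x. H x $ i) x * W x $ j)" for i j k
    using integrable_inner_Lp2[OF Hi cL2[OF Wi]] integrable_inner_Lp2[OF cL2[OF Hi] Wi] by simp_all
  have curlW: "torus_Lp 2 (curl (conv K W))" and curlH: "torus_Lp 2 (curl (conv K H))"
    by (intro continuous_torus_Lp2 curl_cont curl_per W H)+
  have bor: "f \<in> borel_measurable borel" if "torus_Lp 2 f" for f :: "real ^ 3 \<Rightarrow> real ^ 3"
    using that by (simp add: torus_Lp_numeral)
  have "(LINT x|\<mu>. H x \<bullet> curl (conv K W) x) = (LINT x:torus|lborel. H x \<bullet> curl (conv K W) x)"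
    using bor[OF H] bor[OF curlW] by (intro integral_torus_measure) simp
  also have "\<dots> = (LINT x:torus|lborel. h x \<bullet> conv K W x)"
    by (intro test smooth_conv K torus_L2_L1 W periodic_conv Wp)
  also have "\<dots> = (LINT x|\<mu>. h x \<bullet> conv K W x)"
    using bor[OF h] bor[OF torus_Lp2_conv[OF K(1) torus_L2_L1[OF W]]]
    by (intro integral_torus_measure[symmetric]) simp
  also have "\<dots> = (LINT x|\<mu>. conv K h x \<bullet> W x)"
    using conv_adjoint[OF K(1) h W] by (simp add: K(2))
  finally have 1: "(LINT x|\<mu>. H x \<bullet> curl (conv K W) x) = (LINT x|\<mu>. conv K h x \<bullet> W x)" .
  have 2: "(LINT x|\<mu>. H x \<bullet> curl (conv K W) x) = (LINT x|\<mu>. curl (conv K H) x \<bullet> W x)"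
  proof -
    \<comment> \<open>Moving the derivative to \<open>H\<close> reverses every sign, and the
      antisymmetry of curl in its indices restores it: both sides are built from the same six
      numbers.\<close>
    define A where "A k i j = (LINT x|\<mu>. c k (\<lambda>x. H x $ i) x * W x $ j)" for k i j
    have "(LINT x|\<mu>. H x \<bullet> curl (conv K W) x) =
        - A 2 1 3 + A 3 1 2 - A 3 2 1 + A 1 2 3 - A 1 3 2 + A 2 3 1"
      by (simp add: curl_c[OF torus_L2_L1[OF W]] inner_vec_def sum_3 right_diff_distrib adj int1 A_def)
    moreover have "(LINT x|\<mu>. curl (conv K H) x \<bullet> W x) =
        A 2 3 1 - A 3 2 1 + A 3 1 2 - A 1 3 2 + A 1 2 3 - A 2 1 3"
      by (simp add: curl_c[OF torus_L2_L1[OF H]] inner_vec_def sum_3 left_diff_distrib int2 A_def)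
    ultimately show ?thesis by simp
  qed
  have "(LINT x|\<mu>. (norm (W x))\<^sup>2) = (LINT x|\<mu>. curl (conv K H) x \<bullet> W x - conv K h x \<bullet> W x)"
    by (simp add: power2_norm_eq_inner W_def inner_diff_left)
  also have "\<dots> = 0"
    using 1 2 integrable_inner_Lp2[OF curlH W]
      integrable_inner_Lp2[OF torus_Lp2_conv[OF K(1) torus_L2_L1[OF h]] W] by simp
  finally have "W x = 0" by (rule continuous_periodic_zero[OF Wc Wp])
  then show ?thesis by (simp add: W_def)
qed


subsection \<open>Approximation by mollification\<close>

lemma integrable_lborel_shift:
  fixes f :: "'a::euclidean_space \<Rightarrow> 'b::{banach, second_countable_topology}"
  assumes "integrable lborel f"
  shows "integrable lborel (\<lambda>x. f (x - c))" and "(LINT x|lborel. f (x - c)) = (LINT x|lborel. f x)"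
proof -
  have [measurable]: "f \<in> borel_measurable borel" using borel_measurable_integrable[OF assms] by simp
  have "integrable (distr lborel borel (\<lambda>x. x + (- c))) f" using assms by (simp only: distr_lborel_add)
  then show "integrable lborel (\<lambda>x. f (x - c))" by (simp add: integrable_distr_eq)
  have "(LINT x|lborel. f x) = (\<integral>x. f x \<partial>distr lborel borel (\<lambda>x. x + (- c)))"
    by (simp only: distr_lborel_add)
  then show "(LINT x|lborel. f (x - c)) = (LINT x|lborel. f x)" by (simp add: integral_distr)
qed

section \<open>Continuity of translations in the mean\<close>

text \<open>Outer regularity of \<open>A\<close> gives \<open>U\<close>, that of its complement
  gives a closed set inside \<open>A\<close>, and intersecting with a large ball makes it compact;
  each of the three steps loses at most \<open>e / 3\<close>.\<close>

lemma lborel_compact_open_sandwich: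
  fixes A :: "'a::euclidean_space set"
  assumes A: "A \<in> sets lborel" "emeasure lborel A < \<infinity>" and e: "0 < e"
  obtains K U where "compact K" "open U" "K \<subseteq> A" "A \<subseteq> U"
    "emeasure lborel (U - K) < \<infinity>" "measure lborel (U - K) \<le> e"
proof -
  have [measurable]: "A \<in> sets borel" using A by simp
  have e3: "0 < e / 3" using e by simp
  obtain U where U: "open U" "A \<subseteq> U" "emeasure lborel (U - A) < ennreal (e / 3)"
    using outer_regular_lborel[of A "e / 3"] e3 by auto
  obtain V where V: "open V" "- A \<subseteq> V" "emeasure lborel (V - - A) < ennreal (e / 3)"
    using outer_regular_lborel[of "- A" "e / 3"] e3 by auto
  have lim: "(\<lambda>n. measure lborel (A - cball 0 (real n))) \<longlonglongrightarrow> measure lborel (\<Inter>n. A - cball 0 (real n))"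
  proof (rule Lim_measure_decseq)
    show "decseq (\<lambda>n. A - cball (0::'a) (real n))"
      by (intro antimonoI) (auto intro: order_trans[OF _ of_nat_mono])
    show "emeasure lborel (A - cball 0 (real n)) \<noteq> \<infinity>" for n
      using A emeasure_mono[of "A - cball 0 (real n)" A lborel] by (auto simp: top_unique)
  qed auto
  have empty: "(\<Inter>n. A - cball (0::'a) (real n)) = {}"
    using real_arch_simple by fastforce
  from order_tendstoD(2)[OF lim[unfolded empty measure_empty] e3] obtain n where
    n: "measure lborel (A - cball 0 (real n)) < e / 3"
    unfolding eventually_sequentially by blast
  have n': "emeasure lborel (A - cball 0 (real n)) = ennreal (measure lborel (A - cball 0 (real n)))"
    using A emeasure_mono[of "A - cball 0 (real n)" A lborel]
    by (intro emeasure_eq_ennreal_measure) (auto simp: top_unique)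
  define K where "K = (- V) \<inter> cball 0 (real n)"
  have K: "compact K" unfolding K_def using V(1) by (intro closed_Int_compact) auto
  then have Kc: "closed K" by (rule compact_imp_closed)
  have [measurable]: "K \<in> sets borel" "U \<in> sets borel" "V \<in> sets borel" using Kc U(1) V(1) by auto
  have "U - K \<subseteq> ((U - A) \<union> (V - - A)) \<union> (A - cball 0 (real n))" by (auto simp: K_def)
  then have "emeasure lborel (U - K) \<le> emeasure lborel (((U - A) \<union> (V - - A)) \<union> (A - cball 0 (real n)))"
    by (rule emeasure_mono) measurable
  also have "\<dots> \<le> emeasure lborel ((U - A) \<union> (V - - A)) + emeasure lborel (A - cball 0 (real n))"
    by (rule emeasure_subadditive) measurable
  also have "\<dots> \<le> (emeasure lborel (U - A) + emeasure lborel (V - - A)) + emeasure lborel (A - cball 0 (real n))"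
    by (rule add_right_mono[OF emeasure_subadditive]) measurable
  also have "\<dots> \<le> (ennreal (e / 3) + ennreal (e / 3)) + ennreal (e / 3)"
    unfolding n' using U(3) V(3) n by (intro add_mono ennreal_leI) auto
  also have "\<dots> = ennreal e" using e by (simp flip: ennreal_plus)
  finally have le: "emeasure lborel (U - K) \<le> ennreal e" .
  show thesis
  proof
    show "emeasure lborel (U - K) < \<infinity>" using le by (rule order_le_less_trans) simp
    show "measure lborel (U - K) \<le> e" unfolding measure_def by (rule enn2real_leI) (use e le in auto)
    show "K \<subseteq> A" using V(2) by (auto simp: K_def)
  qed (use K U in auto)
qed

lemma norm_diff_square_le: "(norm (a - b))\<^sup>2 \<le> 2 * (norm a)\<^sup>2 + 2 * (norm b)\<^sup>2"
  for a b :: "'b::real_inner"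
  using zero_le_power2[of "norm (a + b)"]
  by (simp add: power2_norm_eq_inner inner_diff_left inner_diff_right inner_add_left inner_add_right
      inner_commute)

text \<open>Induction on integrable functions. For an indicator, a shift shorter than the distance
  from \<open>K\<close> to the complement of \<open>U\<close> changes membership only at points of
  \<open>U - K\<close> or of its translate.\<close>

lemma L1_translation_continuous:
  fixes f :: "'a::euclidean_space \<Rightarrow> 'b::{banach, second_countable_topology}"
  assumes "integrable lborel f"
  shows "\<forall>e>0. \<exists>d>0. \<forall>y. norm y < d \<longrightarrow> (LINT x|lborel. norm (f (x - y) - f x)) \<le> e"
  using assms
proof (induction rule: integrable_induct)
  case (base A c)
  show ?case
  proof (intro allI impI)
    fix e :: real assume e: "0 < e"
    \<comment> \<open>The added 1 keeps the divisor positive when \<open>c\<close> is 0.\<close>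
    define q where "q = norm c + 1"
    have q: "0 < q" "norm c \<le> q" using norm_ge_zero[of c] by (simp_all add: q_def add_nonneg_pos)
    define e' where "e' = e / (2 * q)"
    have e': "0 < e'" using e q by (simp add: e'_def)
    obtain K U where KU: "compact K" "open U" "K \<subseteq> A" "A \<subseteq> U" "emeasure lborel (U - K) < \<infinity>" "measure lborel (U - K) \<le> e'"
      using lborel_compact_open_sandwich[OF base e'] by blast
    have sUK: "U - K \<in> sets lborel" using KU(2) compact_imp_closed[OF KU(1)] by auto
    have "closed (- U)" "K \<inter> - U = {}" using KU by auto
    then obtain d where d: "d > 0" "\<forall>x\<in>K. \<forall>y\<in>- U. d \<le> dist x y"
      using separate_compact_closed[OF KU(1)] by blast
    let ?I = "\<lambda>x. indicator (U - K) x * norm c :: real"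
    have I: "integrable lborel ?I"
      by (rule integrable_mult_left, rule integrable_real_indicator[OF sUK KU(5)])
    have "(LINT x|lborel. norm (indicator A (x - y) *\<^sub>R c - indicator A x *\<^sub>R c)) \<le> e" if y: "norm y < d" for y
    proof -
      have bound: "norm (indicator A (x - y) *\<^sub>R c - indicator A x *\<^sub>R c) \<le> ?I (x - y) + ?I x" for x
      proof -
        have "x \<in> U" if "x - y \<in> K" using d(2)[rule_format, of "x - y" x] that y by (auto simp: dist_norm)
        moreover have "x - y \<in> U" if "x \<in> K" using d(2)[rule_format, of x "x - y"] that y by (auto simp: dist_norm)
        ultimately show ?thesis using KU(3,4) by (auto simp: indicator_def)
      qed
      have "(LINT x|lborel. norm (indicator A (x - y) *\<^sub>R c - indicator A x *\<^sub>R c)) \<le> (LINT x|lborel. ?I (x - y) + ?I x)"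
        by (rule Bochner_Integration.integral_mono'[OF Bochner_Integration.integrable_add[OF integrable_lborel_shift(1)[OF I] I] bound]) auto
      also have "\<dots> = 2 * (measure lborel (U - K) * norm c)"
        using integrable_lborel_shift[OF I, of y] I by simp
      also have "\<dots> \<le> 2 * (e' * q)"
        using KU(6) e' q by (intro mult_left_mono mult_mono) auto
      also have "\<dots> = e" using q by (simp add: e'_def)
      finally show ?thesis .
    qed
    then show "\<exists>d>0. \<forall>y. norm y < d \<longrightarrow>
        (LINT x|lborel. norm (indicator A (x - y) *\<^sub>R c - indicator A x *\<^sub>R c)) \<le> e"
      using d(1) by blast
  qed
next
  case (add f g)
  show ?case
  proof (intro allI impI)
    fix e :: real assume "0 < e"
    then have e2: "0 < e / 2" by simp
    obtain d1 where d1: "d1 > 0" "\<And>y. norm y < d1 \<Longrightarrow> (LINT x|lborel. norm (f (x - y) - f x)) \<le> e / 2"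
      using add.IH(1) e2 by blast
    obtain d2 where d2: "d2 > 0" "\<And>y. norm y < d2 \<Longrightarrow> (LINT x|lborel. norm (g (x - y) - g x)) \<le> e / 2"
      using add.IH(2) e2 by blast
    have "(LINT x|lborel. norm (f (x - y) + g (x - y) - (f x + g x))) \<le> e" if "norm y < min d1 d2" for y
    proof -
      have i1: "integrable lborel (\<lambda>x. norm (f (x - y) - f x))" and i2: "integrable lborel (\<lambda>x. norm (g (x - y) - g x))"
        using integrable_lborel_shift(1)[OF add.hyps(1)] integrable_lborel_shift(1)[OF add.hyps(2)] add.hyps by auto
      have "(LINT x|lborel. norm (f (x - y) + g (x - y) - (f x + g x))) \<le>
          (LINT x|lborel. norm (f (x - y) - f x) + norm (g (x - y) - g x))"
      proof (rule Bochner_Integration.integral_mono'[OF Bochner_Integration.integrable_add[OF i1 i2]])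
        show "norm (f (x - y) + g (x - y) - (f x + g x)) \<le> norm (f (x - y) - f x) + norm (g (x - y) - g x)" for x
          using norm_triangle_ineq[of "f (x - y) - f x" "g (x - y) - g x"] by (simp add: algebra_simps)
      qed simp
      also have "\<dots> \<le> e" using i1 i2 d1(2)[of y] d2(2)[of y] that by simp
      finally show ?thesis .
    qed
    then show "\<exists>d>0. \<forall>y. norm y < d \<longrightarrow> (LINT x|lborel. norm (f (x - y) + g (x - y) - (f x + g x))) \<le> e"
      using d1(1) d2(1) by (intro exI[of _ "min d1 d2"]) auto
  qed
next
  case (lim f s)
  show ?case
  proof (intro allI impI)
    fix e :: real assume "0 < e"
    then have e3: "0 < e / 3" by simp
    have "(\<lambda>i. \<integral>x. norm (s i x - f x) \<partial>lborel) \<longlonglongrightarrow> (LINT x|(lborel :: 'a measure). 0)"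
    proof (rule integral_dominated_convergence[where w = "\<lambda>x. 3 * norm (f x)"])
      show "integrable lborel (\<lambda>x. 3 * norm (f x))" using lim by simp
      show "AE x in lborel. (\<lambda>i. norm (s i x - f x)) \<longlonglongrightarrow> 0"
      proof (rule AE_I2)
        fix x :: 'a
        have "(\<lambda>i. s i x - f x) \<longlonglongrightarrow> f x - f x" by (intro tendsto_diff lim tendsto_const) simp
        then show "(\<lambda>i. norm (s i x - f x)) \<longlonglongrightarrow> 0" using tendsto_norm_zero by fastforce
      qed
      show "AE x in lborel. norm (norm (s i x - f x)) \<le> 3 * norm (f x)" for i
      proof (rule AE_I2)
        fix x :: 'a
        show "norm (norm (s i x - f x)) \<le> 3 * norm (f x)"
          using norm_triangle_ineq4[of "s i x" "f x"] lim.hyps(3)[of x i] by simp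
      qed
    qed (use lim in \<open>auto intro!: borel_measurable_integrable\<close>)
    then have "(\<lambda>i. \<integral>x. norm (s i x - f x) \<partial>lborel) \<longlonglongrightarrow> 0" by simp
    from LIMSEQ_D[OF this e3] obtain i where i: "(LINT x|lborel. norm (s i x - f x)) < e / 3"
      by force
    obtain d where d: "d > 0" "\<And>y. norm y < d \<Longrightarrow> (LINT x|lborel. norm (s i (x - y) - s i x)) \<le> e / 3"
      using lim.IH[of i] e3 by blast
    have "(LINT x|lborel. norm (f (x - y) - f x)) \<le> e" if y: "norm y < d" for y
    proof -
      let ?D = "\<lambda>x. norm (s i x - f x)"
      have D: "integrable lborel ?D" using lim by simp
      have S: "integrable lborel (\<lambda>x. norm (s i (x - y) - s i x))"
        using integrable_lborel_shift(1)[OF lim.hyps(1)] lim.hyps(1) by simp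
      have "(LINT x|lborel. norm (f (x - y) - f x)) \<le> (LINT x|lborel. (?D (x - y) + ?D x) + norm (s i (x - y) - s i x))"
      proof (rule Bochner_Integration.integral_mono'[OF Bochner_Integration.integrable_add[OF Bochner_Integration.integrable_add[OF integrable_lborel_shift(1)[OF D] D] S]])
        show "norm (f (x - y) - f x) \<le> (?D (x - y) + ?D x) + norm (s i (x - y) - s i x)" for x
          using norm_triangle_ineq[of "f (x - y) - s i (x - y)" "s i (x - y) - f x"]
            norm_triangle_ineq[of "s i (x - y) - s i x" "s i x - f x"]
          by (simp add: norm_minus_commute)
      qed simp
      also have "\<dots> = (LINT x|lborel. ?D x) + (LINT x|lborel. ?D x) + (LINT x|lborel. norm (s i (x - y) - s i x))"
        using integrable_lborel_shift[OF D, of y] D S by simp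
      also have "\<dots> \<le> e" using i d(2)[OF y] by simp
      finally show ?thesis .
    qed
    then show "\<exists>d>0. \<forall>y. norm y < d \<longrightarrow> (LINT x|lborel. norm (f (x - y) - f x)) \<le> e"
      using d(1) by blast
  qed
qed

text \<open>The convolution bound, with the indicator of a ball of radius \<open>1/2\<close> in
  place of the kernel, says exactly that \<open>g\<close> is integrable on such balls; finitely many
  of them cover \<open>S\<close>.\<close>

lemma torus_L1_set_integrable_compact:
  fixes g :: "real ^ 'n \<Rightarrow> 'b::euclidean_space"
  assumes g: "torus_L1 g" and S: "compact S"
  shows "set_integrable lborel S g"
proof -
  note [measurable] = torus_L1D(1)[OF g]
  have ball: "set_integrable lborel (ball c (1/2)) g" for c
  proof -
    let ?K = "indicator (ball 0 (1/2)) :: real ^ 'n \<Rightarrow> real"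
    have K: "?K \<in> borel_measurable borel" by (intro borel_measurable_indicator) simp
    have "integrable lborel (\<lambda>y. ?K y *\<^sub>R g (c - y))"
      by (rule conv_integrable_bound(1)[OF K _ _ g, of 1]) (auto simp: indicator_def)
    then have "integrable lborel (\<lambda>z. ?K (c - z) *\<^sub>R g z)"
      unfolding conv_alt(2)[OF K g] .
    moreover have "?K (c - z) = indicator (ball c (1/2)) z" for z
      by (auto simp: indicator_def dist_norm norm_minus_commute)
    ultimately show ?thesis by (simp add: set_integrable_def)
  qed
  obtain C where C: "C \<subseteq> S" "finite C" "S \<subseteq> (\<Union>c\<in>C. ball c (1/2))"
    by (rule compactE_image[OF S, of S "\<lambda>c. ball c (1/2)"]) auto
  have "set_integrable lborel (\<Union>c\<in>C. ball c (1/2)) g"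
    by (rule set_integrable_UN[OF C(2) ball]) simp
  then show ?thesis
    by (rule set_integrable_subset) (use C(3) S in \<open>auto dest: compact_imp_closed\<close>)
qed

text \<open>A nonzero periodic function is not integrable over the whole space, so \<open>g\<close>
  is cut off first. The margin 1 in the radius keeps points of the cube inside the cutoff under all
  shifts shorter than 1.\<close>

lemma torus_L1_translation_continuous:
  fixes g :: "real ^ 'n \<Rightarrow> 'b::euclidean_space"
  assumes g: "torus_L1 g" and e: "0 < e"
  obtains d where "d > 0" "\<And>y. norm y < d \<Longrightarrow> (LINT x|\<mu>. norm (g (x - y) - g x)) \<le> e"
proof -
  note [measurable] = torus_L1D(1)[OF g]
  obtain R where R: "\<And>x. x \<in> (torus :: (real ^ 'n) set) \<Longrightarrow> norm x \<le> R"
    using bounded_cbox[of 0 "One :: real ^ 'n"] unfolding bounded_iff by blast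
  define G where "G x = indicator (cball 0 (R + 1)) x *\<^sub>R g x" for x
  have G: "integrable lborel G"
    using torus_L1_set_integrable_compact[OF g compact_cball] unfolding set_integrable_def G_def .
  obtain d where d: "d > 0" "\<And>y. norm y < d \<Longrightarrow> (LINT x|lborel. norm (G (x - y) - G x)) \<le> e"
    using L1_translation_continuous[OF G] e by blast
  have "(LINT x|\<mu>. norm (g (x - y) - g x)) \<le> e" if y: "norm y < min d 1" for y
  proof -
    have "(LINT x|\<mu>. norm (g (x - y) - g x)) =
        (LINT x|lborel. indicator torus x * norm (g (x - y) - g x))"
      by (subst integral_torus_measure) (auto simp: set_lebesgue_integral_def)
    also have "\<dots> \<le> (LINT x|lborel. norm (G (x - y) - G x))"
    proof (rule Bochner_Integration.integral_mono')
      show "integrable lborel (\<lambda>x. norm (G (x - y) - G x))"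
        using integrable_lborel_shift(1)[OF G] G by simp
      show "indicator torus x * norm (g (x - y) - g x) \<le> norm (G (x - y) - G x)" for x
      proof (cases "x \<in> torus")
        case True
        have "norm (x - y) \<le> R + 1" using R[OF True] norm_triangle_ineq4[of x y] y by simp
        then show ?thesis using R[OF True] True by (simp add: G_def)
      qed simp
    qed simp
    also have "\<dots> \<le> e" using d(2) y by simp
    finally show ?thesis .
  qed
  then show thesis using that[of "min d 1"] d(1) by simp
qed

lemma L2_truncation:
  fixes f :: "real ^ 'n \<Rightarrow> 'b::euclidean_space"
  assumes f: "torus_Lp 2 f" and e: "0 < e"
  obtains M where "0 < M" "(LINT x|\<mu>. (if norm (f x) \<le> M then 0 else (norm (f x))\<^sup>2)) \<le> e"
proof -
  have [measurable]: "f \<in> borel_measurable borel" and int: "integrable \<mu> (\<lambda>x. (norm (f x))\<^sup>2)"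
    using f by (simp_all add: torus_Lp_numeral)
  have "(\<lambda>n. \<integral>x. (if norm (f x) \<le> real n then 0 else (norm (f x))\<^sup>2) \<partial>\<mu>) \<longlonglongrightarrow>
      (LINT x|(\<mu> :: (real ^ 'n) measure). 0)"
  proof (rule integral_dominated_convergence[where w = "\<lambda>x. (norm (f x))\<^sup>2"])
    show "AE x in \<mu>. (\<lambda>n. if norm (f x) \<le> real n then 0 else (norm (f x))\<^sup>2) \<longlonglongrightarrow> 0"
    proof (rule AE_I2)
      fix x
      obtain m :: nat where "norm (f x) \<le> real m" using real_arch_simple by blast
      have "\<forall>\<^sub>F n in sequentially. (if norm (f x) \<le> real n then 0 else (norm (f x))\<^sup>2) = 0"
        using eventually_ge_at_top[of m]
      proof (rule eventually_mono)
        fix n assume "m \<le> n"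
        then have "real m \<le> real n" by simp
        with \<open>norm (f x) \<le> real m\<close> have "norm (f x) \<le> real n" by linarith
        then show "(if norm (f x) \<le> real n then 0 else (norm (f x))\<^sup>2) = 0" by simp
      qed
      then show "(\<lambda>n. if norm (f x) \<le> real n then 0 else (norm (f x))\<^sup>2) \<longlonglongrightarrow> 0"
        by (rule tendsto_eventually)
    qed
  qed (use int in auto)
  then have "(\<lambda>n. \<integral>x. (if norm (f x) \<le> real n then 0 else (norm (f x))\<^sup>2) \<partial>\<mu>) \<longlonglongrightarrow> 0"
    by simp
  from order_tendstoD(2)[OF this e]
  obtain N where N: "\<And>n. n \<ge> N \<Longrightarrow> (LINT x|\<mu>. (if norm (f x) \<le> real n then 0 else (norm (f x))\<^sup>2)) < e"
    unfolding eventually_sequentially by blast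
  show thesis using that[of "real (Suc N)"] N[of "Suc N"] by simp
qed

text \<open>Convergence of pairings follows from continuity of translations in \<open>L^1\<close>.
  Where \<open>f\<close> is at most \<open>M\<close>, the increment of \<open>g\<close> is small in
  \<open>L^1\<close>; the rest is split by Young's inequality between the small tail of
  \<open>f\<close> and the bounded \<open>L^2\<close> norm of the increment. The threshold does not
  depend on the particular mollifier.\<close>

lemma mollifier_pairing_limit:
  fixes f g :: "real ^ 'n \<Rightarrow> 'b::euclidean_space"
  assumes f: "torus_Lp 2 f" and g: "torus_Lp 2 g" and e: "0 < e"
  shows "\<exists>d>0. \<forall>\<epsilon> \<rho>. \<epsilon> < 1/4 \<longrightarrow> \<epsilon> \<le> d \<longrightarrow> mollifier C \<epsilon> \<rho> \<longrightarrow>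
    \<bar>(LINT x|\<mu>. f x \<bullet> conv \<rho> g x) - (LINT x|\<mu>. f x \<bullet> g x)\<bar> \<le> e"
proof -
  have [measurable]: "f \<in> borel_measurable borel" "g \<in> borel_measurable borel"
    and pg: "periodic g"
    and f2: "integrable \<mu> (\<lambda>x. (norm (f x))\<^sup>2)" and g2: "integrable \<mu> (\<lambda>x. (norm (g x))\<^sup>2)"
    using f g by (simp_all add: torus_Lp_numeral)
  define G where "G = (LINT x|\<mu>. (norm (g x))\<^sup>2)"
  have G: "0 \<le> G" by (simp add: G_def)
  \<comment> \<open>The squared \<open>L^2\<close> norm of an increment of \<open>g\<close> is at
    most \<open>4 * G\<close>; the weight \<open>l\<close> makes its share \<open>e / 3\<close>, and
    the tail of \<open>f\<close> divided by \<open>l\<close> must then be at most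
    \<open>e / 3\<close> too, which fixes \<open>M\<close>.\<close>
  define l where "l = e / (3 * (4 * G + 1))"
  have l: "0 < l" using e G by (simp add: l_def)
  have lG: "l * (4 * G) \<le> e / 3" using e G by (simp add: l_def field_simps)
  have "0 < l * (e / 3)" using l e by simp
  then obtain M where M: "0 < M"
    "(LINT x|\<mu>. (if norm (f x) \<le> M then 0 else (norm (f x))\<^sup>2)) \<le> l * (e / 3)"
    using L2_truncation[OF f] by blast
  define F where "F x = (if norm (f x) \<le> M then 0 else (norm (f x))\<^sup>2)" for x
  have [measurable]: "F \<in> borel_measurable borel" unfolding F_def[abs_def] by measurable
  have F: "integrable \<mu> F"
    by (rule Bochner_Integration.integrable_bound[OF f2]) (auto simp: F_def)
  have "0 < e / (3 * M)" using e M by simp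
  then obtain d where d: "d > 0"
    "\<And>y. norm y < d \<Longrightarrow> (LINT x|\<mu>. norm (g (x - y) - g x)) \<le> e / (3 * M)"
    using torus_L1_translation_continuous[OF torus_L2_L1[OF g]] by blast
  have shift2: "integrable \<mu> (\<lambda>x. (norm (g (x - y)))\<^sup>2)"
    "(LINT x|\<mu>. (norm (g (x - y)))\<^sup>2) = G" for y
    using torus_shift[of "\<lambda>x. (norm (g x))\<^sup>2" "- y"] pg g2 unfolding G_def periodic_def by auto
  have shift1: "integrable \<mu> (\<lambda>x. norm (g (x - y)))" for y
    using integrable_torus_shift[of "\<lambda>x. norm (g x)" "- y"] pg torus_L1D(3)[OF torus_L2_L1[OF g]]
    unfolding periodic_def by auto
  have D1: "integrable \<mu> (\<lambda>x. norm (g (x - y) - g x))" for y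
    by (rule Bochner_Integration.integrable_bound[OF Bochner_Integration.integrable_add[OF shift1[of y] integrable_norm[OF torus_L1D(3)[OF torus_L2_L1[OF g]]]]])
      (auto intro!: AE_I2 norm_triangle_ineq4)
  have c: "\<bar>LINT x|\<mu>. f x \<bullet> (g (x - y) - g x)\<bar> \<le> e" if y: "norm y < d" for y
  proof -
    let ?B = "\<lambda>x. M * norm (g (x - y) - g x) + (F x / l + l * (2 * (norm (g (x - y)))\<^sup>2 + 2 * (norm (g x))\<^sup>2))"
    have B: "integrable \<mu> ?B" using D1[of y] F shift2(1)[of y] g2 by simp
    have "\<bar>LINT x|\<mu>. f x \<bullet> (g (x - y) - g x)\<bar> \<le> (LINT x|\<mu>. \<bar>f x \<bullet> (g (x - y) - g x)\<bar>)"
      by (rule integral_abs_bound)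
    also have "\<dots> \<le> (LINT x|\<mu>. ?B x)"
    proof (rule Bochner_Integration.integral_mono'[OF B])
      fix x
      let ?a = "g (x - y) - g x"
      have cs: "\<bar>f x \<bullet> ?a\<bar> \<le> norm (f x) * norm ?a" by (rule Cauchy_Schwarz_ineq2)
      have sq: "(norm ?a)\<^sup>2 \<le> 2 * (norm (g (x - y)))\<^sup>2 + 2 * (norm (g x))\<^sup>2"
        by (rule norm_diff_square_le)
      show "\<bar>f x \<bullet> ?a\<bar> \<le> ?B x"
      proof (cases "norm (f x) \<le> M")
        case True
        have "norm (f x) * norm ?a \<le> M * norm ?a" using True by (intro mult_right_mono) auto
        moreover have "0 \<le> l * (2 * (norm (g (x - y)))\<^sup>2 + 2 * (norm (g x))\<^sup>2)" using l by simp
        ultimately show ?thesis using cs True by (simp add: F_def)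
      next
        case False
        have "0 \<le> (norm (f x) - l * norm ?a)\<^sup>2" by simp
        then have "2 * (norm (f x) * norm ?a) * l \<le> (norm (f x))\<^sup>2 + l\<^sup>2 * (norm ?a)\<^sup>2"
          by (simp add: power2_diff power_mult_distrib mult_ac)
        then have "2 * (norm (f x) * norm ?a) \<le> (norm (f x))\<^sup>2 / l + l * (norm ?a)\<^sup>2"
          using l by (simp add: field_simps power2_eq_square)
        moreover have "0 \<le> norm (f x) * norm ?a" "0 \<le> M * norm ?a" using M by simp_all
        moreover have "l * (norm ?a)\<^sup>2 \<le> l * (2 * (norm (g (x - y)))\<^sup>2 + 2 * (norm (g x))\<^sup>2)"
          using sq l by (intro mult_left_mono) auto
        ultimately show ?thesis using cs False by (simp add: F_def)
      qed
      show "0 \<le> ?B x" using M l by (simp add: F_def)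
    qed
    also have "\<dots> = M * (LINT x|\<mu>. norm (g (x - y) - g x)) + ((LINT x|\<mu>. F x) / l + l * (2 * G + 2 * G))"
      using D1[of y] F shift2[of y] g2 by (simp add: G_def)
    also have "\<dots> \<le> e / 3 + (e / 3 + e / 3)"
    proof (intro add_mono)
      show "M * (LINT x|\<mu>. norm (g (x - y) - g x)) \<le> e / 3"
        using d(2)[OF y] M by (simp add: field_simps)
      show "(LINT x|\<mu>. F x) / l \<le> e / 3"
        using M(2) l unfolding F_def[symmetric] by (simp add: field_simps)
      show "l * (2 * G + 2 * G) \<le> e / 3" using lG by simp
    qed
    finally show ?thesis by simp
  qed
  have bound: "\<bar>(LINT x|\<mu>. f x \<bullet> conv K g x) - (LINT x|\<mu>. f x \<bullet> g x)\<bar> \<le> e"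
    if K: "kernel K" "\<And>y. 0 \<le> K y" "integral\<^sup>L lborel K = 1" "\<And>y. d \<le> norm y \<Longrightarrow> K y = 0" for K
  proof -
    have Ki: "integrable lborel K" by (rule kernel_lborel_integrable[OF K(1)])
    note 1 = conv_increment[OF K(1,3) torus_L2_L1[OF g]]
    have FI: "integrable (\<mu> \<Otimes>\<^sub>M lborel) (\<lambda>(x, y). K y * (f x \<bullet> (g (x - y) - g x)))"
    proof (rule kernel_integrable[OF Ki, where \<Theta> = "\<lambda>x z. f x \<bullet> (g z - g x)"
          and p = "\<lambda>x. 2 * (norm (f x))\<^sup>2 + (norm (g x))\<^sup>2" and q = "\<lambda>x. (norm (g x))\<^sup>2"])
      show "(\<lambda>(x, z). f x \<bullet> (g z - g x)) \<in> borel_measurable (borel \<Otimes>\<^sub>M borel)" by measurable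
      show "\<bar>f x \<bullet> (g z - g x)\<bar> \<le> 2 * (norm (f x))\<^sup>2 + (norm (g x))\<^sup>2 + (norm (g z))\<^sup>2" for x z
        using inner_le_squares[of "f x" "g z"] inner_le_squares[of "f x" "g x"]
        by (simp add: inner_diff_right)
    qed (use f2 g2 pg in \<open>auto simp: periodic_def\<close>)
    have "(LINT x|\<mu>. f x \<bullet> conv K g x) - (LINT x|\<mu>. f x \<bullet> g x) =
        (LINT x|\<mu>. f x \<bullet> conv K g x - f x \<bullet> g x)"
      using integrable_inner_Lp2[OF f g] integrable_inner_Lp2[OF f torus_Lp2_conv[OF K(1) torus_L2_L1[OF g]]]
      by simp
    also have "\<dots> = (LINT y|lborel. (LINT x|\<mu>. K y * (f x \<bullet> (g (x - y) - g x))))"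
      unfolding 1 by (rule torus_lborel.Fubini_integral[OF FI, symmetric])
    finally have "\<bar>(LINT x|\<mu>. f x \<bullet> conv K g x) - (LINT x|\<mu>. f x \<bullet> g x)\<bar> \<le>
        (LINT y|lborel. \<bar>LINT x|\<mu>. K y * (f x \<bullet> (g (x - y) - g x))\<bar>)"
      using integral_abs_bound by simp
    also have "\<dots> \<le> (LINT y|lborel. K y * e)"
    proof (rule Bochner_Integration.integral_mono')
      show "integrable lborel (\<lambda>y. K y * e)" using Ki by simp
      show "\<bar>LINT x|\<mu>. K y * (f x \<bullet> (g (x - y) - g x))\<bar> \<le> K y * e" for y
      proof (cases "norm y < d")
        case True
        have "\<bar>LINT x|\<mu>. K y * (f x \<bullet> (g (x - y) - g x))\<bar> =
            K y * \<bar>LINT x|\<mu>. f x \<bullet> (g (x - y) - g x)\<bar>"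
          using K(2)[of y] by (simp add: abs_mult)
        also have "\<dots> \<le> K y * e" using c[OF True] K(2)[of y] by (intro mult_left_mono)
        finally show ?thesis .
      qed (use K(4) in simp)
      show "0 \<le> K y * e" for y using K(2)[of y] e by simp
    qed
    also have "\<dots> = e" using K(3) by simp
    finally show ?thesis .
  qed
  show ?thesis
  proof (intro exI[of _ d] conjI allI impI d(1))
    fix \<epsilon> :: real and \<rho> :: "real ^ 'n \<Rightarrow> real"
    assume \<epsilon>: "\<epsilon> < 1/4" "\<epsilon> \<le> d" and \<rho>: "mollifier C \<epsilon> \<rho>"
    show "\<bar>(LINT x|\<mu>. f x \<bullet> conv \<rho> g x) - (LINT x|\<mu>. f x \<bullet> g x)\<bar> \<le> e"
    proof (rule bound)
      show "kernel \<rho>" by (rule mollifier_kernel[OF \<rho> \<epsilon>(1)])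
      show "0 \<le> \<rho> y" for y using \<rho> unfolding mollifier_def by auto
      show "integral\<^sup>L lborel \<rho> = 1" using \<rho> unfolding mollifier_def by auto
      show "\<rho> y = 0" if "d \<le> norm y" for y using \<rho> \<epsilon>(2) that unfolding mollifier_def by auto
    qed
  qed
qed


subsection \<open>The helicity flux\<close>

unbundle cross3_syntax

abbreviation deriv_kernel :: "(real ^ 'n \<Rightarrow> real) \<Rightarrow> 'n \<Rightarrow> real ^ 'n \<Rightarrow> real" where
  "deriv_kernel \<rho> k \<equiv> \<lambda>y. frechet_derivative \<rho> (at y) (axis k 1)"

definition flux :: "(real ^ 3 \<Rightarrow> real) \<Rightarrow> (real ^ 3 \<Rightarrow> real ^ 3) \<Rightarrow> (real ^ 3 \<Rightarrow> real ^ 3) \<Rightarrow>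
    (real ^ 3 \<Rightarrow> real ^ 3) \<Rightarrow> real" where
  "flux \<rho> u h f = (LINT x|\<mu>. conv \<rho> f x \<bullet> (u x \<times> h x) +
     (\<Sum>k\<in>UNIV. h x $ k * (h x \<bullet> conv (deriv_kernel \<rho> k) f x)))"

definition cubic_mass :: "(real ^ 3 \<Rightarrow> real ^ 3) \<Rightarrow> (real ^ 3 \<Rightarrow> real ^ 3) \<Rightarrow> real" where
  "cubic_mass u h = (LINT x|\<mu>. norm (u x) ^ 3 + norm (h x) ^ 3)"

text \<open>The averaging of the Besov-VMO modulus written as a kernel, so that the same Fubini
  lemmas apply to it as to \<rho>.\<close>

definition ball_kernel :: "real \<Rightarrow> real ^ 'n \<Rightarrow> real" where
  "ball_kernel \<epsilon> y = indicator (ball 0 \<epsilon>) y / measure lborel (ball (0 :: real ^ 'n) \<epsilon>)"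

text \<open>The space integral of the Besov-VMO modulus for \<open>q = 3\<close> at a single time,
  with no root taken.\<close>

definition cubic_modulus :: "real \<Rightarrow> (real ^ 'n \<Rightarrow> real ^ 'n) \<Rightarrow> real" where
  "cubic_modulus \<epsilon> f =
     (LINT x|\<mu>. (LINT y|lborel. ball_kernel \<epsilon> y * norm (f x - f (x - y)) ^ 3))"

section \<open>Elementary cubic inequalities\<close>

lemma norm_cross_le: "norm (a \<times> b) \<le> norm a * norm b"
proof -
  have "(norm (a \<times> b))\<^sup>2 \<le> (norm a * norm b)\<^sup>2"
    using norm_cross[of a b] by (simp add: power_mult_distrib)
  then show ?thesis by (rule power2_le_imp_le) simp
qed

lemma cube_mixed_le:
  fixes p q :: real
  assumes "0 \<le> p" "0 \<le> q" shows "p * q\<^sup>2 \<le> p ^ 3 + q ^ 3"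
proof (cases "p \<le> q")
  case True
  then have "p * q\<^sup>2 \<le> q * q\<^sup>2" by (rule mult_right_mono) simp
  also have "\<dots> = q ^ 3" by (simp add: power2_eq_square power3_eq_cube)
  finally show ?thesis using zero_le_power[OF assms(1), of 3] by linarith
next
  case False
  then have "p * q\<^sup>2 \<le> p * p\<^sup>2" using assms by (intro mult_left_mono power_mono) auto
  also have "\<dots> = p ^ 3" by (simp add: power2_eq_square power3_eq_cube)
  finally show ?thesis using zero_le_power[OF assms(2), of 3] by linarith
qed

lemma square_le_cube: "0 \<le> (p::real) \<Longrightarrow> p\<^sup>2 \<le> 1 + p ^ 3"
  using cube_mixed_le[of 1 p] by simp

text \<open>The constant is \<open>2 ^ (3 - 1)\<close>, from convexity of the cube; after expansion
  the claim for the norms is \<open>0 \<le> (p + q) * (p - q)^2\<close>.\<close>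

lemma cube_diff_le:
  fixes a b :: "'b::real_normed_vector"
  shows "norm (a - b) ^ 3 \<le> 4 * (norm a ^ 3 + norm b ^ 3)"
proof -
  have "norm (a - b) ^ 3 \<le> (norm a + norm b) ^ 3"
    by (intro power_mono norm_triangle_ineq4) simp
  also have "\<dots> = norm a ^ 3 + norm b ^ 3 + 3 * (norm a * (norm b)\<^sup>2 + norm b * (norm a)\<^sup>2)"
    by (simp add: power2_eq_square power3_eq_cube algebra_simps)
  also have "norm a * (norm b)\<^sup>2 + norm b * (norm a)\<^sup>2 \<le> norm a ^ 3 + norm b ^ 3"
  proof -
    have "norm a ^ 3 + norm b ^ 3 - (norm a * (norm b)\<^sup>2 + norm b * (norm a)\<^sup>2) =
        (norm a + norm b) * (norm a - norm b)\<^sup>2"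
      by (simp add: power2_eq_square power3_eq_cube algebra_simps)
    also have "0 \<le> \<dots>" by simp
    finally show ?thesis by simp
  qed
  finally show ?thesis by simp
qed

text \<open>With \<open>m\<close> the larger of \<open>b\<close> and \<open>c\<close>, compare
  \<open>a\<close> with \<open>e * m\<close>: below it the product is at most
  \<open>e * m^3\<close>, above it at most \<open>a^3 / e^2\<close>. The increment of
  \<open>h\<close> will play \<open>a\<close>; the fields themselves, which do not decay with
  \<epsilon>, play \<open>b\<close> and \<open>c\<close> and get the small weight.\<close>

lemma triple_product_le:
  fixes a b c e :: real
  assumes "0 \<le> a" "0 \<le> b" "0 \<le> c" "0 < e"
  shows "a * b * c \<le> a ^ 3 / e\<^sup>2 + e * (b ^ 3 + c ^ 3)"
proof -
  define m where "m = max b c"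
  have m: "0 \<le> m" "b \<le> m" "c \<le> m" using assms by (auto simp: m_def)
  have m3: "m ^ 3 \<le> b ^ 3 + c ^ 3"
    using assms zero_le_power[of b 3] zero_le_power[of c 3] by (simp add: m_def max_def)
  have "a * b * c \<le> a * (m * m)"
    using assms m by (simp add: mult.assoc mult_left_mono mult_mono)
  also have "\<dots> \<le> a ^ 3 / e\<^sup>2 + e * m ^ 3"
  proof (cases "a \<le> e * m")
    case True
    then have "a * (m * m) \<le> e * m * (m * m)" by (rule mult_right_mono) simp
    also have "\<dots> = e * m ^ 3" by (simp add: power3_eq_cube)
    also have "\<dots> \<le> a ^ 3 / e\<^sup>2 + e * m ^ 3" using assms by simp
    finally show ?thesis .
  next
    case False
    then have "m \<le> a / e" using assms by (simp add: field_simps)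
    then have "a * (m * m) \<le> a * (a / e * (a / e))" using assms m by (intro mult_left_mono mult_mono) auto
    also have "\<dots> = a ^ 3 / e\<^sup>2" by (simp add: power2_eq_square power3_eq_cube)
    also have "\<dots> \<le> a ^ 3 / e\<^sup>2 + e * m ^ 3" using assms m by simp
    finally show ?thesis .
  qed
  also have "\<dots> \<le> a ^ 3 / e\<^sup>2 + e * (b ^ 3 + c ^ 3)" using m3 assms by simp
  finally show ?thesis .
qed

section \<open>Bounds for the flux at a fixed mollifier\<close>

lemma measure_torus_measure: "measure \<mu> UNIV = 1"
  by (simp add: measure_def prob_torus_measure)

lemma torus_L3_D:
  assumes "torus_Lp 3 f"
  shows "f \<in> borel_measurable borel" "periodic f" "integrable \<mu> (\<lambda>x. norm (f x) ^ 3)"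
  using assms by (simp_all add: torus_Lp_numeral)

lemma torus_L3_L2:
  assumes "torus_Lp 3 f" shows "torus_Lp 2 f"
proof -
  note f = torus_L3_D[OF assms]
  note [measurable] = f(1)
  have "integrable \<mu> (\<lambda>x. (norm (f x))\<^sup>2)"
  proof (rule Bochner_Integration.integrable_bound)
    show "integrable \<mu> (\<lambda>x. 1 + norm (f x) ^ 3)" using f(3) by simp
    have "norm ((norm (f x))\<^sup>2) \<le> norm (1 + norm (f x) ^ 3)" for x
      using square_le_cube[OF norm_ge_zero[of "f x"]] by simp
    then show "AE x in \<mu>. norm ((norm (f x))\<^sup>2) \<le> norm (1 + norm (f x) ^ 3)" by simp
  qed measurable
  then show ?thesis using f by (simp add: torus_Lp_numeral)
qed

lemma vec_nth_measurable [measurable]: "(\<lambda>v :: real ^ 'n. v $ i) \<in> borel_measurable borel"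
  by (intro borel_measurable_continuous_onI continuous_intros)

lemma cross3_measurable [measurable (raw)]:
  assumes "f \<in> borel_measurable M" "g \<in> borel_measurable M"
  shows "(\<lambda>x. f x \<times> g x) \<in> borel_measurable M"
proof -
  have "continuous_on UNIV (\<lambda>p :: (real ^ 3) \<times> (real ^ 3). fst p \<times> snd p)"
    by (intro continuous_on_cross continuous_intros)
  then have "(\<lambda>p :: (real ^ 3) \<times> (real ^ 3). fst p \<times> snd p) \<in> borel_measurable borel"
    by (rule borel_measurable_continuous_onI)
  from measurable_compose[OF borel_measurable_Pair[OF assms] this] show ?thesis by simp
qed

text \<open>The mollified fields are bounded, so \<open>L^2\<close> is enough for \<open>u\<close>
  and \<open>h\<close>, and this is available at every time. The 4 counts the transport term and the
  three components of the Hall term.\<close>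

lemma flux_integrands:
  assumes \<rho>: "kernel \<rho>" and u: "torus_Lp 2 u" and h: "torus_Lp 2 h" and f: "torus_L1 f"
    and B: "0 \<le> B" "\<And>x. norm (conv \<rho> f x) \<le> B" "\<And>k x. norm (conv (deriv_kernel \<rho> k) f x) \<le> B"
  shows "integrable \<mu> (\<lambda>x. conv \<rho> f x \<bullet> (u x \<times> h x))"
    and "integrable \<mu> (\<lambda>x. \<Sum>k\<in>UNIV. h x $ k * (h x \<bullet> conv (deriv_kernel \<rho> k) f x))"
    and "\<bar>flux \<rho> u h f\<bar> \<le> 4 * B * (LINT x|\<mu>. (norm (u x))\<^sup>2 + (norm (h x))\<^sup>2)"
proof -
  have [measurable]: "u \<in> borel_measurable borel" "h \<in> borel_measurable borel"
    and sq: "integrable \<mu> (\<lambda>x. (norm (u x))\<^sup>2)" "integrable \<mu> (\<lambda>x. (norm (h x))\<^sup>2)"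
    using u h by (simp_all add: torus_Lp_numeral)
  note [measurable] = conv_measurable[OF \<rho> f] conv_measurable[OF kernel_frechet[OF \<rho>] f]
  let ?I1 = "\<lambda>x. conv \<rho> f x \<bullet> (u x \<times> h x)"
  let ?I2 = "\<lambda>x. \<Sum>k\<in>UNIV. h x $ k * (h x \<bullet> conv (deriv_kernel \<rho> k) f x)"
  let ?Q = "\<lambda>x. 4 * B * ((norm (u x))\<^sup>2 + (norm (h x))\<^sup>2)"
  have Q: "integrable \<mu> ?Q" using sq by simp
  have Q0: "0 \<le> ?Q x" for x using B(1) by simp
  have b: "\<bar>?I1 x\<bar> + \<bar>?I2 x\<bar> \<le> ?Q x" for x
  proof -
    have "\<bar>?I1 x\<bar> \<le> norm (conv \<rho> f x) * norm (u x \<times> h x)" by (rule Cauchy_Schwarz_ineq2)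
    also have "\<dots> \<le> B * (norm (u x) * norm (h x))" by (intro mult_mono B norm_cross_le) auto
    also have "\<dots> \<le> B * ((norm (u x))\<^sup>2 + (norm (h x))\<^sup>2)"
      using inner_le_squares[of "norm (u x)" "norm (h x)"] by (intro mult_left_mono B(1)) simp
    finally have 1: "\<bar>?I1 x\<bar> \<le> B * ((norm (u x))\<^sup>2 + (norm (h x))\<^sup>2)" .
    have "\<bar>?I2 x\<bar> \<le> (\<Sum>k\<in>(UNIV::3 set). B * (norm (h x))\<^sup>2)"
    proof (rule order_trans[OF sum_abs sum_mono])
      fix k :: 3
      have "\<bar>h x \<bullet> conv (deriv_kernel \<rho> k) f x\<bar> \<le> norm (h x) * norm (conv (deriv_kernel \<rho> k) f x)"
        by (rule Cauchy_Schwarz_ineq2)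
      also have "\<dots> \<le> norm (h x) * B" by (intro mult_left_mono B) simp
      finally have "\<bar>h x $ k * (h x \<bullet> conv (deriv_kernel \<rho> k) f x)\<bar> \<le> norm (h x) * (norm (h x) * B)"
        unfolding abs_mult by (intro mult_mono component_le_norm_cart) auto
      then show "\<bar>h x $ k * (h x \<bullet> conv (deriv_kernel \<rho> k) f x)\<bar> \<le> B * (norm (h x))\<^sup>2"
        by (simp add: power2_eq_square mult_ac)
    qed
    then have "\<bar>?I2 x\<bar> \<le> 3 * (B * (norm (h x))\<^sup>2)" by simp
    moreover have "0 \<le> B * (norm (u x))\<^sup>2" using B(1) by simp
    ultimately show ?thesis using 1 by (simp add: distrib_left)
  qed
  have n1: "norm (?I1 x) \<le> norm (?Q x)" and n2: "norm (?I2 x) \<le> norm (?Q x)" for x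
    using b[of x] abs_ge_zero[of "?I1 x"] abs_ge_zero[of "?I2 x"]
    unfolding real_norm_def abs_of_nonneg[OF Q0] by linarith+
  show "integrable \<mu> ?I1"
    by (rule Bochner_Integration.integrable_bound[OF Q _ AE_I2[OF n1]]) measurable
  show "integrable \<mu> ?I2"
    by (rule Bochner_Integration.integrable_bound[OF Q _ AE_I2[OF n2]]) measurable
  have "\<bar>flux \<rho> u h f\<bar> \<le> (LINT x|\<mu>. \<bar>?I1 x + ?I2 x\<bar>)"
    unfolding flux_def by (rule integral_abs_bound)
  also have "\<dots> \<le> (LINT x|\<mu>. ?Q x)"
    by (rule Bochner_Integration.integral_mono'[OF Q order_trans[OF abs_triangle_ineq b] Q0])
  finally show "\<bar>flux \<rho> u h f\<bar> \<le> 4 * B * (LINT x|\<mu>. (norm (u x))\<^sup>2 + (norm (h x))\<^sup>2)"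
    by simp
qed

text \<open>The constant is independent of \<open>f\<close>, because it will be applied to
  differences of \<open>h\<close> between two times. The bounds of the finitely many derivative
  kernels are simply added.\<close>

lemma conv_uniform_bounds:
  fixes \<rho> :: "real ^ 'n \<Rightarrow> real"
  assumes "kernel \<rho>"
  obtains b where "0 \<le> b"
    "\<And>(f :: real ^ 'n \<Rightarrow> 'b::euclidean_space) x. torus_L1 f \<Longrightarrow>
      norm (conv \<rho> f x) \<le> b * (LINT x|\<mu>. norm (f x))"
    "\<And>(f :: real ^ 'n \<Rightarrow> 'b) k x. torus_L1 f \<Longrightarrow>
      norm (conv (deriv_kernel \<rho> k) f x) \<le> b * (LINT x|\<mu>. norm (f x))"
proof -
  obtain b where b: "0 \<le> b" "\<And>y. \<bar>\<rho> y\<bar> \<le> b" by (rule kernel_bounded[OF assms(1)]) (rule that)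
  have "\<forall>k. \<exists>b. 0 \<le> b \<and> (\<forall>y. \<bar>deriv_kernel \<rho> k y\<bar> \<le> b)"
  proof
    fix k
    obtain b where "0 \<le> b" "\<And>y. \<bar>deriv_kernel \<rho> k y\<bar> \<le> b"
      by (rule kernel_bounded[OF kernel_frechet[OF assms(1), of "axis k 1"]]) (rule that)
    then show "\<exists>b. 0 \<le> b \<and> (\<forall>y. \<bar>deriv_kernel \<rho> k y\<bar> \<le> b)" by auto
  qed
  from choice[OF this] obtain c where
    c: "\<And>k. 0 \<le> c k" "\<And>k y. \<bar>deriv_kernel \<rho> k y\<bar> \<le> c k" by auto
  have s: "0 \<le> (\<Sum>k\<in>UNIV. c k)" "c k \<le> (\<Sum>k\<in>UNIV. c k)" for k
    using c(1) by (auto intro: sum_nonneg member_le_sum)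
  show thesis
  proof
    show "0 \<le> b + (\<Sum>k\<in>UNIV. c k)" using b s by simp
    show "norm (conv \<rho> f x) \<le> (b + (\<Sum>k\<in>UNIV. c k)) * (LINT x|\<mu>. norm (f x))"
      if "torus_L1 f" for f :: "real ^ 'n \<Rightarrow> 'b" and x
    proof -
      have "norm (conv \<rho> f x) \<le> b * (LINT x|\<mu>. norm (f x))" by (rule conv_bound[OF assms that b(2)])
      also have "\<dots> \<le> (b + (\<Sum>k\<in>UNIV. c k)) * (LINT x|\<mu>. norm (f x))"
        using s by (intro mult_right_mono) auto
      finally show ?thesis .
    qed
    show "norm (conv (deriv_kernel \<rho> k) f x) \<le> (b + (\<Sum>k\<in>UNIV. c k)) * (LINT x|\<mu>. norm (f x))"
      if "torus_L1 f" for f :: "real ^ 'n \<Rightarrow> 'b" and k x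
    proof -
      have "norm (conv (deriv_kernel \<rho> k) f x) \<le> c k * (LINT x|\<mu>. norm (f x))"
        by (rule conv_bound[OF kernel_frechet[OF assms(1)] that c(2)])
      also have "\<dots> \<le> (b + (\<Sum>k\<in>UNIV. c k)) * (LINT x|\<mu>. norm (f x))"
        using s(2)[of k] b(1) by (intro mult_right_mono) auto
      finally show ?thesis .
    qed
  qed
qed

lemma conv_bounds:
  assumes "kernel \<rho>" "torus_L1 f"
  obtains B where "0 \<le> B" "\<And>x. norm (conv \<rho> f x) \<le> B" "\<And>k x. norm (conv (deriv_kernel \<rho> k) f x) \<le> B"
proof (rule conv_uniform_bounds[OF assms(1)])
  fix b assume "0 \<le> b"
    "\<And>f x. torus_L1 f \<Longrightarrow> norm (conv \<rho> f x :: 'b) \<le> b * (LINT x|\<mu>. norm (f x))"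
    "\<And>f k x. torus_L1 f \<Longrightarrow> norm (conv (deriv_kernel \<rho> k) f x :: 'b) \<le> b * (LINT x|\<mu>. norm (f x))"
  then show thesis using that[of "b * (LINT x|\<mu>. norm (f x))"] assms(2) by simp
qed

text \<open>The constant varies with the mollifier, but the bound is proportional to the
  \<open>L^1\<close> norm of \<open>f\<close>: this pays for freezing \<open>h\<close> in time and
  makes the flux integrable over time. The 2 comes from bounding each square by 1 plus a cube on a
  space of mass 1.\<close>

lemma flux_L1_bound:
  assumes "kernel \<rho>"
  obtains b where "0 \<le> b" "\<And>u h f. \<lbrakk>torus_Lp 3 u; torus_Lp 3 h; torus_L1 f\<rbrakk> \<Longrightarrow>
    \<bar>flux \<rho> u h f\<bar> \<le> b * (LINT x|\<mu>. norm (f x)) * (2 + cubic_mass u h)"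
proof (rule conv_uniform_bounds[OF assms])
  fix b assume b: "0 \<le> b"
    "\<And>f x. torus_L1 f \<Longrightarrow> norm (conv \<rho> f x :: real ^ 3) \<le> b * (LINT x|\<mu>. norm (f x))"
    "\<And>f k x. torus_L1 f \<Longrightarrow> norm (conv (deriv_kernel \<rho> k) f x :: real ^ 3) \<le> b * (LINT x|\<mu>. norm (f x))"
  show thesis
  proof (rule that)
    fix u h f :: "real ^ 3 \<Rightarrow> real ^ 3"
    assume u: "torus_Lp 3 u" and h: "torus_Lp 3 h" and f: "torus_L1 f"
    let ?N = "LINT x|\<mu>. norm (f x)"
    have "\<bar>flux \<rho> u h f\<bar> \<le> 4 * (b * ?N) * (LINT x|\<mu>. (norm (u x))\<^sup>2 + (norm (h x))\<^sup>2)"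
      by (rule flux_integrands(3)[OF assms torus_L3_L2[OF u] torus_L3_L2[OF h] f]) (use b f in auto)
    also have "\<dots> \<le> 4 * (b * ?N) * (LINT x|\<mu>. 2 + (norm (u x) ^ 3 + norm (h x) ^ 3))"
    proof (rule mult_left_mono[OF Bochner_Integration.integral_mono'])
      show "(norm (u x))\<^sup>2 + (norm (h x))\<^sup>2 \<le> 2 + (norm (u x) ^ 3 + norm (h x) ^ 3)" for x
        using square_le_cube[OF norm_ge_zero[of "u x"]] square_le_cube[OF norm_ge_zero[of "h x"]] by simp
    qed (use b torus_L3_D(3)[OF u] torus_L3_D(3)[OF h] in auto)
    also have "\<dots> = 4 * b * ?N * (2 + cubic_mass u h)"
      using torus_L3_D(3)[OF u] torus_L3_D(3)[OF h] by (simp add: cubic_mass_def measure_torus_measure)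
    finally show "\<bar>flux \<rho> u h f\<bar> \<le> 4 * b * ?N * (2 + cubic_mass u h)" .
  qed (use b in simp)
qed

lemma flux_diff:
  assumes \<rho>: "kernel \<rho>" and u: "torus_Lp 2 u" and h: "torus_Lp 2 h" and f: "torus_L1 f" and g: "torus_L1 g"
  shows "flux \<rho> u h (\<lambda>x. f x - g x) = flux \<rho> u h f - flux \<rho> u h g"
proof -
  obtain B where B: "0 \<le> B" "\<And>x. norm (conv \<rho> f x) \<le> B" "\<And>k x. norm (conv (deriv_kernel \<rho> k) f x) \<le> B"
    using conv_bounds[OF \<rho> f] by blast
  obtain C where C: "0 \<le> C" "\<And>x. norm (conv \<rho> g x) \<le> C" "\<And>k x. norm (conv (deriv_kernel \<rho> k) g x) \<le> C"
    using conv_bounds[OF \<rho> g] by blast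
  show ?thesis
    unfolding flux_def conv_diff[OF \<rho> f g] conv_diff[OF kernel_frechet[OF \<rho>] f g]
      inner_diff_left inner_diff_right right_diff_distrib sum_subtractf
    using flux_integrands(1,2)[OF \<rho> u h f B] flux_integrands(1,2)[OF \<rho> u h g C]
    by simp
qed

section \<open>The flux at equal times, through increments\<close>

text \<open>Common form of the structure functions below: a function of two values of
  \<open>h\<close> with cubic growth, which is what an \<open>L^3\<close> field permits.\<close>

lemma cubic_kernel_integrable:
  assumes K: "integrable lborel K" and h: "torus_Lp 3 h"
    and V: "(\<lambda>(a, b). V a b) \<in> borel_measurable (borel \<Otimes>\<^sub>M borel)"
    and c: "0 \<le> c" "\<And>a b. \<bar>V a b\<bar> \<le> c * (norm a ^ 3 + norm b ^ 3)"
  shows "integrable (\<mu> \<Otimes>\<^sub>M lborel) (\<lambda>(x, y). K y * V (h x) (h (x - y)))"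
    and "(LINT x|\<mu>. (LINT y|lborel. K y * V (h x) (h (x - y)))) =
      (LINT x|\<mu>. (LINT y|lborel. K (- y) * V (h (x - y)) (h x)))"
proof -
  note hD = torus_L3_D[OF h]
  note [measurable] = hD(1)
  have m: "(\<lambda>(x, z). V (h x) (h z)) \<in> borel_measurable (borel \<Otimes>\<^sub>M borel)"
  proof -
    have "(\<lambda>p. (h (fst p), h (snd p))) \<in> borel \<Otimes>\<^sub>M borel \<rightarrow>\<^sub>M borel \<Otimes>\<^sub>M borel" by measurable
    from measurable_compose[OF this V] show ?thesis by (simp add: split_beta')
  qed
  have b: "\<bar>V (h x) (h z)\<bar> \<le> c * norm (h x) ^ 3 + c * norm (h z) ^ 3" for x z
    using c(2)[of "h x" "h z"] by (simp add: distrib_left)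
  have p: "integrable \<mu> (\<lambda>x. c * norm (h x) ^ 3)" "\<And>x. 0 \<le> c * norm (h x) ^ 3"
    "periodic (\<lambda>x. c * norm (h x) ^ 3)"
    using hD c by (auto simp: periodic_def)
  show "integrable (\<mu> \<Otimes>\<^sub>M lborel) (\<lambda>(x, y). K y * V (h x) (h (x - y)))"
    by (rule kernel_integrable[OF K m b p(1,2) p])
  show "(LINT x|\<mu>. (LINT y|lborel. K y * V (h x) (h (x - y)))) =
      (LINT x|\<mu>. (LINT y|lborel. K (- y) * V (h (x - y)) (h x)))"
    by (rule kernel_swap[OF K m b p p]) (use hD(2) in \<open>simp add: periodic_def\<close>)
qed

lemma iterated_integral_le:
  fixes P Q :: "real ^ 'n \<Rightarrow> real ^ 'n \<Rightarrow> real"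
  assumes "integrable (\<mu> \<Otimes>\<^sub>M lborel) (\<lambda>(x, y). P x y)"
    and "integrable (\<mu> \<Otimes>\<^sub>M lborel) (\<lambda>(x, y). Q x y)"
    and "\<And>x y. \<bar>P x y\<bar> \<le> Q x y"
  shows "\<bar>LINT x|\<mu>. (LINT y|lborel. P x y)\<bar> \<le>
    (LINT (x, y)|(\<mu> \<Otimes>\<^sub>M lborel). Q x y)"
proof -
  have "\<bar>LINT z|(\<mu> \<Otimes>\<^sub>M lborel). (case z of (x, y) \<Rightarrow> P x y)\<bar> \<le>
      (LINT z|(\<mu> \<Otimes>\<^sub>M lborel). \<bar>case z of (x, y) \<Rightarrow> P x y\<bar>)"
    by (rule integral_abs_bound)
  also have "\<dots> \<le> (LINT z|(\<mu> \<Otimes>\<^sub>M lborel). (case z of (x, y) \<Rightarrow> Q x y))"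
  proof (rule Bochner_Integration.integral_mono'[OF assms(2)])
    show "\<bar>case z of (x, y) \<Rightarrow> P x y\<bar> \<le> (case z of (x, y) \<Rightarrow> Q x y)" for z
      using assms(3) by (cases z) simp
    then show "0 \<le> (case z of (x, y) \<Rightarrow> Q x y)" for z using abs_ge_zero order_trans by blast
  qed
  finally show ?thesis
    by (simp add: torus_lborel.integral_fst[OF assms(1)])
qed

lemma frechet_derivative_sum_axis:
  fixes K :: "real ^ 'n \<Rightarrow> real"
  assumes "smooth K"
  shows "(\<Sum>k\<in>UNIV. frechet_derivative K (at y) (axis k 1) * v $ k) = frechet_derivative K (at y) v"
proof -
  have lin: "linear (frechet_derivative K (at y))"
    using has_derivative_linear[OF smooth_has_derivative[OF assms]] .
  have "frechet_derivative K (at y) v = frechet_derivative K (at y) (\<Sum>k\<in>UNIV. (v $ k) *\<^sub>R axis k 1)"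
    by (rule arg_cong[OF vec_sum_axis])
  then show ?thesis by (simp add: linear_sum[OF lin] linear_scale[OF lin] mult.commute)
qed

lemma deriv_kernel_integral_zero:
  assumes K: "kernel K" "\<And>y. K (- y) = K y"
  shows "(LINT y|lborel. deriv_kernel K k y) = 0"
proof -
  have "(LINT y|lborel. deriv_kernel K k (0 - y)) = (LINT y|lborel. deriv_kernel K k y)"
    by (rule integral_lborel_diff[OF kernel_measurable[OF kernel_frechet[OF K(1)]]])
  moreover have "(LINT y|lborel. deriv_kernel K k (0 - y)) = - (LINT y|lborel. deriv_kernel K k y)"
    by (simp add: frechet_derivative_even[OF kernel_smooth[OF K(1)] K(2)])
  ultimately show ?thesis by simp
qed

lemma ball_kernel_facts:
  fixes y :: "real ^ 'n"
  assumes "0 < \<epsilon>"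
  shows "integrable lborel (ball_kernel \<epsilon> :: real ^ 'n \<Rightarrow> real)"
    and "(LINT y|(lborel :: (real ^ 'n) measure). ball_kernel \<epsilon> y) = 1"
    and "ball_kernel \<epsilon> (- y) = ball_kernel \<epsilon> y" and "0 \<le> ball_kernel \<epsilon> y"
proof -
  have b: "0 < measure lborel (ball (0 :: real ^ 'n) \<epsilon>)" using assms by (simp add: content_ball_pos)
  show "integrable lborel (ball_kernel \<epsilon> :: real ^ 'n \<Rightarrow> real)"
    unfolding ball_kernel_def[abs_def]
    by (intro integrable_divide integrable_real_indicator emeasure_bounded_finite) auto
  show "(LINT y|(lborel :: (real ^ 'n) measure). ball_kernel \<epsilon> y) = 1"
    unfolding ball_kernel_def using b by simp
  show "ball_kernel \<epsilon> (- y) = ball_kernel \<epsilon> y" by (simp add: ball_kernel_def indicator_def)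
  show "0 \<le> ball_kernel \<epsilon> y" by (simp add: ball_kernel_def)
qed

lemma mollifier_facts:
  fixes \<rho> :: "real ^ 'n \<Rightarrow> real"
  assumes "mollifier C \<epsilon> \<rho>" "0 < \<epsilon>"
  shows "0 \<le> C" and "\<rho> y \<le> C * ball_kernel \<epsilon> y"
    and "\<bar>frechet_derivative \<rho> (at y) v\<bar> \<le> C / \<epsilon> * ball_kernel \<epsilon> y * norm v"
proof -
  have m: "smooth \<rho>" "\<And>y. \<epsilon> \<le> norm y \<Longrightarrow> \<rho> y = 0" "\<And>y. 0 \<le> \<rho> y"
    "\<And>y. \<rho> y \<le> C / measure lborel (ball (0 :: real ^ 'n) \<epsilon>)"
    "\<And>y v. \<bar>frechet_derivative \<rho> (at y) v\<bar> \<le> C / (\<epsilon> * measure lborel (ball (0 :: real ^ 'n) \<epsilon>)) * norm v"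
    using assms(1) unfolding mollifier_def by auto
  have b: "0 < measure lborel (ball (0 :: real ^ 'n) \<epsilon>)" using assms(2) by (simp add: content_ball_pos)
  have "0 \<le> C / measure lborel (ball (0 :: real ^ 'n) \<epsilon>)" using m(3,4) order_trans by blast
  then show "0 \<le> C" using b by (simp add: zero_le_divide_iff)
  show "\<rho> y \<le> C * ball_kernel \<epsilon> y" using m(2,4)[of y] by (cases "norm y < \<epsilon>") (auto simp: ball_kernel_def)
  show "\<bar>frechet_derivative \<rho> (at y) v\<bar> \<le> C / \<epsilon> * ball_kernel \<epsilon> y * norm v"
  proof (cases "norm y < \<epsilon>")
    case True
    then show ?thesis using m(5)[of y v] by (simp add: ball_kernel_def)
  next
    case False
    then have "\<rho> y = 0" using m(2) by simp
    \<comment> \<open>Here \<rho> attains its minimum 0, so its derivative vanishes. The argument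
      includes the sphere of radius \<epsilon>.\<close>
    then have "frechet_derivative \<rho> (at y) = (\<lambda>v. 0)"
      by (intro differential_zero_maxmin[OF _ _ smooth_has_derivative[OF m(1)], of _ UNIV]) (use m(3) in auto)
    then show ?thesis using False by (simp add: ball_kernel_def)
  qed
qed

text \<open>No derivative falls on \<rho>, hence there is no factor \<open>1 / \<epsilon>\<close>;
  the weight \<open>e\<close> comes from \<open>triple_product_le\<close>, with the increment in the
  role of \<open>a\<close>.\<close>

lemma flux_transport_bound:
  assumes \<rho>: "mollifier C \<epsilon> \<rho>" and \<epsilon>: "0 < \<epsilon>" "\<epsilon> < 1/4" and u: "torus_Lp 3 u" and h: "torus_Lp 3 h"
    and e: "0 < e"
  shows "\<bar>LINT x|\<mu>. conv \<rho> h x \<bullet> (u x \<times> h x)\<bar> \<le>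
    C / e\<^sup>2 * cubic_modulus \<epsilon> h + e * cubic_mass u h"
proof -
  note mf = mollifier_facts[OF \<rho> \<epsilon>(1)]
  have K: "kernel \<rho>" by (rule mollifier_kernel[OF \<rho> \<epsilon>(2)])
  have \<rho>0: "0 \<le> \<rho> y" for y using \<rho> unfolding mollifier_def by auto
  have \<rho>1: "integral\<^sup>L lborel \<rho> = 1" using \<rho> unfolding mollifier_def by auto
  note uD = torus_L3_D[OF u] and hD = torus_L3_D[OF h]
  note [measurable] = uD(1) hD(1) kernel_measurable[OF K]
  let ?P = "\<lambda>x y. \<rho> y * ((u x \<times> h x) \<bullet> (h (x - y) - h x))"
  let ?Q1 = "\<lambda>x y. ball_kernel \<epsilon> y * norm (h x - h (x - y)) ^ 3"
  \<comment> \<open>In this part \<rho> is not replaced by the ball kernel: its mass is exactly one,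
    so the integral is the cubic mass without the constant \<open>C\<close>.\<close>
  let ?Q2 = "\<lambda>x y. \<rho> y * (norm (u x) ^ 3 + norm (h x) ^ 3)"
  let ?Q = "\<lambda>x y. C / e\<^sup>2 * ?Q1 x y + e * ?Q2 x y"
  have Q1: "integrable (\<mu> \<Otimes>\<^sub>M lborel) (\<lambda>(x, y). ?Q1 x y)"
    by (rule cubic_kernel_integrable(1)[OF ball_kernel_facts(1)[OF \<epsilon>(1)] h, where V = "\<lambda>a b. norm (a - b) ^ 3" and c = 4])
      (measurable, auto intro: cube_diff_le[simplified])
  have Q2: "integrable (\<mu> \<Otimes>\<^sub>M lborel) (\<lambda>(x, y). ?Q2 x y)"
  proof (rule kernel_integrable[OF kernel_lborel_integrable[OF K], where \<Theta> = "\<lambda>x z. norm (u x) ^ 3 + norm (h x) ^ 3"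
        and p = "\<lambda>x. norm (u x) ^ 3 + norm (h x) ^ 3" and q = "\<lambda>x. 0"])
    show "(\<lambda>(x, z :: real ^ 3). norm (u x) ^ 3 + norm (h x) ^ 3) \<in> borel_measurable (borel \<Otimes>\<^sub>M borel)"
      by measurable
  qed (use uD hD in \<open>auto simp: periodic_def\<close>)
  have Q: "integrable (\<mu> \<Otimes>\<^sub>M lborel) (\<lambda>(x, y). ?Q x y)"
    using Bochner_Integration.integrable_add[OF integrable_mult_right[OF Q1, of "C / e\<^sup>2"]
        integrable_mult_right[OF Q2, of e]] by (simp add: split_beta')
  have PQ: "\<bar>?P x y\<bar> \<le> ?Q x y" for x y
  proof -
    let ?\<delta> = "h x - h (x - y)"
    have "\<bar>(u x \<times> h x) \<bullet> (h (x - y) - h x)\<bar> \<le> norm (u x \<times> h x) * norm (h (x - y) - h x)"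
      by (rule Cauchy_Schwarz_ineq2)
    also have "\<dots> \<le> (norm (u x) * norm (h x)) * norm ?\<delta>"
      by (intro mult_mono norm_cross_le) (auto simp: norm_minus_commute)
    also have "\<dots> \<le> norm ?\<delta> ^ 3 / e\<^sup>2 + e * (norm (u x) ^ 3 + norm (h x) ^ 3)"
      using triple_product_le[of "norm ?\<delta>" "norm (u x)" "norm (h x)" e] e by (simp add: mult_ac)
    finally have "\<bar>?P x y\<bar> \<le> \<rho> y * (norm ?\<delta> ^ 3 / e\<^sup>2 + e * (norm (u x) ^ 3 + norm (h x) ^ 3))"
      using \<rho>0[of y] by (simp add: abs_mult mult_left_mono)
    also have "\<dots> = \<rho> y * (norm ?\<delta> ^ 3 / e\<^sup>2) + e * ?Q2 x y" by (simp add: algebra_simps)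
    also have "\<rho> y * (norm ?\<delta> ^ 3 / e\<^sup>2) \<le> C * ball_kernel \<epsilon> y * (norm ?\<delta> ^ 3 / e\<^sup>2)"
      by (rule mult_right_mono[OF mf(2)]) simp
    finally show ?thesis by (simp add: mult_ac)
  qed
  have P: "integrable (\<mu> \<Otimes>\<^sub>M lborel) (\<lambda>(x, y). ?P x y)"
  proof (rule Bochner_Integration.integrable_bound[OF Q])
    show "(\<lambda>(x, y). ?P x y) \<in> borel_measurable (\<mu> \<Otimes>\<^sub>M lborel)" by measurable
    show "AE z in \<mu> \<Otimes>\<^sub>M lborel. norm (case z of (x, y) \<Rightarrow> ?P x y) \<le> norm (case z of (x, y) \<Rightarrow> ?Q x y)"
    proof (rule AE_I2)
      fix z :: "(real ^ 3) \<times> (real ^ 3)"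
      obtain x y where z: "z = (x, y)" by (cases z)
      show "norm (case z of (x, y) \<Rightarrow> ?P x y) \<le> norm (case z of (x, y) \<Rightarrow> ?Q x y)"
        unfolding z prod.case real_norm_def using PQ[where x = x and y = y] by linarith
    qed
  qed
  have "conv \<rho> h x \<bullet> (u x \<times> h x) = (LINT y|lborel. ?P x y)" for x
    using conv_increment[OF K \<rho>1 torus_L2_L1[OF torus_L3_L2[OF h]], of "u x \<times> h x" x]
    by (simp add: inner_commute dot_cross_self)
  then have "\<bar>LINT x|\<mu>. conv \<rho> h x \<bullet> (u x \<times> h x)\<bar> \<le>
      (LINT (x, y)|(\<mu> \<Otimes>\<^sub>M lborel). ?Q x y)"
    using iterated_integral_le[OF P Q PQ] by simp
  also have "\<dots> = C / e\<^sup>2 * (LINT (x, y)|(\<mu> \<Otimes>\<^sub>M lborel). ?Q1 x y) +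
      e * (LINT (x, y)|(\<mu> \<Otimes>\<^sub>M lborel). ?Q2 x y)"
    using Q1 Q2 by (simp add: split_beta')
  also have "(LINT (x, y)|(\<mu> \<Otimes>\<^sub>M lborel). ?Q1 x y) = cubic_modulus \<epsilon> h"
    unfolding torus_lborel.integral_fst[OF Q1, symmetric] by (simp add: cubic_modulus_def)
  also have "(LINT (x, y)|(\<mu> \<Otimes>\<^sub>M lborel). ?Q2 x y) = cubic_mass u h"
    unfolding torus_lborel.integral_fst[OF Q2, symmetric] cubic_mass_def using \<rho>1 by simp
  finally show ?thesis .
qed

text \<open>Write \<open>\<delta> = h (x - y) - h x\<close>. In the integral of
  \<open>\<Sum>k. \<partial>\<^sub>k \<rho> y * \<delta>\<^sub>k * \<bar>\<delta>\<bar>\<^sup>2\<close> over \<open>x\<close> and \<open>y\<close>, expanding the product, the oddness of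
  \<open>\<partial>\<^sub>k \<rho>\<close> and the vanishing divergence of \<open>\<rho> * h\<close> leave four copies of the Hall term.\<close>

lemma flux_hall_bound:
  fixes \<rho> :: "real ^ 3 \<Rightarrow> real" and h :: "real ^ 3 \<Rightarrow> real ^ 3"
  assumes \<rho>: "mollifier C \<epsilon> \<rho>" and \<epsilon>: "0 < \<epsilon>" "\<epsilon> < 1/4" and h: "torus_Lp 3 h" "weakly_div_free h"
  shows "\<bar>LINT x|\<mu>. (\<Sum>k\<in>UNIV. h x $ k * (h x \<bullet> conv (deriv_kernel \<rho> k) h x))\<bar> \<le>
    C / (4 * \<epsilon>) * cubic_modulus \<epsilon> h"
proof -
  note mf = mollifier_facts[OF \<rho> \<epsilon>(1)]
  have K: "kernel \<rho>" by (rule mollifier_kernel[OF \<rho> \<epsilon>(2)])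
  have even: "\<rho> (- y) = \<rho> y" for y using \<rho> unfolding mollifier_def by auto
  define \<kappa> where "\<kappa> k = deriv_kernel \<rho> k" for k
  have \<kappa>: "kernel (\<kappa> k)" for k unfolding \<kappa>_def by (rule kernel_frechet[OF K])
  have odd: "\<kappa> k (- y) = - \<kappa> k y" for k y
    unfolding \<kappa>_def by (rule frechet_derivative_even[OF kernel_smooth[OF K] even])
  have L2: "torus_Lp 2 h" by (rule torus_L3_L2[OF h(1)])
  have L1: "torus_L1 h" by (rule torus_L2_L1[OF L2])
  note hD = torus_L3_D[OF h(1)]
  note [measurable] = hD(1)
  \<comment> \<open>The kernel \<open>\<kappa> k\<close> is odd, so exchanging the two points turns
    \<open>T k V\<close> into minus the value for the flipped \<open>V\<close>.\<close>
  define T where "T k V = (LINT (x, y)|(\<mu> \<Otimes>\<^sub>M lborel). \<kappa> k y * V (h x) (h (x - y)))"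
    for k and V :: "real ^ 3 \<Rightarrow> real ^ 3 \<Rightarrow> real"
  define cubic where "cubic V \<longleftrightarrow> (\<lambda>(a, b). V a b) \<in> borel_measurable (borel \<Otimes>\<^sub>M borel) \<and>
      (\<forall>a b. \<bar>V a b\<bar> \<le> norm a ^ 3 + norm b ^ 3)" for V :: "real ^ 3 \<Rightarrow> real ^ 3 \<Rightarrow> real"
  have int: "integrable (\<mu> \<Otimes>\<^sub>M lborel) (\<lambda>(x, y). \<kappa> k y * V (h x) (h (x - y)))"
    and anti: "T k V = - T k (\<lambda>a b. V b a)" if "cubic V" for k V
  proof -
    have V: "(\<lambda>(a, b). V a b) \<in> borel_measurable (borel \<Otimes>\<^sub>M borel)"
      "\<And>a b. \<bar>V a b\<bar> \<le> 1 * (norm a ^ 3 + norm b ^ 3)" using that by (auto simp: cubic_def)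
    note [measurable] = V(1)
    note ck = cubic_kernel_integrable[OF kernel_lborel_integrable[OF \<kappa>] h(1)]
    show i: "integrable (\<mu> \<Otimes>\<^sub>M lborel) (\<lambda>(x, y). \<kappa> k y * V (h x) (h (x - y)))"
      by (rule ck(1)[OF V(1) _ V(2)]) simp
    have i': "integrable (\<mu> \<Otimes>\<^sub>M lborel) (\<lambda>(x, y). \<kappa> k y * V (h (x - y)) (h x))"
    proof (rule ck(1)[where V = "\<lambda>a b. V b a" and c = 1])
      show "(\<lambda>(a, b). V b a) \<in> borel_measurable (borel \<Otimes>\<^sub>M borel)" by measurable
      show "\<bar>V b a\<bar> \<le> 1 * (norm a ^ 3 + norm b ^ 3)" for a b using V(2)[of b a] by simp
    qed simp
    have "T k V = (LINT x|\<mu>. (LINT y|lborel. \<kappa> k y * V (h x) (h (x - y))))"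
      unfolding T_def by (rule torus_lborel.integral_fst[OF i, symmetric])
    also have "\<dots> = (LINT x|\<mu>. (LINT y|lborel. \<kappa> k (- y) * V (h (x - y)) (h x)))"
      by (rule ck(2)[OF V(1) _ V(2)]) simp
    also have "\<dots> = - (LINT x|\<mu>. (LINT y|lborel. \<kappa> k y * V (h (x - y)) (h x)))"
      by (simp add: odd)
    also have "\<dots> = - T k (\<lambda>a b. V b a)"
      unfolding T_def by (simp only: torus_lborel.integral_fst[OF i'])
    finally show "T k V = - T k (\<lambda>a b. V b a)" .
  qed
  \<comment> \<open>Up to flipping the arguments, these three are all the monomials in the expansion
    of the cubic increment.\<close>
  define V1 :: "3 \<Rightarrow> real ^ 3 \<Rightarrow> real ^ 3 \<Rightarrow> real" where "V1 k a b = a $ k * (norm a)\<^sup>2" for k a b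
  define V2 :: "3 \<Rightarrow> real ^ 3 \<Rightarrow> real ^ 3 \<Rightarrow> real" where "V2 k a b = b $ k * (norm a)\<^sup>2" for k a b
  define V5 :: "3 \<Rightarrow> real ^ 3 \<Rightarrow> real ^ 3 \<Rightarrow> real" where "V5 k a b = a $ k * (a \<bullet> b)" for k a b
  have c1: "cubic (V1 k)" for k
    unfolding cubic_def V1_def
  proof (intro conjI allI)
    fix a b :: "real ^ 3"
    have "\<bar>a $ k * (norm a)\<^sup>2\<bar> \<le> norm a * (norm a)\<^sup>2"
      by (simp add: abs_mult mult_right_mono component_le_norm_cart)
    also have "\<dots> = norm a ^ 3" by (simp add: power2_eq_square power3_eq_cube)
    finally show "\<bar>a $ k * (norm a)\<^sup>2\<bar> \<le> norm a ^ 3 + norm b ^ 3"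
      using zero_le_power[OF norm_ge_zero[of b], of 3] by linarith
  qed measurable
  have c2: "cubic (V2 k)" for k
    unfolding cubic_def V2_def
  proof (intro conjI allI)
    fix a b :: "real ^ 3"
    have "\<bar>b $ k * (norm a)\<^sup>2\<bar> \<le> norm b * (norm a)\<^sup>2"
      by (simp add: abs_mult mult_right_mono component_le_norm_cart)
    then show "\<bar>b $ k * (norm a)\<^sup>2\<bar> \<le> norm a ^ 3 + norm b ^ 3"
      using cube_mixed_le[of "norm b" "norm a"] by simp
  qed measurable
  have c5: "cubic (V5 k)" for k
    unfolding cubic_def V5_def
  proof (intro conjI allI)
    fix a b :: "real ^ 3"
    have "\<bar>a $ k * (a \<bullet> b)\<bar> \<le> norm a * (norm a * norm b)"
      unfolding abs_mult by (intro mult_mono component_le_norm_cart Cauchy_Schwarz_ineq2) auto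
    also have "\<dots> = norm b * (norm a)\<^sup>2" by (simp add: power2_eq_square)
    finally show "\<bar>a $ k * (a \<bullet> b)\<bar> \<le> norm a ^ 3 + norm b ^ 3"
      using cube_mixed_le[of "norm b" "norm a"] by simp
  qed measurable
  have flip: "cubic (\<lambda>a b. V b a)" if "cubic V" for V
  proof -
    have [measurable]: "(\<lambda>(a, b). V a b) \<in> borel_measurable (borel \<Otimes>\<^sub>M borel)" using that by (simp add: cubic_def)
    have "(\<lambda>(a, b). V b a) \<in> borel_measurable (borel \<Otimes>\<^sub>M borel)" by measurable
    moreover have "\<bar>V b a\<bar> \<le> norm a ^ 3 + norm b ^ 3" for a b
    proof -
      have "\<bar>V b a\<bar> \<le> norm b ^ 3 + norm a ^ 3" using that unfolding cubic_def by blast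
      then show ?thesis by simp
    qed
    ultimately show ?thesis by (simp add: cubic_def)
  qed
  have T1: "T k (V1 k) = 0" for k
  proof -
    have "T k (V1 k) = (LINT x|\<mu>. (LINT y|lborel. \<kappa> k y * V1 k (h x) (h (x - y))))"
      unfolding T_def by (rule torus_lborel.integral_fst[OF int[OF c1], symmetric])
    then show ?thesis
      using deriv_kernel_integral_zero[OF K even, of k] by (simp add: V1_def \<kappa>_def)
  qed
  \<comment> \<open>Only the sum over \<open>k\<close> vanishes: the integrals over \<open>y\<close>
    add up to the divergence of the mollified \<open>h\<close>, times the squared norm of
    \<open>h x\<close>.\<close>
  have T2: "(\<Sum>k\<in>UNIV. T k (V2 k)) = 0"
  proof -
    have "T k (V2 k) = (LINT x|\<mu>. (norm (h x))\<^sup>2 * conv (\<kappa> k) (\<lambda>x. h x $ k) x)"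
      and "integrable \<mu> (\<lambda>x. (norm (h x))\<^sup>2 * conv (\<kappa> k) (\<lambda>x. h x $ k) x)" for k
    proof -
      have e: "(LINT y|lborel. \<kappa> k y * V2 k (h x) (h (x - y))) = (norm (h x))\<^sup>2 * conv (\<kappa> k) (\<lambda>x. h x $ k) x" for x
      proof -
        have "(LINT y|lborel. \<kappa> k y * V2 k (h x) (h (x - y))) = (LINT y|lborel. (norm (h x))\<^sup>2 * (\<kappa> k y *\<^sub>R (h (x - y) $ k)))"
          by (simp add: V2_def mult_ac)
        then show ?thesis by (simp add: conv_def)
      qed
      show "T k (V2 k) = (LINT x|\<mu>. (norm (h x))\<^sup>2 * conv (\<kappa> k) (\<lambda>x. h x $ k) x)"
        unfolding T_def torus_lborel.integral_fst[OF int[OF c2], symmetric] e ..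
      show "integrable \<mu> (\<lambda>x. (norm (h x))\<^sup>2 * conv (\<kappa> k) (\<lambda>x. h x $ k) x)"
        using torus_lborel.integrable_fst[OF int[OF c2, of k k]] unfolding e .
    qed
    then have "(\<Sum>k\<in>UNIV. T k (V2 k)) =
        (LINT x|\<mu>. (\<Sum>k\<in>UNIV. (norm (h x))\<^sup>2 * conv (\<kappa> k) (\<lambda>x. h x $ k) x))"
      by (simp add: Bochner_Integration.integral_sum)
    also have "\<dots> = 0"
      unfolding sum_distrib_left[symmetric] \<kappa>_def divergence_conv[OF K even L2 h(2)] by simp
    finally show ?thesis .
  qed
  have T5: "(LINT x|\<mu>. (\<Sum>k\<in>UNIV. h x $ k * (h x \<bullet> conv (\<kappa> k) h x))) = (\<Sum>k\<in>UNIV. T k (V5 k))"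
  proof -
    have e: "(LINT y|lborel. \<kappa> k y * V5 k (h x) (h (x - y))) = h x $ k * (h x \<bullet> conv (\<kappa> k) h x)" for k x
    proof -
      have "(LINT y|lborel. \<kappa> k y * V5 k (h x) (h (x - y))) =
          (LINT y|lborel. h x $ k * (h x \<bullet> (\<kappa> k y *\<^sub>R h (x - y))))"
        by (simp add: V5_def mult_ac)
      also have "\<dots> = h x $ k * (LINT y|lborel. h x \<bullet> (\<kappa> k y *\<^sub>R h (x - y)))" by (rule integral_mult_right_zero)
      also have "(LINT y|lborel. h x \<bullet> (\<kappa> k y *\<^sub>R h (x - y))) = h x \<bullet> conv (\<kappa> k) h x"
        unfolding conv_def by (rule integral_inner_right) (rule conv_integrable[OF \<kappa> L1])
      finally show ?thesis .
    qed
    have "integrable \<mu> (\<lambda>x. h x $ k * (h x \<bullet> conv (\<kappa> k) h x))" for k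
      using torus_lborel.integrable_fst[OF int[OF c5, of k k]] unfolding e .
    moreover have "T k (V5 k) = (LINT x|\<mu>. h x $ k * (h x \<bullet> conv (\<kappa> k) h x))" for k
      unfolding T_def torus_lborel.integral_fst[OF int[OF c5], symmetric] e ..
    ultimately show ?thesis by (simp add: Bochner_Integration.integral_sum)
  qed
  define V0 :: "3 \<Rightarrow> real ^ 3 \<Rightarrow> real ^ 3 \<Rightarrow> real" where "V0 k a b = (b - a) $ k * (norm (b - a))\<^sup>2" for k a b
  have V0: "V0 k a b = V2 k a b + V1 k b a - 2 * V5 k b a - V1 k a b - V2 k b a + 2 * V5 k a b" for k a b
    unfolding V0_def V1_def V2_def V5_def
    by (simp add: power2_norm_eq_inner inner_diff_left inner_diff_right inner_commute algebra_simps)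
  have int0: "integrable (\<mu> \<Otimes>\<^sub>M lborel) (\<lambda>(x, y). \<kappa> k y * V0 k (h x) (h (x - y)))"
    and T0: "T k (V0 k) = T k (V2 k) + T k (\<lambda>a b. V1 k b a) - 2 * T k (\<lambda>a b. V5 k b a) - T k (V1 k)
      - T k (\<lambda>a b. V2 k b a) + 2 * T k (V5 k)" for k
    unfolding T_def V0
    using int[OF c1, of k k] int[OF c2, of k k] int[OF c5, of k k]
      int[OF flip[OF c1], of k k] int[OF flip[OF c2], of k k] int[OF flip[OF c5], of k k]
    by (simp_all add: split_beta' distrib_left right_diff_distrib mult.left_commute[of _ 2])
  \<comment> \<open>A flipped monomial contributes minus its integral, so pairs with opposite
    coefficients double: two copies of \<open>V2\<close> and four of \<open>V5\<close>, while
    \<open>V1\<close> drops out.\<close>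
  have T0': "T k (V0 k) = 2 * T k (V2 k) + 4 * T k (V5 k)" for k
    unfolding T0 using anti[OF c1, of k k] anti[OF c2, of k k] anti[OF c5, of k k] T1[of k] by simp
  have sumT: "(\<Sum>k\<in>UNIV. T k (V0 k)) = 4 * (\<Sum>k\<in>UNIV. T k (V5 k))"
    unfolding T0' sum.distrib sum_distrib_left[symmetric] T2 by simp
  let ?P = "\<lambda>x y. \<Sum>k\<in>UNIV. \<kappa> k y * V0 k (h x) (h (x - y))"
  let ?Q1 = "\<lambda>x y. ball_kernel \<epsilon> y * norm (h x - h (x - y)) ^ 3"
  let ?Q = "\<lambda>x y. C / \<epsilon> * ?Q1 x y"
  have Q1: "integrable (\<mu> \<Otimes>\<^sub>M lborel) (\<lambda>(x, y). ?Q1 x y)"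
    by (rule cubic_kernel_integrable(1)[OF ball_kernel_facts(1)[OF \<epsilon>(1)] h(1), where V = "\<lambda>a b. norm (a - b) ^ 3" and c = 4])
      (measurable, auto intro: cube_diff_le[simplified])
  have Q: "integrable (\<mu> \<Otimes>\<^sub>M lborel) (\<lambda>(x, y). ?Q x y)"
    using integrable_mult_right[OF Q1, of "C / \<epsilon>"] by (simp add: split_beta')
  have P: "integrable (\<mu> \<Otimes>\<^sub>M lborel) (\<lambda>(x, y). ?P x y)"
    using int0 by (simp add: split_beta')
  have PQ: "\<bar>?P x y\<bar> \<le> ?Q x y" for x y
  proof -
    let ?d = "h (x - y) - h x"
    \<comment> \<open>Contracted with the increment, the derivative kernels give a single
      directional derivative of \<rho>, so the constant \<open>C / \<epsilon>\<close> enters once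
      and not once per component.\<close>
    have "?P x y = (\<Sum>k\<in>UNIV. \<kappa> k y * ?d $ k) * (norm ?d)\<^sup>2"
      by (simp add: V0_def sum_distrib_right mult.assoc)
    also have "\<dots> = frechet_derivative \<rho> (at y) ?d * (norm ?d)\<^sup>2"
      unfolding \<kappa>_def by (simp only: frechet_derivative_sum_axis[OF kernel_smooth[OF K]])
    finally have "\<bar>?P x y\<bar> = \<bar>frechet_derivative \<rho> (at y) ?d\<bar> * (norm ?d)\<^sup>2" by (simp add: abs_mult)
    also have "\<dots> \<le> (C / \<epsilon> * ball_kernel \<epsilon> y * norm ?d) * (norm ?d)\<^sup>2" by (intro mult_right_mono mf(3)) simp
    also have "\<dots> = C / \<epsilon> * (ball_kernel \<epsilon> y * norm ?d ^ 3)" by (simp add: power2_eq_square power3_eq_cube)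
    finally show ?thesis by (simp add: norm_minus_commute)
  qed
  have "(LINT x|\<mu>. (LINT y|lborel. ?P x y)) = (\<Sum>k\<in>UNIV. T k (V0 k))"
    unfolding torus_lborel.integral_fst[OF P] T_def using int0 by (simp add: split_beta' Bochner_Integration.integral_sum)
  then have "\<bar>4 * (\<Sum>k\<in>UNIV. T k (V5 k))\<bar> \<le> (LINT (x, y)|(\<mu> \<Otimes>\<^sub>M lborel). ?Q x y)"
    using iterated_integral_le[OF P Q PQ] unfolding sumT by simp
  also have "\<dots> = C / \<epsilon> * (LINT (x, y)|(\<mu> \<Otimes>\<^sub>M lborel). ?Q1 x y)"
    using Q1 by (simp add: split_beta')
  also have "(LINT (x, y)|(\<mu> \<Otimes>\<^sub>M lborel). ?Q1 x y) = cubic_modulus \<epsilon> h"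
    unfolding torus_lborel.integral_fst[OF Q1, symmetric] by (simp add: cubic_modulus_def)
  finally show ?thesis
    unfolding T5[unfolded \<kappa>_def] by (simp add: abs_mult \<kappa>_def)
qed

lemma flux_estimate:
  assumes \<rho>: "mollifier C \<epsilon> \<rho>" and \<epsilon>: "0 < \<epsilon>" "\<epsilon> < 1/4" and u: "torus_Lp 3 u"
    and h: "torus_Lp 3 h" "weakly_div_free h" and e: "0 < e"
  shows "\<bar>flux \<rho> u h h\<bar> \<le> (C / (4 * \<epsilon>) + C / e\<^sup>2) * cubic_modulus \<epsilon> h + e * cubic_mass u h"
proof -
  have K: "kernel \<rho>" by (rule mollifier_kernel[OF \<rho> \<epsilon>(2)])
  have L1: "torus_L1 h" by (rule torus_L2_L1[OF torus_L3_L2[OF h(1)]])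
  obtain B where B: "0 \<le> B" "\<And>x. norm (conv \<rho> h x) \<le> B" "\<And>k x. norm (conv (deriv_kernel \<rho> k) h x) \<le> B"
    using conv_bounds[OF K L1] by blast
  have "flux \<rho> u h h = (LINT x|\<mu>. conv \<rho> h x \<bullet> (u x \<times> h x)) +
      (LINT x|\<mu>. (\<Sum>k\<in>UNIV. h x $ k * (h x \<bullet> conv (deriv_kernel \<rho> k) h x)))"
    unfolding flux_def by (rule Bochner_Integration.integral_add[OF flux_integrands(1,2)[OF K torus_L3_L2[OF u] torus_L3_L2[OF h(1)] L1 B]])
  then show ?thesis
    using flux_transport_bound[OF \<rho> \<epsilon> u h(1) e] flux_hall_bound[OF \<rho> \<epsilon> h]
      abs_triangle_ineq[of "LINT x|\<mu>. conv \<rho> h x \<bullet> (u x \<times> h x)"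
      "LINT x|\<mu>. (\<Sum>k\<in>UNIV. h x $ k * (h x \<bullet> conv (deriv_kernel \<rho> k) h x))"]
    unfolding distrib_right by linarith
qed

section \<open>Continuity in time, measured in the mean\<close>

lemma torus_Lp_norm_cubed:
  assumes "torus_Lp 3 f"
  shows "torus_Lp_norm 3 f powr 3 = (LINT x|\<mu>. norm (f x) ^ 3)"
proof -
  note [measurable] = torus_L3_D(1)[OF assms]
  have "(LINT x:torus|lborel. norm (f x) powr 3) = (LINT x|\<mu>. norm (f x) ^ 3)"
    by (subst integral_torus_measure) (simp_all add: powr_numeral_nonneg)
  then show ?thesis by (simp add: torus_Lp_norm_def powr_powr)
qed

lemma torus_Lp3_diff:
  assumes f: "torus_Lp 3 f" and g: "torus_Lp 3 g" shows "torus_Lp 3 (\<lambda>x. f x - g x)"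
proof -
  note fD = torus_L3_D[OF f] and gD = torus_L3_D[OF g]
  note [measurable] = fD(1) gD(1)
  have "integrable \<mu> (\<lambda>x. norm (f x - g x) ^ 3)"
  proof (rule Bochner_Integration.integrable_bound)
    show "integrable \<mu> (\<lambda>x. 4 * (norm (f x) ^ 3 + norm (g x) ^ 3))" using fD(3) gD(3) by simp
    show "AE x in \<mu>. norm (norm (f x - g x) ^ 3) \<le> norm (4 * (norm (f x) ^ 3 + norm (g x) ^ 3))"
    proof (rule AE_I2)
      fix x
      show "norm (norm (f x - g x) ^ 3) \<le> norm (4 * (norm (f x) ^ 3 + norm (g x) ^ 3))"
        using cube_diff_le[of "f x" "g x"] by (simp add: abs_of_nonneg)
    qed
  qed measurable
  then show ?thesis using fD(2) gD(2) by (simp add: torus_Lp_numeral periodic_def)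
qed

lemma torus_L3_L1: "torus_Lp 3 f \<Longrightarrow> torus_L1 f"
  by (intro torus_L2_L1 torus_L3_L2)

text \<open>Split at the level \<open>l\<close>: below it the integrand is at most \<open>l\<close>,
  and above it \<open>r \<le> r^3 / l^2\<close> for \<open>r = norm (f x)\<close>.\<close>

lemma L1_norm_le:
  assumes f: "torus_Lp 3 f" and l: "0 < l"
  shows "(LINT x|\<mu>. norm (f x)) \<le> l + (LINT x|\<mu>. norm (f x) ^ 3) / l\<^sup>2"
proof -
  have "(LINT x|\<mu>. norm (f x)) \<le> (LINT x|\<mu>. l + norm (f x) ^ 3 / l\<^sup>2)"
  proof (rule integral_mono)
    show "integrable \<mu> (\<lambda>x. norm (f x))" using torus_L1D(3)[OF torus_L3_L1[OF f]] by simp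
    show "integrable \<mu> (\<lambda>x. l + norm (f x) ^ 3 / l\<^sup>2)" using torus_L3_D(3)[OF f] by simp
    show "norm (f x) \<le> l + norm (f x) ^ 3 / l\<^sup>2" for x
    proof (cases "norm (f x) \<le> l")
      case True
      then show ?thesis using l by (simp add: add_increasing2)
    next
      case False
      have "l\<^sup>2 \<le> (norm (f x))\<^sup>2" using False l by (intro power_mono) auto
      then have "norm (f x) * l\<^sup>2 \<le> norm (f x) * (norm (f x))\<^sup>2" by (rule mult_left_mono) simp
      then have "norm (f x) \<le> norm (f x) ^ 3 / l\<^sup>2"
        using l by (simp add: pos_le_divide_eq power2_eq_square power3_eq_cube)
      then show ?thesis using l by simp
    qed
  qed
  also have "\<dots> = l + (LINT x|\<mu>. norm (f x) ^ 3) / l\<^sup>2"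
    using torus_L3_D(3)[OF f] by (simp add: measure_torus_measure)
  finally show ?thesis .
qed

lemma C_L3_L1_continuous:
  assumes h: "C_Lq T 3 h" and p: "p \<in> {0..T}" and \<eta>: "0 < \<eta>"
  obtains d where "0 < d" "\<And>\<tau>. \<tau> \<in> {0..T} \<Longrightarrow> \<bar>\<tau> - p\<bar> < d \<Longrightarrow>
    (LINT x|\<mu>. norm (h \<tau> x - h p x)) \<le> \<eta>"
proof -
  have hL: "torus_Lp 3 (h t)" if "t \<in> {0..T}" for t using h that unfolding C_Lq_def by blast
  \<comment> \<open>The minimum with 1 gives \<open>n^3 \<le> n\<close>; the other bound is the cube
    of \<open>\<eta> / 2\<close>, so that \<open>L1_norm_le\<close> at the level
    \<open>\<eta> / 2\<close> yields two halves of \<eta>.\<close>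
  define c where "c = min 1 (\<eta> * (\<eta> / 2)\<^sup>2 / 2)"
  have c: "0 < c" "c \<le> 1" "c \<le> \<eta> * (\<eta> / 2)\<^sup>2 / 2" using \<eta> by (auto simp: c_def)
  have "((\<lambda>t. torus_Lp_norm 3 (\<lambda>x. h t x - h p x)) \<longlongrightarrow> 0) (at p within {0..T})"
    using h p unfolding C_Lq_def by blast
  from order_tendstoD(2)[OF this c(1)]
  obtain d where d: "0 < d" "\<And>\<tau>. \<tau> \<in> {0..T} \<Longrightarrow> \<tau> \<noteq> p \<Longrightarrow> dist \<tau> p < d \<Longrightarrow>
      torus_Lp_norm 3 (\<lambda>x. h \<tau> x - h p x) < c"
    unfolding eventually_at by blast
  show thesis
  proof (rule that[OF d(1)])
    fix \<tau> assume \<tau>: "\<tau> \<in> {0..T}" "\<bar>\<tau> - p\<bar> < d"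
    show "(LINT x|\<mu>. norm (h \<tau> x - h p x)) \<le> \<eta>"
    proof (cases "\<tau> = p")
      case False
      have D: "torus_Lp 3 (\<lambda>x. h \<tau> x - h p x)" by (rule torus_Lp3_diff[OF hL hL]) (use \<tau> p in auto)
      define n where "n = torus_Lp_norm 3 (\<lambda>x. h \<tau> x - h p x)"
      have n: "0 \<le> n" "n < c" using d(2)[OF \<tau>(1) False] \<tau>(2) by (auto simp: n_def dist_real_def torus_Lp_norm_def)
      have "(LINT x|\<mu>. norm (h \<tau> x - h p x) ^ 3) = n ^ 3"
        using torus_Lp_norm_cubed[OF D] n(1) by (simp add: n_def[symmetric] powr_numeral_nonneg)
      also have "\<dots> \<le> n" using n c power_decreasing[of 1 3 n] by simp
      also have "\<dots> \<le> \<eta> / 2 * (\<eta> / 2)\<^sup>2" using n c by simp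
      finally have "(LINT x|\<mu>. norm (h \<tau> x - h p x) ^ 3) / (\<eta> / 2)\<^sup>2 \<le> \<eta> / 2"
        using \<eta> by (simp add: pos_divide_le_eq)
      then show ?thesis using L1_norm_le[OF D, of "\<eta> / 2"] \<eta> by linarith
    qed (use \<eta> in simp)
  qed
qed


subsection \<open>Weak time derivatives\<close>

text \<open>The rescaled \<beta> is a probability density supported in
  \<open>[p, p + \<delta>]\<close>: its mass is the total increment of the step
  \<open>S\<close>.\<close>

lemma step_average:
  fixes S \<beta> a :: "real \<Rightarrow> real"
  assumes S: "\<And>x. (S has_real_derivative \<beta> x) (at x)" "\<And>x. 0 \<le> \<beta> x"
      "\<And>x. x \<le> 0 \<Longrightarrow> S x = 0" "\<And>x. 1 \<le> x \<Longrightarrow> S x = 1" "\<And>x. x \<notin> {0<..<1} \<Longrightarrow> \<beta> x = 0"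
      "continuous_on UNIV \<beta>"
    and a: "continuous_on {0..T} a" and \<delta>: "0 < \<delta>" and p: "0 \<le> p" "p + \<delta> \<le> T"
    and close: "\<And>\<tau>. \<tau> \<in> {p..p + \<delta>} \<Longrightarrow> \<bar>a \<tau> - c\<bar> \<le> e"
  shows "\<bar>(LINT \<tau>:{0..T}|lborel. \<beta> ((\<tau> - p) / \<delta>) / \<delta> * a \<tau>) - c\<bar> \<le> e"
proof -
  define k where "k \<tau> = \<beta> ((\<tau> - p) / \<delta>) / \<delta>" for \<tau>
  have kc: "continuous_on A k" for A
    unfolding k_def[abs_def] using \<delta>
    by (intro continuous_intros continuous_on_compose2[OF S(6)]) auto
  have k0: "0 \<le> k \<tau>" for \<tau> using S(2) \<delta> by (simp add: k_def)
  have kout: "k \<tau> = 0" if "\<tau> \<notin> {p..p + \<delta>}" for \<tau>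
  proof -
    have "(\<tau> - p) / \<delta> \<notin> {0<..<1}" using that \<delta> by (auto simp: field_simps)
    then show ?thesis by (simp add: k_def S(5))
  qed
  have ki: "set_integrable lborel {0..T} (\<lambda>\<tau>. k \<tau> * f \<tau>)" if "continuous_on {0..T} f" for f
    unfolding set_integrable_def
    by (intro borel_integrable_compact continuous_on_mult kc that compact_Icc)
  have "(LINT \<tau>|lborel. k \<tau> * indicator {0..T} \<tau>) = S ((T - p) / \<delta>) - S ((0 - p) / \<delta>)"
  proof (rule integral_FTC_Icc_real)
    show "0 \<le> T" using \<delta> p by linarith
    show "((\<lambda>\<tau>. S ((\<tau> - p) / \<delta>)) has_real_derivative k \<tau>) (at \<tau>)" for \<tau>
    proof -
      have "((\<lambda>\<tau>. (\<tau> - p) / \<delta>) has_real_derivative 1 / \<delta>) (at \<tau>)"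
        by (rule DERIV_cdivide, rule DERIV_cong[OF DERIV_diff[OF DERIV_ident DERIV_const]]) simp
      from DERIV_chain2[OF S(1) this] show ?thesis by (simp add: k_def)
    qed
    show "isCont k \<tau>" for \<tau> using kc[of UNIV] by (simp add: continuous_on_eq_continuous_at)
  qed
  also have "\<dots> = 1"
    using \<delta> p S(3)[of "(0 - p) / \<delta>"] S(4)[of "(T - p) / \<delta>"] by (simp add: field_simps)
  finally have k1: "(LINT \<tau>:{0..T}|lborel. k \<tau>) = 1"
    by (simp add: set_lebesgue_integral_def mult.commute)
  have kI: "set_integrable lborel {0..T} k" using ki[of "\<lambda>_. 1"] by simp
  have "(LINT \<tau>:{0..T}|lborel. k \<tau> * a \<tau>) - c = (LINT \<tau>:{0..T}|lborel. k \<tau> * a \<tau> - k \<tau> * c)"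
    using set_integral_diff(2)[OF ki[OF a] set_integrable_mult_left[OF kI, of c]] k1 by simp
  also have "\<bar>\<dots>\<bar> \<le> (LINT \<tau>:{0..T}|lborel. \<bar>k \<tau> * a \<tau> - k \<tau> * c\<bar>)"
    using set_integral_norm_bound[OF set_integral_diff(1)[OF ki[OF a] set_integrable_mult_left[OF kI, of c]]] by simp
  also have "\<dots> \<le> (LINT \<tau>:{0..T}|lborel. k \<tau> * e)"
  proof (rule set_integral_mono)
    show "set_integrable lborel {0..T} (\<lambda>\<tau>. \<bar>k \<tau> * a \<tau> - k \<tau> * c\<bar>)"
      by (rule set_integrable_abs[OF set_integral_diff(1)[OF ki[OF a] set_integrable_mult_left[OF kI, of c]]])
    show "set_integrable lborel {0..T} (\<lambda>\<tau>. k \<tau> * e)" by (rule set_integrable_mult_left[OF kI])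
    show "\<bar>k \<tau> * a \<tau> - k \<tau> * c\<bar> \<le> k \<tau> * e" for \<tau>
    proof (cases "\<tau> \<in> {p..p + \<delta>}")
      case True
      have "\<bar>k \<tau> * a \<tau> - k \<tau> * c\<bar> = k \<tau> * \<bar>a \<tau> - c\<bar>"
        using k0[of \<tau>] by (simp add: abs_mult flip: right_diff_distrib)
      then show ?thesis using close[OF True] k0[of \<tau>] by (simp add: mult_left_mono)
    qed (simp add: kout)
  qed
  also have "\<dots> = e" using k1 by simp
  finally show "\<bar>(LINT \<tau>:{0..T}|lborel. \<beta> ((\<tau> - p) / \<delta>) / \<delta> * a \<tau>) - c\<bar> \<le> e"
    by (simp add: k_def)
qed

lemma weak_derivative_integral:
  fixes a G :: "real \<Rightarrow> real"
  assumes a: "continuous_on {0..T} a" and G: "set_integrable lborel {0..T} G"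
    and weak: "\<And>\<theta> \<theta>'. \<lbrakk>smooth \<theta>; \<And>t. (\<theta> has_real_derivative \<theta>' t) (at t);
      \<exists>c d. 0 < c \<and> c \<le> d \<and> d < T \<and> (\<forall>t. t \<notin> {c..d} \<longrightarrow> \<theta> t = 0)\<rbrakk> \<Longrightarrow>
      (LINT t:{0..T}|lborel. \<theta>' t * a t + \<theta> t * G t) = 0"
    and st: "0 \<le> s" "s \<le> t" "t \<le> T"
  shows "a t - a s = (LINT \<tau>:{s<..t}|lborel. G \<tau>)"
proof (cases "s = t")
  case False
  then have lt: "s < t" using st by simp
  obtain S \<beta> :: "real \<Rightarrow> real" where S: "smooth S" "\<And>x. (S has_real_derivative \<beta> x) (at x)" "\<And>x. 0 \<le> \<beta> x"
    "\<And>x. x \<le> 0 \<Longrightarrow> S x = 0" "\<And>x. 1 \<le> x \<Longrightarrow> S x = 1"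
    "\<And>x. x \<notin> {0<..<1} \<Longrightarrow> \<beta> x = 0" "continuous_on UNIV \<beta>"
    by (rule smooth_step_exists) (rule that)
  have mono: "S x \<le> S y" if "x \<le> y" for x y
    using that S(2,3) by (intro DERIV_nonneg_imp_nondecreasing[of x y S]) blast+
  have S01: "0 \<le> S x" "S x \<le> 1" for x
    using mono[of "min x 0" x] mono[of x "max x 1"] S(4)[of "min x 0"] S(5)[of "max x 1"] by auto
  \<comment> \<open>At most a quarter of the interval: the rise occupies
    \<open>[s + \<delta>, s + 2 * \<delta>]\<close> and the fall
    \<open>[t - 2 * \<delta>, t - \<delta>]\<close>, in this order.\<close>
  define \<delta> where "\<delta> n = (t - s) / (4 * real (Suc n))" for n
  have \<delta>: "0 < \<delta> n" "4 * \<delta> n \<le> t - s" for n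
    using lt mult_right_mono[of s t "real n"] by (simp_all add: \<delta>_def field_simps)
  have \<delta>0: "\<delta> \<longlonglongrightarrow> 0"
  proof -
    have "(\<lambda>n. (t - s) / 4 * (1 / real (Suc n))) \<longlonglongrightarrow> (t - s) / 4 * 0"
      by (intro tendsto_mult tendsto_const LIMSEQ_Suc[OF lim_1_over_n])
    then show ?thesis by (simp add: \<delta>_def[abs_def] field_simps)
  qed
  define p where "p n = s + \<delta> n" for n
  define q where "q n = t - 2 * \<delta> n" for n
  define \<theta> where "\<theta> n \<tau> = S ((\<tau> - p n) / \<delta> n) - S ((\<tau> - q n) / \<delta> n)" for n \<tau>
  define A where "A n = (LINT \<tau>:{0..T}|lborel. \<beta> ((\<tau> - p n) / \<delta> n) / \<delta> n * a \<tau>)" for n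
  define B where "B n = (LINT \<tau>:{0..T}|lborel. \<beta> ((\<tau> - q n) / \<delta> n) / \<delta> n * a \<tau>)" for n
  have pq: "0 \<le> p n" "p n + \<delta> n \<le> T" "0 \<le> q n" "q n + \<delta> n \<le> T" "p n + \<delta> n \<le> q n" for n
    using \<delta>[of n] st by (auto simp: p_def q_def)
  have avg: "\<bar>(LINT \<tau>:{0..T}|lborel. \<beta> ((\<tau> - r) / \<delta> n) / \<delta> n * a \<tau>) - c\<bar> \<le> e"
    if "0 \<le> r" "r + \<delta> n \<le> T" "\<And>\<tau>. \<tau> \<in> {r..r + \<delta> n} \<Longrightarrow> \<bar>a \<tau> - c\<bar> \<le> e" for r n c e
    by (rule step_average[where S = S and \<beta> = \<beta> and T = T]) (fact S(2-7) a \<delta>(1) that)+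
  have conv: "(\<lambda>n. (LINT \<tau>:{0..T}|lborel. \<beta> ((\<tau> - r n) / \<delta> n) / \<delta> n * a \<tau>)) \<longlonglongrightarrow> a r0"
    if r: "\<And>n. 0 \<le> r n" "\<And>n. r n + \<delta> n \<le> T" "r \<longlonglongrightarrow> r0" and r0: "r0 \<in> {0..T}" for r r0
  proof (rule LIMSEQ_I)
    fix e :: real assume e: "0 < e"
    then have e2: "0 < e / 2" by simp
    obtain d where d: "0 < d" "\<And>\<tau>. \<tau> \<in> {0..T} \<Longrightarrow> dist \<tau> r0 < d \<Longrightarrow> dist (a \<tau>) (a r0) < e / 2"
      using a r0 e2 unfolding continuous_on_iff by blast
    have d2: "0 < d / 2" using d by simp
    obtain N1 where N1: "\<And>n. n \<ge> N1 \<Longrightarrow> norm (r n - r0) < d / 2" using LIMSEQ_D[OF r(3) d2] by blast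
    obtain N2 where N2: "\<And>n. n \<ge> N2 \<Longrightarrow> norm (\<delta> n - 0) < d / 2" using LIMSEQ_D[OF \<delta>0 d2] by blast
    show "\<exists>N. \<forall>n\<ge>N. norm ((LINT \<tau>:{0..T}|lborel. \<beta> ((\<tau> - r n) / \<delta> n) / \<delta> n * a \<tau>) - a r0) < e"
    proof (intro exI allI impI)
      fix n assume n: "n \<ge> max N1 N2"
      have "\<bar>(LINT \<tau>:{0..T}|lborel. \<beta> ((\<tau> - r n) / \<delta> n) / \<delta> n * a \<tau>) - a r0\<bar> \<le> e / 2"
      proof (rule avg[OF r(1,2)])
        fix \<tau> assume \<tau>: "\<tau> \<in> {r n..r n + \<delta> n}"
        have "\<tau> \<in> {0..T}" using \<tau> r(1,2)[of n] by auto
        moreover have "\<bar>r n - r0\<bar> < d / 2" "\<bar>\<delta> n\<bar> < d / 2" "r n \<le> \<tau>" "\<tau> \<le> r n + \<delta> n"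
          using \<tau> N1[of n] N2[of n] n by simp_all
        then have "dist \<tau> r0 < d" unfolding dist_real_def by linarith
        ultimately show "\<bar>a \<tau> - a r0\<bar> \<le> e / 2" using d(2)[of \<tau>] by (simp add: dist_real_def)
      qed
      then show "norm ((LINT \<tau>:{0..T}|lborel. \<beta> ((\<tau> - r n) / \<delta> n) / \<delta> n * a \<tau>) - a r0) < e"
        using e by simp
    qed
  qed
  have p_lim: "p \<longlonglongrightarrow> s"
    using tendsto_add[OF tendsto_const[of s] \<delta>0] by (simp add: p_def[abs_def])
  have q_lim: "q \<longlonglongrightarrow> t"
    using tendsto_diff[OF tendsto_const[of t] tendsto_mult[OF tendsto_const[of 2] \<delta>0]] by (simp add: q_def[abs_def])
  have A_lim: "A \<longlonglongrightarrow> a s" unfolding A_def[abs_def]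
    by (rule conv[OF pq(1,2) p_lim]) (use st in simp)
  have B_lim: "B \<longlonglongrightarrow> a t" unfolding B_def[abs_def]
    by (rule conv[OF pq(3,4) q_lim]) (use st in simp)
  have \<theta>_smooth: "smooth (\<theta> n)" for n
  proof -
    have lin: "smooth (\<lambda>\<tau>. S ((\<tau> - r) / \<delta> n))" for r
    proof -
      have "smooth (\<lambda>\<tau>. \<tau> * inverse (\<delta> n) + - r / \<delta> n)"
        by (intro smooth_add smooth_const smooth_bounded_linear bounded_linear_mult_left)
      then have "smooth (\<lambda>\<tau>. S (\<tau> * inverse (\<delta> n) + - r / \<delta> n))" by (rule smooth_compose_real[OF S(1)])
      moreover have "(\<tau> - r) / \<delta> n = \<tau> * inverse (\<delta> n) + - r / \<delta> n" for \<tau>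
        by (simp add: divide_inverse left_diff_distrib)
      ultimately show ?thesis by simp
    qed
    have "smooth (\<lambda>\<tau>. S ((\<tau> - p n) / \<delta> n) + - S ((\<tau> - q n) / \<delta> n))"
      by (rule smooth_add[OF lin smooth_linear_compose[OF bounded_linear_minus[OF bounded_linear_ident] lin]])
    then show ?thesis by (simp add: \<theta>_def[abs_def])
  qed
  have \<theta>_deriv: "(\<theta> n has_real_derivative \<beta> ((\<tau> - p n) / \<delta> n) / \<delta> n - \<beta> ((\<tau> - q n) / \<delta> n) / \<delta> n) (at \<tau>)" for n \<tau>
  proof -
    have "((\<lambda>\<tau>. S ((\<tau> - r) / \<delta> n)) has_real_derivative \<beta> ((\<tau> - r) / \<delta> n) / \<delta> n) (at \<tau>)" for r
    proof -
      have "((\<lambda>\<tau>. (\<tau> - r) / \<delta> n) has_real_derivative 1 / \<delta> n) (at \<tau>)"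
        by (rule DERIV_cdivide, rule DERIV_cong[OF DERIV_diff[OF DERIV_ident DERIV_const]]) simp
      from DERIV_chain2[OF S(2) this] show ?thesis by simp
    qed
    from DERIV_diff[OF this this] show ?thesis by (simp add: \<theta>_def[abs_def])
  qed
  have \<theta>_left: "\<theta> n \<tau> = 0" if "\<tau> \<le> p n" for n \<tau>
  proof -
    have "(\<tau> - p n) / \<delta> n \<le> 0" "(\<tau> - q n) / \<delta> n \<le> 0"
      using that pq(5)[of n] \<delta>(1)[of n] by (auto simp: divide_le_0_iff)
    then show ?thesis by (simp add: \<theta>_def S(4))
  qed
  have \<theta>_right: "\<theta> n \<tau> = 0" if "q n + \<delta> n \<le> \<tau>" for n \<tau>
  proof -
    have "1 \<le> (\<tau> - p n) / \<delta> n" "1 \<le> (\<tau> - q n) / \<delta> n"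
      using that pq(5)[of n] \<delta>(1)[of n] by (auto simp: le_divide_eq)
    then show ?thesis by (simp add: \<theta>_def S(5))
  qed
  have \<theta>_mid: "\<theta> n \<tau> = 1" if "p n + \<delta> n \<le> \<tau>" "\<tau> \<le> q n" for n \<tau>
  proof -
    have "1 \<le> (\<tau> - p n) / \<delta> n" "(\<tau> - q n) / \<delta> n \<le> 0"
      using that \<delta>(1)[of n] by (auto simp: le_divide_eq divide_le_0_iff)
    then show ?thesis by (simp add: \<theta>_def S(4,5))
  qed
  have \<theta>_bound: "\<bar>\<theta> n \<tau>\<bar> \<le> 1" for n \<tau>
    using S01[of "(\<tau> - p n) / \<delta> n"] S01[of "(\<tau> - q n) / \<delta> n"] by (simp add: \<theta>_def abs_le_iff)
  have \<theta>c: "continuous_on X (\<theta> n)" for X n by (rule smooth_continuous[OF \<theta>_smooth])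
  have \<theta>m [measurable]: "\<theta> n \<in> borel_measurable borel" for n
    by (rule borel_measurable_continuous_onI[OF \<theta>c])
  have Gm [measurable]: "(\<lambda>\<tau>. indicator {0..T} \<tau> * G \<tau>) \<in> borel_measurable borel"
    and GI: "integrable lborel (\<lambda>\<tau>. indicator {0..T} \<tau> * G \<tau>)"
    using G borel_measurable_integrable[of lborel "\<lambda>\<tau>. indicator {0..T} \<tau> * G \<tau>"]
    unfolding set_integrable_def by simp_all
  have dom: "norm (\<theta> n \<tau> * (indicator {0..T} \<tau> * G \<tau>)) \<le> norm (indicator {0..T} \<tau> * G \<tau>)" for n \<tau>
    using mult_right_mono[OF \<theta>_bound[of n \<tau>], of "\<bar>indicator {0..T} \<tau> * G \<tau>\<bar>"]
    by (simp add: abs_mult)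
  have \<theta>GI: "integrable lborel (\<lambda>\<tau>. \<theta> n \<tau> * (indicator {0..T} \<tau> * G \<tau>))" for n
    by (rule Bochner_Integration.integrable_bound[OF GI _ AE_I2[OF dom]]) measurable
  have eq: "A n - B n + (LINT \<tau>|lborel. \<theta> n \<tau> * (indicator {0..T} \<tau> * G \<tau>)) = 0" for n
  proof -
    have "(LINT \<tau>:{0..T}|lborel. (\<beta> ((\<tau> - p n) / \<delta> n) / \<delta> n - \<beta> ((\<tau> - q n) / \<delta> n) / \<delta> n) * a \<tau> + \<theta> n \<tau> * G \<tau>) = 0"
    proof (rule weak[OF \<theta>_smooth \<theta>_deriv])
      show "\<exists>c d. 0 < c \<and> c \<le> d \<and> d < T \<and> (\<forall>t. t \<notin> {c..d} \<longrightarrow> \<theta> n t = 0)"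
      proof (rule exI[of _ "p n"], rule exI[of _ "q n + \<delta> n"], intro conjI allI impI)
        show "0 < p n" "p n \<le> q n + \<delta> n" "q n + \<delta> n < T"
          using \<delta>[of n] st by (auto simp: p_def q_def)
        show "\<theta> n \<tau> = 0" if "\<tau> \<notin> {p n..q n + \<delta> n}" for \<tau>
          using that \<theta>_left[of \<tau> n] \<theta>_right[of n \<tau>] by (cases "\<tau> \<le> p n") auto
      qed
    qed
    moreover have "set_integrable lborel {0..T} (\<lambda>\<tau>. \<beta> ((\<tau> - r) / \<delta> n) / \<delta> n * a \<tau>)"
      if "0 \<le> r" "r + \<delta> n \<le> T" for r
      unfolding set_integrable_def
      by (intro borel_integrable_compact compact_Icc continuous_on_mult a continuous_intros
          continuous_on_compose2[OF S(7)]) (use \<delta>(1)[of n] in auto)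
    from this[OF pq(1,2)] this[OF pq(3,4)]
    have "(LINT \<tau>:{0..T}|lborel. (\<beta> ((\<tau> - p n) / \<delta> n) / \<delta> n - \<beta> ((\<tau> - q n) / \<delta> n) / \<delta> n) * a \<tau> + \<theta> n \<tau> * G \<tau>) =
       A n - B n + (LINT \<tau>|lborel. \<theta> n \<tau> * (indicator {0..T} \<tau> * G \<tau>))"
      using \<theta>GI[of n] unfolding A_def B_def set_lebesgue_integral_def set_integrable_def
      by (simp add: left_diff_distrib distrib_left right_diff_distrib mult.left_commute[of "\<theta> n _"])
    ultimately show ?thesis by simp
  qed
  have lim: "(\<lambda>n. \<integral>\<tau>. \<theta> n \<tau> * (indicator {0..T} \<tau> * G \<tau>) \<partial>lborel) \<longlonglongrightarrow>
      (LINT \<tau>|lborel. indicator {s<..<t} \<tau> * (indicator {0..T} \<tau> * G \<tau>))"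
  proof (rule integral_dominated_convergence[where w = "\<lambda>\<tau>. norm (indicator {0..T} \<tau> * G \<tau>)"])
    show "integrable lborel (\<lambda>\<tau>. norm (indicator {0..T} \<tau> * G \<tau>))" by (rule integrable_norm[OF GI])
    show "AE \<tau> in lborel. (\<lambda>n. \<theta> n \<tau> * (indicator {0..T} \<tau> * G \<tau>)) \<longlonglongrightarrow>
        indicator {s<..<t} \<tau> * (indicator {0..T} \<tau> * G \<tau>)"
    proof (rule AE_I2)
      fix \<tau>
      have "(\<lambda>n. \<theta> n \<tau>) \<longlonglongrightarrow> indicator {s<..<t} \<tau>"
      proof (cases "\<tau> \<in> {s<..<t}")
        case False
        have "\<theta> n \<tau> = 0" for n
        proof (cases "\<tau> \<le> s")
          case True
          then show ?thesis using \<delta>(1)[of n] by (intro \<theta>_left) (simp add: p_def)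
        next
          case F: False
          then have "t \<le> \<tau>" using False by auto
          then show ?thesis using \<delta>(1)[of n] by (intro \<theta>_right) (simp add: q_def)
        qed
        then show ?thesis using False by simp
      next
        case True
        define m where "m = min (\<tau> - s) (t - \<tau>) / 2"
        have "0 < m" using True by (simp add: m_def)
        from order_tendstoD(2)[OF \<delta>0 this] have "\<forall>\<^sub>F n in sequentially. \<theta> n \<tau> = 1"
        proof (rule eventually_mono)
          fix n assume "\<delta> n < m"
          then show "\<theta> n \<tau> = 1" by (intro \<theta>_mid) (auto simp: m_def p_def q_def min_def split: if_splits)
        qed
        then show ?thesis using True by (simp add: tendsto_eventually)
      qed
      then show "(\<lambda>n. \<theta> n \<tau> * (indicator {0..T} \<tau> * G \<tau>)) \<longlonglongrightarrow>
          indicator {s<..<t} \<tau> * (indicator {0..T} \<tau> * G \<tau>)"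
        by (intro tendsto_mult tendsto_const)
    qed
    show "AE \<tau> in lborel. norm (\<theta> n \<tau> * (indicator {0..T} \<tau> * G \<tau>)) \<le> norm (indicator {0..T} \<tau> * G \<tau>)" for n
      by (rule AE_I2[OF dom])
  qed measurable
  have "(\<lambda>n. A n - B n + (LINT \<tau>|lborel. \<theta> n \<tau> * (indicator {0..T} \<tau> * G \<tau>))) \<longlonglongrightarrow>
      a s - a t + (LINT \<tau>|lborel. indicator {s<..<t} \<tau> * (indicator {0..T} \<tau> * G \<tau>))"
    by (intro tendsto_add tendsto_diff A_lim B_lim lim)
  then have "a s - a t + (LINT \<tau>|lborel. indicator {s<..<t} \<tau> * (indicator {0..T} \<tau> * G \<tau>)) = 0"
    unfolding eq LIMSEQ_const_iff by simp
  then have "a t - a s = (LINT \<tau>|lborel. indicator {s<..<t} \<tau> * (indicator {0..T} \<tau> * G \<tau>))"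
    by linarith
  \<comment> \<open>The right end point is added so that adjacent intervals can later be joined
    without overlap.\<close>
  also have "\<dots> = (LINT \<tau>|lborel. indicator {s<..t} \<tau> * (indicator {0..T} \<tau> * G \<tau>))"
  proof (rule integral_cong_AE)
    show "AE \<tau> in lborel. indicator {s<..<t} \<tau> * (indicator {0..T} \<tau> * G \<tau>) =
        indicator {s<..t} \<tau> * (indicator {0..T} \<tau> * G \<tau>)"
      using AE_lborel_singleton[of t] by eventually_elim (auto simp: indicator_def)
  qed measurable
  also have "\<dots> = (LINT \<tau>:{s<..t}|lborel. G \<tau>)"
    unfolding set_lebesgue_integral_def
    by (rule Bochner_Integration.integral_cong) (use st in \<open>auto simp: indicator_def\<close>)
  finally show ?thesis .
qed (simp add: set_lebesgue_integral_def)

section \<open>Measurability in time and the Besov-VMO modulus\<close>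

text \<open>The fields are measurable only over the time interval; extending them by zero makes the
  parametrized integrals below measurable on the whole line.\<close>

lemma jointly_measurable_cut:
  assumes "jointly_measurable T f"
  shows "(\<lambda>(t, x). indicator {0..T} t *\<^sub>R f t x) \<in> borel_measurable (borel \<Otimes>\<^sub>M borel)"
proof -
  have "(\<lambda>p. indicator (Sigma {0..T} (\<lambda>_. UNIV)) p *\<^sub>R (case p of (t, x) \<Rightarrow> f t x)) \<in> borel_measurable (borel \<Otimes>\<^sub>M borel)"
    using assms unfolding jointly_measurable_def set_borel_measurable_def borel_prod .
  moreover have "(\<lambda>p. indicator (Sigma {0..T} (\<lambda>_. UNIV)) p *\<^sub>R (case p of (t, x) \<Rightarrow> f t x)) =
      (\<lambda>(t, x). indicator {0..T} t *\<^sub>R f t x)"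
    by (auto simp: indicator_def fun_eq_iff)
  ultimately show ?thesis by simp
qed

lemma cubic_modulus_measurable:
  assumes h: "jointly_measurable T h"
  shows "(\<lambda>\<tau>. indicator {0..T} \<tau> * cubic_modulus \<epsilon> (h \<tau>)) \<in> borel_measurable borel"
proof -
  define g where "g \<tau> x = indicator {0..T} \<tau> *\<^sub>R h \<tau> x" for \<tau> x
  have g [measurable]: "(\<lambda>(\<tau>, x). g \<tau> x) \<in> borel_measurable (borel \<Otimes>\<^sub>M borel)"
    using jointly_measurable_cut[OF h] by (simp add: g_def)
  have [measurable]: "ball_kernel \<epsilon> \<in> borel_measurable borel"
    unfolding ball_kernel_def[abs_def] by (intro borel_measurable_divide borel_measurable_indicator borel_measurable_const) simp
  have 1: "(\<lambda>p. (LINT y|lborel. ball_kernel \<epsilon> y * norm (g (fst p) (snd p) - g (fst p) (snd p - y)) ^ 3))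
      \<in> borel_measurable (borel \<Otimes>\<^sub>M \<mu>)"
    by measurable
  have "(\<lambda>\<tau>. cubic_modulus \<epsilon> (g \<tau>)) \<in> borel_measurable borel"
    unfolding cubic_modulus_def using 1
    by (intro torus_measure.borel_measurable_lebesgue_integral) (simp add: split_beta')
  then have "(\<lambda>\<tau>. indicator {0..T} \<tau> * cubic_modulus \<epsilon> (g \<tau>)) \<in> borel_measurable borel" by measurable
  moreover have "(\<lambda>\<tau>. indicator {0..T} \<tau> * cubic_modulus \<epsilon> (g \<tau>)) = (\<lambda>\<tau>. indicator {0..T} \<tau> * cubic_modulus \<epsilon> (h \<tau>))"
    by (auto simp: fun_eq_iff indicator_def g_def[abs_def])
  ultimately show ?thesis by simp
qed

lemma flux_measurable:
  assumes u: "jointly_measurable T u" and h: "jointly_measurable T h" and \<rho>: "kernel \<rho>" and f: "torus_L1 f"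
  shows "(\<lambda>\<tau>. indicator {0..T} \<tau> * flux \<rho> (u \<tau>) (h \<tau>) f) \<in> borel_measurable borel"
proof -
  define g where "g \<tau> x = indicator {0..T} \<tau> *\<^sub>R h \<tau> x" for \<tau> x
  define v where "v \<tau> x = indicator {0..T} \<tau> *\<^sub>R u \<tau> x" for \<tau> x
  have [measurable]: "(\<lambda>(\<tau>, x). g \<tau> x) \<in> borel_measurable (borel \<Otimes>\<^sub>M borel)"
    "(\<lambda>(\<tau>, x). v \<tau> x) \<in> borel_measurable (borel \<Otimes>\<^sub>M borel)"
    using jointly_measurable_cut[OF h] jointly_measurable_cut[OF u] by (simp_all add: g_def v_def)
  note [measurable] = conv_measurable[OF \<rho> f] conv_measurable[OF kernel_frechet[OF \<rho>] f]
  have 1: "(\<lambda>(\<tau>, x). conv \<rho> f x \<bullet> (v \<tau> x \<times> g \<tau> x) +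
      (\<Sum>k\<in>UNIV. g \<tau> x $ k * (g \<tau> x \<bullet> conv (deriv_kernel \<rho> k) f x))) \<in> borel_measurable (borel \<Otimes>\<^sub>M \<mu>)"
    by measurable
  have [measurable]: "(\<lambda>\<tau>. flux \<rho> (v \<tau>) (g \<tau>) f) \<in> borel_measurable borel"
    unfolding flux_def by (intro torus_measure.borel_measurable_lebesgue_integral 1)
  have "(\<lambda>\<tau>. indicator {0..T} \<tau> * flux \<rho> (v \<tau>) (g \<tau>) f) \<in> borel_measurable borel" by measurable
  moreover have "(\<lambda>\<tau>. indicator {0..T} \<tau> * flux \<rho> (v \<tau>) (g \<tau>) f) = (\<lambda>\<tau>. indicator {0..T} \<tau> * flux \<rho> (u \<tau>) (h \<tau>) f)"
    by (auto simp: fun_eq_iff indicator_def g_def[abs_def] v_def[abs_def])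
  ultimately show ?thesis by simp
qed

lemma cubic_modulus_nonneg: "0 \<le> cubic_modulus \<epsilon> f"
  unfolding cubic_modulus_def ball_kernel_def by (intro integral_nonneg_AE AE_I2) simp

text \<open>Supplies the majorant for integrating the modulus over time. Each of the two points of
  an increment contributes the 4 of \<open>cube_diff_le\<close>, and averaging over the shift
  changes neither contribution.\<close>

lemma cubic_modulus_le:
  fixes f :: "real ^ 3 \<Rightarrow> real ^ 3"
  assumes \<epsilon>: "0 < \<epsilon>" and f: "torus_Lp 3 f"
  shows "cubic_modulus \<epsilon> f \<le> 8 * (LINT x|\<mu>. norm (f x) ^ 3)"
proof -
  have w: "integrable lborel (ball_kernel \<epsilon> :: real ^ 3 \<Rightarrow> real)"
    "(LINT y|(lborel :: (real ^ 3) measure). ball_kernel \<epsilon> y) = 1"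
    "\<And>y :: real ^ 3. ball_kernel \<epsilon> (- y) = ball_kernel \<epsilon> y" "\<And>y :: real ^ 3. 0 \<le> ball_kernel \<epsilon> y"
    by (rule ball_kernel_facts[OF \<epsilon>])+
  have i: "integrable (\<mu> \<Otimes>\<^sub>M lborel) (\<lambda>(x, y). ball_kernel \<epsilon> y * V (f x) (f (x - y)))"
    and sw: "(LINT x|\<mu>. (LINT y|lborel. ball_kernel \<epsilon> y * V (f x) (f (x - y)))) =
      (LINT x|\<mu>. (LINT y|lborel. ball_kernel \<epsilon> y * V (f (x - y)) (f x)))"
    if "(\<lambda>(a, b). V a b) \<in> borel_measurable (borel \<Otimes>\<^sub>M borel)" "\<And>a b. \<bar>V a b\<bar> \<le> 4 * (norm a ^ 3 + norm b ^ 3)"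
    for V
    using cubic_kernel_integrable[OF w(1) f that(1) _ that(2)] by (simp_all add: w(3))
  have m: "(\<lambda>(a, b :: real ^ 3). norm (a :: real ^ 3) ^ 3) \<in> borel_measurable (borel \<Otimes>\<^sub>M borel)"
    "(\<lambda>(a :: real ^ 3, b). norm (b :: real ^ 3) ^ 3) \<in> borel_measurable (borel \<Otimes>\<^sub>M borel)"
    "(\<lambda>(a, b). norm (a - b :: real ^ 3) ^ 3) \<in> borel_measurable (borel \<Otimes>\<^sub>M borel)" by measurable
  have b: "\<bar>norm a ^ 3\<bar> \<le> 4 * (norm a ^ 3 + norm b ^ 3)" "\<bar>norm b ^ 3\<bar> \<le> 4 * (norm a ^ 3 + norm b ^ 3)"
    "\<bar>norm (a - b) ^ 3\<bar> \<le> 4 * (norm a ^ 3 + norm b ^ 3)" for a b :: "real ^ 3"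
    using cube_diff_le[of a b] by simp_all
  note ia = i[OF m(1) b(1)] and ib = i[OF m(2) b(2)] and id = i[OF m(3) b(3)]
  have A: "(LINT x|\<mu>. (LINT y|lborel. ball_kernel \<epsilon> (y :: real ^ 3) * norm (f x) ^ 3)) = (LINT x|\<mu>. norm (f x) ^ 3)"
    using w(1,2) by simp
  have B: "(LINT x|\<mu>. (LINT y|lborel. ball_kernel \<epsilon> y * norm (f (x - y)) ^ 3)) = (LINT x|\<mu>. norm (f x) ^ 3)"
    using sw[OF m(1) b(1)] A by simp
  have Q: "integrable (\<mu> \<Otimes>\<^sub>M lborel) (\<lambda>(x, y). 4 * (ball_kernel \<epsilon> y * norm (f x) ^ 3) + 4 * (ball_kernel \<epsilon> y * norm (f (x - y)) ^ 3))"
    using Bochner_Integration.integrable_add[OF integrable_mult_right[OF ia, of 4] integrable_mult_right[OF ib, of 4]]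
    by (simp add: split_beta')
  have "cubic_modulus \<epsilon> f \<le> \<bar>cubic_modulus \<epsilon> f\<bar>" by simp
  also have "\<dots> \<le> (LINT (x, y)|(\<mu> \<Otimes>\<^sub>M lborel). 4 * (ball_kernel \<epsilon> y * norm (f x) ^ 3) + 4 * (ball_kernel \<epsilon> y * norm (f (x - y)) ^ 3))"
    unfolding cubic_modulus_def
  proof (rule iterated_integral_le[OF id Q])
    fix x y
    have "ball_kernel \<epsilon> y * norm (f x - f (x - y)) ^ 3 \<le> ball_kernel \<epsilon> y * (4 * (norm (f x) ^ 3 + norm (f (x - y)) ^ 3))"
      by (intro mult_left_mono cube_diff_le w(4))
    then show "\<bar>ball_kernel \<epsilon> y * norm (f x - f (x - y)) ^ 3\<bar> \<le>
        4 * (ball_kernel \<epsilon> y * norm (f x) ^ 3) + 4 * (ball_kernel \<epsilon> y * norm (f (x - y)) ^ 3)"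
      using w(4)[of y] by (simp add: abs_mult distrib_left mult_ac)
  qed
  also have "\<dots> = 4 * (LINT (x, y :: real ^ 3)|(\<mu> \<Otimes>\<^sub>M lborel). ball_kernel \<epsilon> y * norm (f x) ^ 3) +
      4 * (LINT (x, y)|(\<mu> \<Otimes>\<^sub>M lborel). ball_kernel \<epsilon> y * norm (f (x - y)) ^ 3)"
    using ia ib by (simp add: split_beta')
  also have "\<dots> = 8 * (LINT x|\<mu>. norm (f x) ^ 3)"
    unfolding torus_lborel.integral_fst[OF ia, symmetric] torus_lborel.integral_fst[OF ib, symmetric] A B by simp
  finally show ?thesis .
qed

text \<open>With \<open>q = r = 3\<close> the exponent \<open>r / q\<close> is 1, and cubing the
  whole expression turns \<open>\<epsilon> powr (1/3)\<close> into \<epsilon>. This is the rate that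
  cancels the \<open>1 / \<epsilon>\<close> of the Hall term.\<close>

lemma Besov_VMO_cubic_modulus:
  fixes h :: "real \<Rightarrow> real ^ 3 \<Rightarrow> real ^ 3"
  assumes h: "Lr_Besov_VMO T 3 (1/3) 3 h" and m: "\<And>t. t \<in> {0..T} \<Longrightarrow> torus_Lp 3 (h t)"
  shows "((\<lambda>\<epsilon>. (LINT t:{0..T}|lborel. cubic_modulus \<epsilon> (h t)) / \<epsilon>) \<longlongrightarrow> 0) (at_right 0)"
proof -
  have eq: "(LINT x:torus|lborel. 1 / measure lborel (ball (0 :: real ^ 3) \<epsilon>) *
      (LINT y:ball 0 \<epsilon>|lborel. norm (h t x - h t (x - y)) powr 3)) powr (3 / 3) = cubic_modulus \<epsilon> (h t)"
    if t: "t \<in> {0..T}" for t \<epsilon>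
  proof -
    note [measurable] = torus_L3_D(1)[OF m[OF t]]
    have [measurable]: "(ball_kernel \<epsilon> :: real ^ 3 \<Rightarrow> real) \<in> borel_measurable borel"
      unfolding ball_kernel_def[abs_def] by (intro borel_measurable_divide borel_measurable_indicator borel_measurable_const) simp
    have "1 / measure lborel (ball (0 :: real ^ 3) \<epsilon>) * (LINT y:ball 0 \<epsilon>|lborel. norm (h t x - h t (x - y)) powr 3) =
        (LINT y|lborel. ball_kernel \<epsilon> y * norm (h t x - h t (x - y)) ^ 3)" for x
      unfolding set_lebesgue_integral_def ball_kernel_def
      by (simp add: powr_numeral_nonneg flip: integral_divide_zero)
    then have "(LINT x:torus|lborel. 1 / measure lborel (ball (0 :: real ^ 3) \<epsilon>) *
      (LINT y:ball 0 \<epsilon>|lborel. norm (h t x - h t (x - y)) powr 3)) = cubic_modulus \<epsilon> (h t)"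
      unfolding cubic_modulus_def by (subst integral_torus_measure) simp_all
    then show ?thesis using cubic_modulus_nonneg[of \<epsilon> "h t"] by simp
  qed
  define Y where "Y \<epsilon> = (LINT t:{0..T}|lborel. cubic_modulus \<epsilon> (h t))" for \<epsilon>
  have Y0: "0 \<le> Y \<epsilon>" for \<epsilon>
    unfolding Y_def set_lebesgue_integral_def
    by (intro integral_nonneg_AE AE_I2) (simp add: cubic_modulus_nonneg)
  have "(LINT t:{0..T}|lborel. (LINT x:torus|lborel. 1 / measure lborel (ball (0 :: real ^ 3) \<epsilon>) *
      (LINT y:ball 0 \<epsilon>|lborel. norm (h t x - h t (x - y)) powr 3)) powr (3 / 3)) = Y \<epsilon>" for \<epsilon>
    unfolding Y_def by (rule set_lebesgue_integral_cong) (use eq in auto)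
  then have "((\<lambda>\<epsilon>. 1 / \<epsilon> powr (1/3) * Y \<epsilon> powr (1/3)) \<longlongrightarrow> 0) (at_right 0)"
    using h unfolding Lr_Besov_VMO_def by simp
  from tendsto_power[OF this, of 3]
  have "((\<lambda>\<epsilon>. (1 / \<epsilon> powr (1/3) * Y \<epsilon> powr (1/3)) ^ 3) \<longlongrightarrow> 0) (at_right 0)" by simp
  moreover have "\<forall>\<^sub>F \<epsilon> in at_right 0. (1 / \<epsilon> powr (1/3) * Y \<epsilon> powr (1/3)) ^ 3 = Y \<epsilon> / \<epsilon>"
    using eventually_at_right_less[of 0]
  proof (rule eventually_mono)
    fix \<epsilon> :: real assume "0 < \<epsilon>"
    have c: "(x powr (1/3)) ^ 3 = x" if "0 \<le> x" for x :: real
    proof -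
      have "(x powr (1/3)) ^ 3 = (x powr (1/3)) powr 3" by (simp add: powr_numeral_nonneg)
      then show ?thesis using that by (simp add: powr_powr)
    qed
    show "(1 / \<epsilon> powr (1/3) * Y \<epsilon> powr (1/3)) ^ 3 = Y \<epsilon> / \<epsilon>"
      using c[of \<epsilon>] c[OF Y0[of \<epsilon>]] \<open>0 < \<epsilon>\<close> by (simp add: power_divide)
  qed
  ultimately show ?thesis unfolding Y_def[symmetric] by (rule Lim_transform_eventually)
qed


subsection \<open>Evolution of the mollified helicity\<close>

lemma partial_cmult:
  fixes g :: "real ^ 'n \<Rightarrow> real"
  assumes "g differentiable (at x)"
  shows "partial k (\<lambda>z. c * g z) x = c * partial k g x"
proof -
  have "((\<lambda>z. c * g z) has_derivative (\<lambda>v. c * frechet_derivative g (at x) v)) (at x)"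
    by (rule bounded_linear.has_derivative[OF bounded_linear_mult_right])
      (use assms frechet_derivative_works in blast)
  then show ?thesis unfolding partial_def by (simp add: frechet_derivative_at[symmetric])
qed

text \<open>The gradient of the test field is contracted with an antisymmetric tensor in
  \<open>h\<close> and \<open>u\<close>, so only its antisymmetric part, the curl, survives.\<close>

lemma stretching_cross:
  fixes D :: "3 \<Rightarrow> 3 \<Rightarrow> real" and u h :: "real ^ 3"
  shows "(\<Sum>i\<in>UNIV. \<Sum>k\<in>UNIV. D k i * (h $ i * u $ k - u $ i * h $ k)) =
    vector [D 2 3 - D 3 2, D 3 1 - D 1 3, D 1 2 - D 2 1] \<bullet> (u \<times> h)"
  by (simp add: cross3_def inner_vec_def sum_3 algebra_simps)

text \<open>Self-adjointness of the inverse curl: the weak curl of \<open>H\<close> is tested with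
  \<open>conv \<rho> G\<close>, whose curl is \<open>conv \<rho> g\<close>.\<close>

lemma curl_inverse_pairing_symmetric:
  assumes \<rho>: "kernel \<rho>" "\<And>y. \<rho> (- y) = \<rho> y" and H: "is_curl_inverse h H" and G: "is_curl_inverse g G"
  shows "(LINT x|\<mu>. h x \<bullet> conv \<rho> G x) = (LINT x|\<mu>. H x \<bullet> conv \<rho> g x)"
proof -
  have wH: "has_weak_curl H h" and wG: "has_weak_curl G g" using H G unfolding is_curl_inverse_def by auto
  have HL2: "torus_Lp 2 H" and hL2: "torus_Lp 2 h" and GL2: "torus_Lp 2 G" and gL2: "torus_Lp 2 g"
    using wH wG unfolding has_weak_curl_def by auto
  note L1 = torus_L2_L1[OF GL2] torus_L2_L1[OF gL2]
  have [measurable]: "H \<in> borel_measurable borel" "h \<in> borel_measurable borel"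
    using HL2 hL2 by (simp_all add: torus_Lp_numeral)
  note [measurable] = conv_measurable[OF \<rho>(1) L1(1)] conv_measurable[OF \<rho>(1) L1(2)]
  have "(LINT x|\<mu>. h x \<bullet> conv \<rho> G x) = (LINT x:torus|lborel. h x \<bullet> conv \<rho> G x)"
    by (rule integral_torus_measure) measurable
  also have "\<dots> = (LINT x:torus|lborel. H x \<bullet> curl (conv \<rho> G) x)"
    using wH smooth_conv[OF \<rho>(1) L1(1)] periodic_conv[OF torus_L1D(2)[OF L1(1)]]
    unfolding has_weak_curl_def by simp
  also have "\<dots> = (LINT x:torus|lborel. H x \<bullet> conv \<rho> g x)"
    unfolding curl_conv[OF \<rho> wG] ..
  also have "\<dots> = (LINT x|\<mu>. H x \<bullet> conv \<rho> g x)"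
    by (rule integral_torus_measure[symmetric]) measurable
  finally show ?thesis .
qed

text \<open>\<open>H t\<close> is an arbitrary version at each time, with no measurability in
  \<open>t\<close>. This suffices because potentials enter only at fixed times, never under a time
  integral.\<close>

locale helicity_setting =
  fixes T :: real and u h H :: "real \<Rightarrow> real ^ 3 \<Rightarrow> real ^ 3"
  assumes sol: "Hall_MHD_weak_solution T u h"
    and h_cont: "C_Lq T 3 h"
    and u_L3: "AE t in lborel. t \<in> {0..T} \<longrightarrow> torus_Lp 3 (u t)"
    and u_cubed: "set_integrable lborel {0..T} (\<lambda>t. torus_Lp_norm 3 (u t) powr 3)"
    and h_cubed: "set_integrable lborel {0..T} (\<lambda>t. torus_Lp_norm 3 (h t) powr 3)"
    and H_inv: "\<And>t. t \<in> {0..T} \<Longrightarrow> is_curl_inverse (h t) (H t)"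
begin

lemma h_L3: "t \<in> {0..T} \<Longrightarrow> torus_Lp 3 (h t)"
  using h_cont unfolding C_Lq_def by blast

lemma jointly_measurable_fields: "jointly_measurable T u" "jointly_measurable T h"
  using sol unfolding Hall_MHD_weak_solution_def by auto

lemma set_integrable_flux:
  assumes \<rho>: "kernel \<rho>" and f: "torus_L1 f"
  shows "set_integrable lborel {0..T} (\<lambda>t. flux \<rho> (u t) (h t) f)"
proof -
  obtain b where b: "0 \<le> b" "\<And>u h f. \<lbrakk>torus_Lp 3 u; torus_Lp 3 h; torus_L1 f\<rbrakk> \<Longrightarrow>
    \<bar>flux \<rho> u h f\<bar> \<le> b * (LINT x|\<mu>. norm (f x)) * (2 + cubic_mass u h)"
    by (rule flux_L1_bound[OF \<rho>]) (rule that)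
  let ?c = "b * (LINT x|\<mu>. norm (f x))"
  have I2: "set_integrable lborel {0..T} (\<lambda>t. ?c * (2 + (torus_Lp_norm 3 (u t) powr 3 + torus_Lp_norm 3 (h t) powr 3)))"
  proof -
    have "set_integrable lborel {0..T} (\<lambda>t. 2 :: real)"
      unfolding set_integrable_def using borel_integrable_compact[of "{0..T}" "\<lambda>t. 2 :: real"] by simp
    then show ?thesis using u_cubed h_cubed by (intro set_integrable_mult_right set_integral_add(1)) auto
  qed
  show ?thesis
    unfolding set_integrable_def
  proof (rule Bochner_Integration.integrable_bound[OF I2[unfolded set_integrable_def]])
    show "(\<lambda>t. indicator {0..T} t *\<^sub>R flux \<rho> (u t) (h t) f) \<in> borel_measurable lborel"
      using flux_measurable[OF jointly_measurable_fields \<rho> f] by simp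
    show "AE t in lborel. norm (indicator {0..T} t *\<^sub>R flux \<rho> (u t) (h t) f) \<le>
        norm (indicator {0..T} t *\<^sub>R (?c * (2 + (torus_Lp_norm 3 (u t) powr 3 + torus_Lp_norm 3 (h t) powr 3))))"
      using u_L3
    proof eventually_elim
      case (elim t)
      show ?case
      proof (cases "t \<in> {0..T}")
        case True
        then have ut: "torus_Lp 3 (u t)" and ht: "torus_Lp 3 (h t)" using elim h_L3 by auto
        have "cubic_mass (u t) (h t) = torus_Lp_norm 3 (u t) powr 3 + torus_Lp_norm 3 (h t) powr 3"
          using torus_L3_D(3)[OF ut] torus_L3_D(3)[OF ht]
          by (simp add: cubic_mass_def torus_Lp_norm_cubed[OF ut] torus_Lp_norm_cubed[OF ht])
        then have "\<bar>flux \<rho> (u t) (h t) f\<bar> \<le> ?c * (2 + (torus_Lp_norm 3 (u t) powr 3 + torus_Lp_norm 3 (h t) powr 3))"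
          using b(2)[OF ut ht f] by simp
        also have "\<dots> \<le> \<bar>\<dots>\<bar>" by (rule abs_ge_self)
        finally show ?thesis using True by simp
      qed simp
    qed
  qed
qed

text \<open>The test field is a time cutoff times \<open>conv \<rho> G\<close>, which is smooth and
  periodic, and divergence-free because \<open>G\<close> is weakly so. Its curl is
  \<open>conv \<rho> g\<close>, so the potential itself disappears from the flux.\<close>

lemma helicity_pairing_evolution:
  assumes \<rho>: "kernel \<rho>" "\<And>y. \<rho> (- y) = \<rho> y" and G: "is_curl_inverse g G"
    and st: "0 \<le> s" "s \<le> t" "t \<le> T"
  shows "(LINT x|\<mu>. h t x \<bullet> conv \<rho> G x) - (LINT x|\<mu>. h s x \<bullet> conv \<rho> G x) =
    (LINT \<tau>:{s<..t}|lborel. flux \<rho> (u \<tau>) (h \<tau>) g)"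
proof -
  have wc: "has_weak_curl G g" and wd: "weakly_div_free G" using G unfolding is_curl_inverse_def by auto
  have GL2: "torus_Lp 2 G" and gL2: "torus_Lp 2 g" using wc unfolding has_weak_curl_def by auto
  have GL1: "torus_L1 G" and gL1: "torus_L1 g" using torus_L2_L1 GL2 gL2 by auto
  have hw: "weakly_continuous_L2 T h" and uw: "weakly_continuous_L2 T u"
    and weak: "\<And>\<phi>. div_free_test_field T \<phi> \<Longrightarrow>
       (LINT t:{0..T}|lborel. (LINT x:torus|lborel.
          time_deriv \<phi> t x \<bullet> h t x +
          (\<Sum>i\<in>UNIV. \<Sum>k\<in>UNIV. partial k (\<lambda>z. \<phi> t z $ i) x *
             (h t x $ i * u t x $ k - u t x $ i * h t x $ k)) +
          (\<Sum>i\<in>UNIV. \<Sum>k\<in>UNIV. h t x $ i * h t x $ k *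
             partial k (\<lambda>z. curl (\<phi> t) z $ i) x))) = 0"
    using sol unfolding Hall_MHD_weak_solution_def by auto
  define \<psi> where "\<psi> = conv \<rho> G"
  have \<psi>s: "smooth \<psi>" unfolding \<psi>_def by (rule smooth_conv[OF \<rho>(1) GL1])
  have \<psi>p: "periodic \<psi>" unfolding \<psi>_def by (rule periodic_conv[OF torus_L1D(2)[OF GL1]])
  have \<psi>2: "torus_Lp 2 \<psi>" unfolding \<psi>_def by (rule torus_Lp2_conv[OF \<rho>(1) GL1])
  have curl\<psi>: "curl \<psi> = conv \<rho> g" unfolding \<psi>_def by (rule ext) (rule curl_conv[OF \<rho> wc])
  have comp_diff: "(\<lambda>z. conv \<rho> f z $ i) differentiable (at x)" if "torus_L1 f" for f :: "real ^ 3 \<Rightarrow> real ^ 3" and i x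
    unfolding conv_nth[OF \<rho>(1) that]
    using conv_has_derivative[OF \<rho>(1) torus_L1_nth[OF that]] unfolding differentiable_def by blast
  have div\<psi>: "divergence \<psi> x = 0" for x
    unfolding divergence_def \<psi>_def partial_conv_nth[OF \<rho>(1) GL1] by (rule divergence_conv[OF \<rho> GL2 wd])
  have L2: "torus_Lp 2 (u t)" "torus_Lp 2 (h t)" if "t \<in> {0..T}" for t
    using hw uw that unfolding weakly_continuous_L2_def by auto
  then have meas: "u t \<in> borel_measurable borel" "h t \<in> borel_measurable borel" if "t \<in> {0..T}" for t
    using that unfolding torus_Lp_def by auto
  define a where "a t = (LINT x|\<mu>. h t x \<bullet> \<psi> x)" for t
  define \<Gamma> where "\<Gamma> t x = conv \<rho> g x \<bullet> (u t x \<times> h t x) +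
      (\<Sum>k\<in>UNIV. h t x $ k * (h t x \<bullet> conv (deriv_kernel \<rho> k) g x))" for t x
  have flux: "flux \<rho> (u t) (h t) g = (LINT x|\<mu>. \<Gamma> t x)" for t
    unfolding flux_def \<Gamma>_def ..
  have [measurable]: "\<psi> \<in> borel_measurable borel" using \<psi>2 by (simp add: torus_Lp_numeral)
  note [measurable] = conv_measurable[OF \<rho>(1) gL1] conv_measurable[OF kernel_frechet[OF \<rho>(1)] gL1]
  have a_cont: "continuous_on {0..T} a"
  proof -
    have "continuous_on {0..T} (\<lambda>t. LINT x:torus|lborel. h t x \<bullet> \<psi> x)"
      using hw \<psi>2 unfolding weakly_continuous_L2_def by blast
    then show ?thesis
    proof (rule continuous_on_eq)
      fix t assume "t \<in> {0..T}"
      note [measurable] = meas(2)[OF this]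
      show "(LINT x:torus|lborel. h t x \<bullet> \<psi> x) = a t"
        unfolding a_def by (rule integral_torus_measure[symmetric]) measurable
    qed
  qed
  have "a t - a s = (LINT \<tau>:{s<..t}|lborel. flux \<rho> (u \<tau>) (h \<tau>) g)"
  proof (rule weak_derivative_integral[OF a_cont set_integrable_flux[OF \<rho>(1) gL1] _ st])
    fix \<theta> \<theta>' :: "real \<Rightarrow> real"
    assume \<theta>: "smooth \<theta>" "\<And>t. (\<theta> has_real_derivative \<theta>' t) (at t)"
      and supp: "\<exists>c d. 0 < c \<and> c \<le> d \<and> d < T \<and> (\<forall>t. t \<notin> {c..d} \<longrightarrow> \<theta> t = 0)"
    define \<phi> where "\<phi> t x = \<theta> t *\<^sub>R \<psi> x" for t x
    have part: "partial k (\<lambda>z. \<phi> t z $ i) x = \<theta> t * partial k (\<lambda>z. \<psi> z $ i) x" for k t i x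
      using partial_cmult[OF comp_diff[OF GL1], of k "\<theta> t" i x] by (simp add: \<phi>_def \<psi>_def)
    have curl\<phi>: "curl (\<phi> t) z $ i = \<theta> t * (conv \<rho> g z $ i)" for t z i
      unfolding curl\<psi>[symmetric] curl_def part
      using exhaust_3[of i] by (auto simp: right_diff_distrib)
    have part2: "partial k (\<lambda>z. curl (\<phi> t) z $ i) x = \<theta> t * (conv (deriv_kernel \<rho> k) g x $ i)" for k t i x
      unfolding curl\<phi> partial_cmult[OF comp_diff[OF gL1]] partial_conv_nth[OF \<rho>(1) gL1]
        conv_nth[OF kernel_frechet[OF \<rho>(1)] gL1] ..
    have td: "time_deriv \<phi> t x = \<theta>' t *\<^sub>R \<psi> x" for t x
    proof -
      have "((\<lambda>s. \<phi> s x) has_vector_derivative \<theta>' t *\<^sub>R \<psi> x) (at t)"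
        unfolding \<phi>_def using \<theta>(2)[of t]
        by (intro has_vector_derivative_scaleR[where g' = 0, simplified]) auto
      then show ?thesis unfolding time_deriv_def by (rule vector_derivative_at)
    qed
    have test: "div_free_test_field T \<phi>"
      unfolding div_free_test_field_def
    proof (intro conjI allI)
      have "smooth (\<lambda>p :: real \<times> (real ^ 3). \<theta> (fst p) *\<^sub>R \<psi> (snd p))"
        by (rule smooth_bilinear[OF bounded_bilinear_scaleR
              smooth_compose_linear[OF bounded_linear_fst \<theta>(1)] smooth_compose_linear[OF bounded_linear_snd \<psi>s]])
      then show "smooth (\<lambda>(t, x). \<phi> t x)" by (simp add: \<phi>_def split_beta')
      show "periodic (\<phi> t)" for t using \<psi>p by (simp add: periodic_def \<phi>_def)
      show "\<exists>a b. 0 < a \<and> a \<le> b \<and> b < T \<and> (\<forall>t x. t \<notin> {a..b} \<longrightarrow> \<phi> t x = 0)"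
      proof -
        obtain c d where "0 < c" "c \<le> d" "d < T" "\<And>t. t \<notin> {c..d} \<Longrightarrow> \<theta> t = 0" using supp by blast
        then show ?thesis by (intro exI[of _ c] exI[of _ d]) (simp add: \<phi>_def)
      qed
      show "divergence (\<phi> t) x = 0" for t x
        unfolding divergence_def part sum_distrib_left[symmetric] using div\<psi>[of x]
        by (simp add: divergence_def)
    qed
    have integrand: "time_deriv \<phi> t x \<bullet> h t x +
          (\<Sum>i\<in>UNIV. \<Sum>k\<in>UNIV. partial k (\<lambda>z. \<phi> t z $ i) x *
             (h t x $ i * u t x $ k - u t x $ i * h t x $ k)) +
          (\<Sum>i\<in>UNIV. \<Sum>k\<in>UNIV. h t x $ i * h t x $ k *
             partial k (\<lambda>z. curl (\<phi> t) z $ i) x) = \<theta>' t * (h t x \<bullet> \<psi> x) + \<theta> t * \<Gamma> t x" for t x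
    proof -
      have 1: "(\<Sum>i\<in>UNIV. \<Sum>k\<in>UNIV. partial k (\<lambda>z. \<phi> t z $ i) x *
             (h t x $ i * u t x $ k - u t x $ i * h t x $ k)) = \<theta> t * (conv \<rho> g x \<bullet> (u t x \<times> h t x))"
        unfolding part mult.assoc sum_distrib_left[symmetric]
          stretching_cross[where D = "\<lambda>k i. partial k (\<lambda>z. \<psi> z $ i) x"]
        unfolding curl\<psi>[symmetric] curl_def ..
      have "(\<Sum>i\<in>UNIV. \<Sum>k\<in>UNIV. h t x $ i * h t x $ k * partial k (\<lambda>z. curl (\<phi> t) z $ i) x) =
          (\<Sum>k\<in>UNIV. \<Sum>i\<in>UNIV. \<theta> t * (h t x $ k * (h t x $ i * conv (deriv_kernel \<rho> k) g x $ i)))"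
        unfolding part2 by (subst sum.swap) (simp add: mult_ac)
      also have "\<dots> = \<theta> t * (\<Sum>k\<in>UNIV. h t x $ k * (h t x \<bullet> conv (deriv_kernel \<rho> k) g x))"
        by (simp add: inner_vec_def sum_distrib_left)
      finally show ?thesis
        unfolding 1 td \<Gamma>_def by (simp add: inner_commute distrib_left)
    qed
    \<comment> \<open>Both fields are in \<open>L^2\<close> at every time, so the space integral
      splits for each \<open>t\<close> and not only almost everywhere.\<close>
    have slice: "(LINT x:torus|lborel. \<theta>' t * (h t x \<bullet> \<psi> x) + \<theta> t * \<Gamma> t x) =
        \<theta>' t * a t + \<theta> t * flux \<rho> (u t) (h t) g" if t: "t \<in> {0..T}" for t
    proof -
      note [measurable] = meas[OF t]
      obtain B where B: "0 \<le> B" "\<And>x. norm (conv \<rho> g x) \<le> B" "\<And>k x. norm (conv (deriv_kernel \<rho> k) g x) \<le> B"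
        by (rule conv_bounds[OF \<rho>(1) gL1]) (rule that)
      have "integrable \<mu> (\<Gamma> t)"
        unfolding \<Gamma>_def[abs_def]
        by (rule Bochner_Integration.integrable_add[OF flux_integrands(1,2)[OF \<rho>(1) L2[OF t] gL1 B]])
      moreover have "integrable \<mu> (\<lambda>x. h t x \<bullet> \<psi> x)"
        by (rule integrable_inner_Lp2[OF L2(2)[OF t] \<psi>2])
      moreover have "(LINT x:torus|lborel. \<theta>' t * (h t x \<bullet> \<psi> x) + \<theta> t * \<Gamma> t x) =
          (LINT x|\<mu>. \<theta>' t * (h t x \<bullet> \<psi> x) + \<theta> t * \<Gamma> t x)"
        unfolding \<Gamma>_def by (rule integral_torus_measure[symmetric]) measurable
      ultimately show ?thesis by (simp add: flux a_def)
    qed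
    have "(LINT t:{0..T}|lborel. LINT x:torus|lborel. \<theta>' t * (h t x \<bullet> \<psi> x) + \<theta> t * \<Gamma> t x) = 0"
      using weak[OF test] unfolding integrand .
    moreover have "(LINT t:{0..T}|lborel. LINT x:torus|lborel. \<theta>' t * (h t x \<bullet> \<psi> x) + \<theta> t * \<Gamma> t x) =
        (LINT t:{0..T}|lborel. \<theta>' t * a t + \<theta> t * flux \<rho> (u t) (h t) g)"
      by (rule set_lebesgue_integral_cong) (use slice in auto)
    ultimately show "(LINT t:{0..T}|lborel. \<theta>' t * a t + \<theta> t * flux \<rho> (u t) (h t) g) = 0" by simp
  qed
  then show ?thesis by (simp add: a_def \<psi>_def)
qed

lemma mollified_helicity_increment:
  assumes \<rho>: "kernel \<rho>" "\<And>y. \<rho> (- y) = \<rho> y" and st: "0 \<le> s" "s \<le> t" "t \<le> T"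
  shows "(LINT x|\<mu>. H t x \<bullet> conv \<rho> (h t) x) - (LINT x|\<mu>. H s x \<bullet> conv \<rho> (h s) x) =
    (LINT \<tau>:{s<..t}|lborel. flux \<rho> (u \<tau>) (h \<tau>) (h t) + flux \<rho> (u \<tau>) (h \<tau>) (h s))"
proof -
  have T: "s \<in> {0..T}" "t \<in> {0..T}" using st by auto
  define B where "B r q = (LINT x|\<mu>. h q x \<bullet> conv \<rho> (H r) x)" for r q
  \<comment> \<open>Moving the inverse curl from one factor to the other exchanges the two
    times.\<close>
  have Q: "(LINT x|\<mu>. H r x \<bullet> conv \<rho> (h q) x) = B q r" if "r \<in> {0..T}" "q \<in> {0..T}" for r q
    unfolding B_def by (rule curl_inverse_pairing_symmetric[OF \<rho> H_inv H_inv, symmetric]) (use that in auto)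
  have sym: "B r q = B q r" if "r \<in> {0..T}" "q \<in> {0..T}" for r q
  proof -
    have "torus_Lp 2 (H r)" "torus_Lp 2 (h q)"
      using H_inv[OF that(1)] H_inv[OF that(2)] unfolding is_curl_inverse_def has_weak_curl_def by auto
    from conv_adjoint[OF \<rho>(1) this]
    have "(LINT x|\<mu>. H r x \<bullet> conv \<rho> (h q) x) = B r q"
      by (simp add: \<rho>(2) B_def inner_commute)
    then show ?thesis using Q[OF that] by simp
  qed
  have ev: "B r t - B r s = (LINT \<tau>:{s<..t}|lborel. flux \<rho> (u \<tau>) (h \<tau>) (h r))" if "r \<in> {0..T}" for r
    unfolding B_def by (rule helicity_pairing_evolution[OF \<rho> H_inv[OF that] st])
  have "(LINT x|\<mu>. H t x \<bullet> conv \<rho> (h t) x) - (LINT x|\<mu>. H s x \<bullet> conv \<rho> (h s) x) =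
      (B t t - B t s) + (B s t - B s s)"
    using Q[OF T(1,1)] Q[OF T(2,2)] sym[OF T] by simp
  also have "\<dots> = (LINT \<tau>:{s<..t}|lborel. flux \<rho> (u \<tau>) (h \<tau>) (h t)) + (LINT \<tau>:{s<..t}|lborel. flux \<rho> (u \<tau>) (h \<tau>) (h s))"
    by (simp only: ev[OF T(1)] ev[OF T(2)])
  also have "\<dots> = (LINT \<tau>:{s<..t}|lborel. flux \<rho> (u \<tau>) (h \<tau>) (h t) + flux \<rho> (u \<tau>) (h \<tau>) (h s))"
  proof (rule set_integral_add(2)[symmetric])
    show "set_integrable lborel {s<..t} (\<lambda>\<tau>. flux \<rho> (u \<tau>) (h \<tau>) (h t))"
      "set_integrable lborel {s<..t} (\<lambda>\<tau>. flux \<rho> (u \<tau>) (h \<tau>) (h s))"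
      by (rule set_integrable_subset[OF set_integrable_flux[OF \<rho>(1) torus_L3_L1[OF h_L3]]];
          use st in auto)+
  qed
  finally show ?thesis .
qed

text \<open>The factor 2 stems from the two endpoint fluxes. The constant of the freezing error
  depends on \<rho>, which is fixed here, so that error vanishes with \<eta> and leaves no trace in
  the bound.\<close>

lemma mollified_helicity_bound:
  assumes \<rho>: "mollifier C \<epsilon> \<rho>" and \<epsilon>: "0 < \<epsilon>" "\<epsilon> < 1/4" and e: "0 < e" and t: "t \<in> {0..T}"
  shows "\<bar>(LINT x|\<mu>. H t x \<bullet> conv \<rho> (h t) x) - (LINT x|\<mu>. H 0 x \<bullet> conv \<rho> (h 0) x)\<bar> \<le>
    2 * ((C / (4 * \<epsilon>) + C / e\<^sup>2) * (LINT \<tau>:{0..T}|lborel. cubic_modulus \<epsilon> (h \<tau>)) +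
      e * (LINT \<tau>:{0..T}|lborel. torus_Lp_norm 3 (u \<tau>) powr 3 + torus_Lp_norm 3 (h \<tau>) powr 3))"
    (is "_ \<le> ?R")
proof -
  have hdiv: "weakly_div_free (h t)" if "t \<in> {0..T}" for t
    using sol that unfolding Hall_MHD_weak_solution_def by auto
  have K: "kernel \<rho>" by (rule mollifier_kernel[OF \<rho> \<epsilon>(2)])
  have even: "\<rho> (- y) = \<rho> y" for y using \<rho> unfolding mollifier_def by auto
  have C: "0 \<le> C" by (rule mollifier_facts(1)[OF \<rho> \<epsilon>(1)])
  define Q where "Q t = (LINT x|\<mu>. H t x \<bullet> conv \<rho> (h t) x)" for t
  define U where "U \<tau> = torus_Lp_norm 3 (u \<tau>) powr 3 + torus_Lp_norm 3 (h \<tau>) powr 3" for \<tau>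
  define c where "c = C / (4 * \<epsilon>) + C / e\<^sup>2"
  have c: "0 \<le> c" using C \<epsilon> by (simp add: c_def)
  define m where "m \<tau> = c * cubic_modulus \<epsilon> (h \<tau>) + e * U \<tau>" for \<tau>
  have U0: "0 \<le> U \<tau>" for \<tau> by (simp add: U_def)
  have m0: "0 \<le> m \<tau>" for \<tau>
    unfolding m_def by (intro add_nonneg_nonneg mult_nonneg_nonneg c U0 cubic_modulus_nonneg) (use e in simp)
  have U: "set_integrable lborel {0..T} U" unfolding U_def by (rule set_integral_add(1)[OF u_cubed h_cubed])
  have X: "set_integrable lborel {0..T} (\<lambda>\<tau>. cubic_modulus \<epsilon> (h \<tau>))"
    unfolding set_integrable_def
  proof (rule Bochner_Integration.integrable_bound)
    show "integrable lborel (\<lambda>\<tau>. indicator {0..T} \<tau> *\<^sub>R (8 * (torus_Lp_norm 3 (h \<tau>) powr 3)))"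
      using set_integrable_mult_right[of 8, OF h_cubed] by (simp add: set_integrable_def)
    show "(\<lambda>\<tau>. indicator {0..T} \<tau> *\<^sub>R cubic_modulus \<epsilon> (h \<tau>)) \<in> borel_measurable lborel"
      using cubic_modulus_measurable[OF jointly_measurable_fields(2)] by simp
    show "AE \<tau> in lborel. norm (indicator {0..T} \<tau> *\<^sub>R cubic_modulus \<epsilon> (h \<tau>)) \<le>
        norm (indicator {0..T} \<tau> *\<^sub>R (8 * (torus_Lp_norm 3 (h \<tau>) powr 3)))"
    proof (rule AE_I2)
      fix \<tau>
      show "norm (indicator {0..T} \<tau> *\<^sub>R cubic_modulus \<epsilon> (h \<tau>)) \<le>
        norm (indicator {0..T} \<tau> *\<^sub>R (8 * (torus_Lp_norm 3 (h \<tau>) powr 3)))"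
      proof (cases "\<tau> \<in> {0..T}")
        case True
        then show ?thesis
          using cubic_modulus_le[OF \<epsilon>(1) h_L3[OF True]] cubic_modulus_nonneg[of \<epsilon> "h \<tau>"]
          by (simp add: torus_Lp_norm_cubed[OF h_L3[OF True]])
      qed simp
    qed
  qed
  have m: "set_integrable lborel {0..T} m"
    unfolding m_def by (intro set_integral_add(1) set_integrable_mult_right X U)
  have fluxI: "set_integrable lborel {0..T} (\<lambda>\<tau>. flux \<rho> (u \<tau>) (h \<tau>) f)" if "torus_L1 f" for f
    by (rule set_integrable_flux[OF K that])
  obtain b where b: "0 \<le> b" "\<And>u h f. \<lbrakk>torus_Lp 3 u; torus_Lp 3 h; torus_L1 f\<rbrakk> \<Longrightarrow>
    \<bar>flux \<rho> u h f\<bar> \<le> b * (LINT x|\<mu>. norm (f x)) * (2 + cubic_mass u h)"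
    by (rule flux_L1_bound[OF K]) (rule that)
  have two: "set_integrable lborel {0..T} (\<lambda>t. 2 :: real)"
    unfolding set_integrable_def using borel_integrable_compact[of "{0..T}" "\<lambda>t. 2 :: real"] by simp
  have I2: "set_integrable lborel {0..T} (\<lambda>\<tau>. 2 + U \<tau>)" by (rule set_integral_add(1)[OF two U])
  have main: "\<bar>Q t - Q 0\<bar> \<le> 4 * b * \<eta> * (LINT \<tau>:{0..T}|lborel. 2 + U \<tau>) + 2 * (LINT \<tau>:{0..T}|lborel. m \<tau>)"
    if \<eta>: "0 < \<eta>" for \<eta>
  proof -
    \<comment> \<open>Two endpoints, each with \<open>h\<close> within \<open>2 * \<eta>\<close> of
      \<open>h \<tau>\<close> in \<open>L^1\<close>, give the 4; the flux at equal times is counted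
      twice and gives \<open>2 * m \<tau>\<close>.\<close>
    define W where "W \<tau> = 4 * b * \<eta> * (2 + U \<tau>) + 2 * m \<tau>" for \<tau>
    have W0: "0 \<le> W \<tau>" for \<tau> using b \<eta> U0[of \<tau>] m0[of \<tau>] by (simp add: W_def)
    have W: "set_integrable lborel {0..T} W"
      unfolding W_def by (intro set_integral_add(1) set_integrable_mult_right I2 m)
    have Wsub: "set_integrable lborel {r<..q} W" if "0 \<le> r" "q \<le> T" for r q
      by (rule set_integrable_subset[OF W]) (use that in auto)
    \<comment> \<open>Bisection: the estimate is additive over adjacent intervals and holds on short
      intervals around every point, so continuity of \<open>h\<close> at each single time suffices.
      The premises are those of the interval predicate, here taken from 0 to
      \<open>t\<close>.\<close>
    have "0 \<le> (0::real) \<longrightarrow> t \<le> T \<longrightarrow> \<bar>Q t - Q 0\<bar> \<le> (LINT \<tau>:{0<..t}|lborel. W \<tau>)"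
    proof (rule Bolzano[where P = "\<lambda>r q. 0 \<le> r \<longrightarrow> q \<le> T \<longrightarrow> \<bar>Q q - Q r\<bar> \<le> (LINT \<tau>:{r<..q}|lborel. W \<tau>)"])
      show "0 \<le> t" using t by simp
    next
      fix r q p :: real
      assume rq: "0 \<le> r \<longrightarrow> q \<le> T \<longrightarrow> \<bar>Q q - Q r\<bar> \<le> (LINT \<tau>:{r<..q}|lborel. W \<tau>)"
        and qp: "0 \<le> q \<longrightarrow> p \<le> T \<longrightarrow> \<bar>Q p - Q q\<bar> \<le> (LINT \<tau>:{q<..p}|lborel. W \<tau>)"
        and le: "r \<le> q" "q \<le> p"
      show "0 \<le> r \<longrightarrow> p \<le> T \<longrightarrow> \<bar>Q p - Q r\<bar> \<le> (LINT \<tau>:{r<..p}|lborel. W \<tau>)"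
      proof (intro impI)
        assume "0 \<le> r" "p \<le> T"
        then have "\<bar>Q q - Q r\<bar> \<le> (LINT \<tau>:{r<..q}|lborel. W \<tau>)" "\<bar>Q p - Q q\<bar> \<le> (LINT \<tau>:{q<..p}|lborel. W \<tau>)"
          using rq qp le by auto
        moreover have "(LINT \<tau>:{r<..p}|lborel. W \<tau>) = (LINT \<tau>:{r<..q}|lborel. W \<tau>) + (LINT \<tau>:{q<..p}|lborel. W \<tau>)"
        proof -
          have "{r<..p} = {r<..q} \<union> {q<..p}" using le by auto
          moreover have "(LINT \<tau>:{r<..q} \<union> {q<..p}|lborel. W \<tau>) = (LINT \<tau>:{r<..q}|lborel. W \<tau>) + (LINT \<tau>:{q<..p}|lborel. W \<tau>)"
            using \<open>0 \<le> r\<close> \<open>p \<le> T\<close> le by (intro set_integral_Un Wsub) auto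
          ultimately show ?thesis by simp
        qed
        ultimately show "\<bar>Q p - Q r\<bar> \<le> (LINT \<tau>:{r<..p}|lborel. W \<tau>)" by linarith
      qed
    next
      fix x :: real assume "0 \<le> x" "x \<le> t"
      then have x: "x \<in> {0..T}" using t by auto
      obtain d where d: "0 < d" "\<And>\<tau>. \<tau> \<in> {0..T} \<Longrightarrow> \<bar>\<tau> - x\<bar> < d \<Longrightarrow>
          (LINT y|\<mu>. norm (h \<tau> y - h x y)) \<le> \<eta>"
        by (rule C_L3_L1_continuous[OF h_cont x \<eta>]) (rule that)
      show "\<exists>d>0. \<forall>r q. r \<le> x \<and> x \<le> q \<and> q - r < d \<longrightarrow>
          0 \<le> r \<longrightarrow> q \<le> T \<longrightarrow> \<bar>Q q - Q r\<bar> \<le> (LINT \<tau>:{r<..q}|lborel. W \<tau>)"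
      proof (intro exI[of _ d] conjI allI impI d(1))
        fix r q assume rq: "r \<le> x \<and> x \<le> q \<and> q - r < d" "0 \<le> r" "q \<le> T"
        then have rT: "r \<in> {0..T}" and qT: "q \<in> {0..T}" by auto
        \<comment> \<open>Times in the short interval are compared through \<open>x\<close>, hence
          the factor 2.\<close>
        have dist: "(LINT y|\<mu>. norm (h p y - h \<tau> y)) \<le> 2 * \<eta>" if "p \<in> {r..q}" "\<tau> \<in> {r..q}" for p \<tau>
        proof -
          have pT: "p \<in> {0..T}" "\<bar>p - x\<bar> < d" and \<tau>T: "\<tau> \<in> {0..T}" "\<bar>\<tau> - x\<bar> < d" using that rq by auto
          have i: "integrable \<mu> (\<lambda>y. norm (h p y - h x y))" "integrable \<mu> (\<lambda>y. norm (h \<tau> y - h x y))"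
            using torus_L1D(3)[OF torus_L3_L1[OF torus_Lp3_diff[OF h_L3 h_L3]]] pT \<tau>T x by auto
          have "(LINT y|\<mu>. norm (h p y - h \<tau> y)) \<le> (LINT y|\<mu>. norm (h p y - h x y) + norm (h \<tau> y - h x y))"
          proof (rule Bochner_Integration.integral_mono'[OF Bochner_Integration.integrable_add[OF i]])
            show "norm (h p y - h \<tau> y) \<le> norm (h p y - h x y) + norm (h \<tau> y - h x y)" for y
              using norm_triangle_ineq4[of "h p y - h x y" "h \<tau> y - h x y"] by simp
          qed simp
          also have "\<dots> \<le> 2 * \<eta>" using i d(2)[OF pT] d(2)[OF \<tau>T] by simp
          finally show ?thesis .
        qed
        have bound: "\<bar>flux \<rho> (u \<tau>) (h \<tau>) (h p)\<bar> \<le> m \<tau> + 2 * b * \<eta> * (2 + U \<tau>)"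
          if p: "p \<in> {r..q}" and \<tau>: "\<tau> \<in> {r..q}" and ut: "torus_Lp 3 (u \<tau>)" for p \<tau>
        proof -
          have \<tau>T: "\<tau> \<in> {0..T}" and pT: "p \<in> {0..T}" using p \<tau> rq by auto
          have mass: "cubic_mass (u \<tau>) (h \<tau>) = U \<tau>"
            using torus_L3_D(3)[OF ut] torus_L3_D(3)[OF h_L3[OF \<tau>T]]
            by (simp add: cubic_mass_def U_def torus_Lp_norm_cubed[OF ut] torus_Lp_norm_cubed[OF h_L3[OF \<tau>T]])
          have L: "torus_L1 (\<lambda>y. h p y - h \<tau> y)" by (rule torus_L3_L1[OF torus_Lp3_diff[OF h_L3[OF pT] h_L3[OF \<tau>T]]])
          have "flux \<rho> (u \<tau>) (h \<tau>) (h p) = flux \<rho> (u \<tau>) (h \<tau>) (h \<tau>) + flux \<rho> (u \<tau>) (h \<tau>) (\<lambda>y. h p y - h \<tau> y)"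
            using flux_diff[OF K torus_L3_L2[OF ut] torus_L3_L2[OF h_L3[OF \<tau>T]] torus_L3_L1[OF h_L3[OF pT]] torus_L3_L1[OF h_L3[OF \<tau>T]]] by simp
          moreover have "\<bar>flux \<rho> (u \<tau>) (h \<tau>) (h \<tau>)\<bar> \<le> m \<tau>"
            using flux_estimate[OF \<rho> \<epsilon> ut h_L3[OF \<tau>T] hdiv[OF \<tau>T] e] by (simp add: m_def c_def mass)
          moreover have "\<bar>flux \<rho> (u \<tau>) (h \<tau>) (\<lambda>y. h p y - h \<tau> y)\<bar> \<le> 2 * b * \<eta> * (2 + U \<tau>)"
          proof -
            have "\<bar>flux \<rho> (u \<tau>) (h \<tau>) (\<lambda>y. h p y - h \<tau> y)\<bar> \<le>
                b * (LINT y|\<mu>. norm (h p y - h \<tau> y)) * (2 + U \<tau>)"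
              using b(2)[OF ut h_L3[OF \<tau>T] L] by (simp add: mass)
            also have "\<dots> \<le> b * (2 * \<eta>) * (2 + U \<tau>)"
              using b(1) U0[of \<tau>] by (intro mult_right_mono mult_left_mono dist[OF p \<tau>]) auto
            finally show ?thesis by (simp add: mult_ac)
          qed
          ultimately show ?thesis by linarith
        qed
        let ?F = "\<lambda>\<tau>. flux \<rho> (u \<tau>) (h \<tau>) (h q) + flux \<rho> (u \<tau>) (h \<tau>) (h r)"
        have F: "set_integrable lborel {r<..q} ?F"
          by (rule set_integrable_subset[OF set_integral_add(1)[OF fluxI[OF torus_L3_L1[OF h_L3[OF qT]]] fluxI[OF torus_L3_L1[OF h_L3[OF rT]]]]])
            (use rq in auto)
        have incr: "Q q - Q r = (LINT \<tau>:{r<..q}|lborel. ?F \<tau>)"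
          unfolding Q_def using rq
          by (intro mollified_helicity_increment[OF K even]) auto
        have "\<bar>Q q - Q r\<bar> \<le> (LINT \<tau>:{r<..q}|lborel. \<bar>?F \<tau>\<bar>)"
          unfolding incr using set_integral_norm_bound[OF F] by simp
        also have "\<dots> \<le> (LINT \<tau>:{r<..q}|lborel. W \<tau>)"
        proof (rule set_integral_mono_AE[OF set_integrable_abs[OF F] Wsub])
          show "AE \<tau>\<in>{r<..q} in lborel. \<bar>?F \<tau>\<bar> \<le> W \<tau>"
            using u_L3
          proof eventually_elim
            case (elim \<tau>)
            show ?case
            proof
              assume \<tau>: "\<tau> \<in> {r<..q}"
              then have "\<tau> \<in> {0..T}" using rq by auto
              then have ut: "torus_Lp 3 (u \<tau>)" using elim by simp
              have \<tau>': "\<tau> \<in> {r..q}" using \<tau> by simp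
              have "q \<in> {r..q}" "r \<in> {r..q}" using rq by auto
              from add_mono[OF bound[OF this(1) \<tau>' ut] bound[OF this(2) \<tau>' ut]]
              have "\<bar>?F \<tau>\<bar> \<le> (m \<tau> + 2 * b * \<eta> * (2 + U \<tau>)) + (m \<tau> + 2 * b * \<eta> * (2 + U \<tau>))"
                by (rule order_trans[OF abs_triangle_ineq])
              then show "\<bar>?F \<tau>\<bar> \<le> W \<tau>" by (simp add: W_def algebra_simps)
            qed
          qed
        qed (use rq in auto)
        finally show "\<bar>Q q - Q r\<bar> \<le> (LINT \<tau>:{r<..q}|lborel. W \<tau>)" .
      qed
    qed
    then have "\<bar>Q t - Q 0\<bar> \<le> (LINT \<tau>:{0<..t}|lborel. W \<tau>)" using t by simp
    also have "\<dots> \<le> (LINT \<tau>:{0..T}|lborel. W \<tau>)"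
      unfolding set_lebesgue_integral_def
    proof (rule Bochner_Integration.integral_mono')
      show "integrable lborel (\<lambda>\<tau>. indicator {0..T} \<tau> *\<^sub>R W \<tau>)" using W by (simp add: set_integrable_def)
      show "indicator {0<..t} \<tau> *\<^sub>R W \<tau> \<le> indicator {0..T} \<tau> *\<^sub>R W \<tau>" for \<tau>
        using t W0[of \<tau>] by (auto simp: indicator_def)
      show "0 \<le> indicator {0..T} \<tau> *\<^sub>R W \<tau>" for \<tau> using W0[of \<tau>] by simp
    qed
    also have "\<dots> = 4 * b * \<eta> * (LINT \<tau>:{0..T}|lborel. 2 + U \<tau>) + 2 * (LINT \<tau>:{0..T}|lborel. m \<tau>)"
      unfolding W_def
      by (subst set_integral_add(2)) (use I2 m in auto)
    finally show ?thesis .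
  qed
  have mR: "2 * (LINT \<tau>:{0..T}|lborel. m \<tau>) = ?R"
    unfolding m_def
    by (subst set_integral_add(2)[OF set_integrable_mult_right[OF X] set_integrable_mult_right[OF U]])
      (simp add: U_def c_def)
  have "\<bar>Q t - Q 0\<bar> \<le> ?R"
  proof (rule field_le_epsilon)
    fix \<delta> :: real assume \<delta>: "0 < \<delta>"
    \<comment> \<open>The error term is \<open>k * \<eta>\<close>; choosing
      \<open>\<eta> = \<delta> / (k + 1)\<close> makes it at most \<delta> even when
      \<open>k\<close> is 0.\<close>
    define k where "k = 4 * b * (LINT \<tau>:{0..T}|lborel. 2 + U \<tau>)"
    have "0 \<le> (LINT \<tau>:{0..T}|lborel. 2 + U \<tau>)"
      unfolding set_lebesgue_integral_def by (intro integral_nonneg_AE AE_I2) (simp add: U0)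
    then have k: "0 \<le> k" using b by (simp add: k_def)
    have "0 < \<delta> / (k + 1)" using \<delta> k by simp
    from main[OF this] have "\<bar>Q t - Q 0\<bar> \<le> k * (\<delta> / (k + 1)) + ?R"
      unfolding mR by (simp add: k_def mult_ac)
    also have "k * (\<delta> / (k + 1)) \<le> \<delta>" using \<delta> k by (simp add: pos_divide_le_eq mult_left_mono distrib_left mult.commute)
    finally show "\<bar>Q t - Q 0\<bar> \<le> ?R + \<delta>" by simp
  qed
  then show ?thesis by (simp add: Q_def)
qed

end

section \<open>Removing the mollification\<close>

text \<open>The choice operator may return a weak curl other than \<open>h\<close>. Any two weak
  curls of \<open>H\<close> have the same pairing with the smooth field
  \<open>conv \<rho> H\<close>, and letting the scale tend to 0 carries this over to the pairing
  with \<open>H\<close>.\<close>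

lemma magnetic_helicity_eq:
  assumes H: "is_curl_inverse h H"
  shows "magnetic_helicity H = (LINT x|\<mu>. H x \<bullet> h x)"
proof -
  have wc: "has_weak_curl H h" using H unfolding is_curl_inverse_def by auto
  then have ww: "has_weak_curl H (weak_curl H)" unfolding weak_curl_def by (rule someI[of "has_weak_curl H"])
  define w where "w = weak_curl H"
  have HL2: "torus_Lp 2 H" and hL2: "torus_Lp 2 h" and wL2: "torus_Lp 2 w"
    using wc ww unfolding has_weak_curl_def w_def by auto
  note L1 = torus_L2_L1[OF HL2]
  have [measurable]: "H \<in> borel_measurable borel" "h \<in> borel_measurable borel" "w \<in> borel_measurable borel"
    using HL2 hL2 wL2 by (simp_all add: torus_Lp_numeral)
  obtain C where C: "C > 0" "\<And>\<epsilon>. \<epsilon> > 0 \<Longrightarrow> \<exists>\<rho>::real ^ 3 \<Rightarrow> real. mollifier C \<epsilon> \<rho>"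
    by (rule mollifier_exists) (rule that)
  have "\<bar>(LINT x|\<mu>. w x \<bullet> H x) - (LINT x|\<mu>. h x \<bullet> H x)\<bar> \<le> 0 + e" if e: "0 < e" for e
  proof -
    have e2: "0 < e / 2" using e by simp
    obtain d1 where d1: "d1 > 0" "\<forall>\<epsilon> \<rho>. \<epsilon> < 1/4 \<longrightarrow> \<epsilon> \<le> d1 \<longrightarrow> mollifier C \<epsilon> \<rho> \<longrightarrow>
      \<bar>(LINT x|\<mu>. w x \<bullet> conv \<rho> H x) - (LINT x|\<mu>. w x \<bullet> H x)\<bar> \<le> e / 2"
      using mollifier_pairing_limit[OF wL2 HL2 e2, of C] by blast
    obtain d2 where d2: "d2 > 0" "\<forall>\<epsilon> \<rho>. \<epsilon> < 1/4 \<longrightarrow> \<epsilon> \<le> d2 \<longrightarrow> mollifier C \<epsilon> \<rho> \<longrightarrow>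
      \<bar>(LINT x|\<mu>. h x \<bullet> conv \<rho> H x) - (LINT x|\<mu>. h x \<bullet> H x)\<bar> \<le> e / 2"
      using mollifier_pairing_limit[OF hL2 HL2 e2, of C] by blast
    define \<epsilon> where "\<epsilon> = min (min d1 d2) (1/8)"
    have \<epsilon>: "0 < \<epsilon>" "\<epsilon> < 1/4" "\<epsilon> \<le> d1" "\<epsilon> \<le> d2" using d1(1) d2(1) by (auto simp: \<epsilon>_def)
    obtain \<rho> :: "real ^ 3 \<Rightarrow> real" where \<rho>: "mollifier C \<epsilon> \<rho>" using C(2)[OF \<epsilon>(1)] by blast
    have K: "kernel \<rho>" by (rule mollifier_kernel[OF \<rho> \<epsilon>(2)])
    note [measurable] = conv_measurable[OF K L1]
    have test: "(LINT x:torus|lborel. v x \<bullet> conv \<rho> H x) = (LINT x:torus|lborel. H x \<bullet> curl (conv \<rho> H) x)"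
      if "has_weak_curl H v" for v
      using that smooth_conv[OF K L1] periodic_conv[OF torus_L1D(2)[OF L1]] unfolding has_weak_curl_def by simp
    have "(LINT x|\<mu>. w x \<bullet> conv \<rho> H x) = (LINT x:torus|lborel. w x \<bullet> conv \<rho> H x)"
      by (rule integral_torus_measure) measurable
    also have "\<dots> = (LINT x:torus|lborel. h x \<bullet> conv \<rho> H x)" using test[OF wc] test[OF ww] by (simp add: w_def)
    also have "\<dots> = (LINT x|\<mu>. h x \<bullet> conv \<rho> H x)"
      by (rule integral_torus_measure[symmetric]) measurable
    finally have "(LINT x|\<mu>. w x \<bullet> conv \<rho> H x) = (LINT x|\<mu>. h x \<bullet> conv \<rho> H x)" .
    moreover have "\<bar>(LINT x|\<mu>. w x \<bullet> conv \<rho> H x) - (LINT x|\<mu>. w x \<bullet> H x)\<bar> \<le> e / 2"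
      using d1(2) \<epsilon>(2,3) \<rho> by blast
    moreover have "\<bar>(LINT x|\<mu>. h x \<bullet> conv \<rho> H x) - (LINT x|\<mu>. h x \<bullet> H x)\<bar> \<le> e / 2"
      using d2(2) \<epsilon>(2,4) \<rho> by blast
    ultimately show ?thesis by linarith
  qed
  then have "(LINT x|\<mu>. w x \<bullet> H x) = (LINT x|\<mu>. h x \<bullet> H x)"
    using field_le_epsilon[of "\<bar>(LINT x|\<mu>. w x \<bullet> H x) - (LINT x|\<mu>. h x \<bullet> H x)\<bar>" 0] by simp
  moreover have "magnetic_helicity H = (LINT x|\<mu>. H x \<bullet> w x)"
    unfolding magnetic_helicity_def w_def[symmetric] by (rule integral_torus_measure[symmetric]) measurable
  ultimately show ?thesis by (simp add: inner_commute)
qed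

theorem theorem1p4:
  fixes T :: real and u h H :: "real \<Rightarrow> real ^ 3 \<Rightarrow> real ^ 3"
  assumes "T > 0"
    and "Hall_MHD_weak_solution T u h"
    and "\<And>t. t \<in> {0..T} \<Longrightarrow> mean_zero (h t)"
    and "C_Lq T 3 h"
    and "Lr_Lq T 3 3 u"
    and "Lr_Besov_VMO T 3 (1 / 3) 3 h"
    and "\<And>t. t \<in> {0..T} \<Longrightarrow> is_curl_inverse (h t) (H t)"
  shows "\<forall>t\<in>{0..T}. magnetic_helicity (H t) = magnetic_helicity (H 0)"
proof
  fix t assume t: "t \<in> {0..T}"
  have z: "0 \<in> {0..T}" using \<open>T > 0\<close> by simp
  interpret helicity_setting T u h H
    by standard (use assms in \<open>auto simp: Lr_Lq_def Lr_Besov_VMO_def\<close>)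
  have L2: "torus_Lp 2 (H t)" "torus_Lp 2 (h t)" if "t \<in> {0..T}" for t
    using H_inv[OF that] unfolding is_curl_inverse_def has_weak_curl_def by auto
  note besov = Besov_VMO_cubic_modulus[OF assms(6) h_L3]
  obtain C where C: "C > 0" "\<And>\<epsilon>. \<epsilon> > 0 \<Longrightarrow> \<exists>\<rho>::real ^ 3 \<Rightarrow> real. mollifier C \<epsilon> \<rho>"
    by (rule mollifier_exists) (rule that)
  define X where "X \<epsilon> = (LINT \<tau>:{0..T}|lborel. cubic_modulus \<epsilon> (h \<tau>))" for \<epsilon>
  define U where "U = (LINT \<tau>:{0..T}|lborel. torus_Lp_norm 3 (u \<tau>) powr 3 + torus_Lp_norm 3 (h \<tau>) powr 3)"
  have U: "0 \<le> U" unfolding U_def set_lebesgue_integral_def by (intro integral_nonneg_AE AE_I2) simp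
  have X0: "0 \<le> X \<epsilon>" for \<epsilon>
    unfolding X_def set_lebesgue_integral_def
    by (intro integral_nonneg_AE AE_I2) (simp add: cubic_modulus_nonneg)
  define A where "A r = (LINT x|\<mu>. H r x \<bullet> h r x)" for r
  have "\<bar>A t - A 0\<bar> \<le> 0 + \<delta>" if \<delta>: "0 < \<delta>" for \<delta>
  proof -
    define V where "V = U + 1"
    have V: "0 < V" "U \<le> V" using U by (simp_all add: V_def)
    \<comment> \<open>This weight makes the mass term at most \<open>\<delta> / 4\<close>. It is
      fixed before \<epsilon>, because the threshold for the modulus depends on it.\<close>
    define e where "e = \<delta> / (8 * V)"
    have e: "0 < e" using \<delta> V by (simp add: e_def)
    have eU: "2 * (e * U) \<le> \<delta> / 4"
    proof -
      have "e * U \<le> e * V" using e V by simp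
      also have "\<dots> = \<delta> / 8" using V by (simp add: e_def)
      finally show ?thesis by simp
    qed
    \<comment> \<open>For \<open>\<epsilon> \<le> 1\<close> the coefficient of the modulus is at
      most \<open>c / \<epsilon>\<close>, so the quotient \<open>X \<epsilon> / \<epsilon>\<close>,
      which tends to 0, absorbs it.\<close>
    define c where "c = C / 4 + C / e\<^sup>2"
    have c: "0 < c" using C e by (simp add: c_def add_pos_pos)
    have \<delta>4: "0 < \<delta> / 4" using \<delta> by simp
    have "0 < \<delta> / (8 * c)" using \<delta> c by simp
    from order_tendstoD(2)[OF besov this]
    obtain b where b: "0 < b" "\<And>\<epsilon>. 0 < \<epsilon> \<Longrightarrow> \<epsilon> < b \<Longrightarrow> X \<epsilon> / \<epsilon> < \<delta> / (8 * c)"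
      unfolding eventually_at_right_field X_def by blast
    obtain d1 where d1: "d1 > 0" "\<forall>\<epsilon> \<rho>. \<epsilon> < 1/4 \<longrightarrow> \<epsilon> \<le> d1 \<longrightarrow> mollifier C \<epsilon> \<rho> \<longrightarrow>
      \<bar>(LINT x|\<mu>. H t x \<bullet> conv \<rho> (h t) x) - (LINT x|\<mu>. H t x \<bullet> h t x)\<bar> \<le> \<delta> / 4"
      using mollifier_pairing_limit[OF L2(1)[OF t] L2(2)[OF t] \<delta>4, of C] by blast
    obtain d2 where d2: "d2 > 0" "\<forall>\<epsilon> \<rho>. \<epsilon> < 1/4 \<longrightarrow> \<epsilon> \<le> d2 \<longrightarrow> mollifier C \<epsilon> \<rho> \<longrightarrow>
      \<bar>(LINT x|\<mu>. H 0 x \<bullet> conv \<rho> (h 0) x) - (LINT x|\<mu>. H 0 x \<bullet> h 0 x)\<bar> \<le> \<delta> / 4"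
      using mollifier_pairing_limit[OF L2(1)[OF z] L2(2)[OF z] \<delta>4, of C] by blast
    \<comment> \<open>\<open>b\<close> is a strict threshold and is halved; \<open>1/8\<close> makes
      the mollifier a \<open>kernel\<close> and keeps \<epsilon> below 1.\<close>
    define \<epsilon> where "\<epsilon> = min (min d1 d2) (min (b / 2) (1/8))"
    have \<epsilon>: "0 < \<epsilon>" "\<epsilon> < 1/4" "\<epsilon> \<le> d1" "\<epsilon> \<le> d2" "\<epsilon> < b" "\<epsilon> \<le> 1"
      using d1(1) d2(1) b(1) by (auto simp: \<epsilon>_def)
    obtain \<rho> :: "real ^ 3 \<Rightarrow> real" where \<rho>: "mollifier C \<epsilon> \<rho>" using C(2)[OF \<epsilon>(1)] by blast
    define Q where "Q r = (LINT x|\<mu>. H r x \<bullet> conv \<rho> (h r) x)" for r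
    have "\<bar>Q t - Q 0\<bar> \<le> 2 * ((C / (4 * \<epsilon>) + C / e\<^sup>2) * X \<epsilon> + e * U)"
      unfolding Q_def X_def U_def
      by (rule mollified_helicity_bound[OF \<rho> \<epsilon>(1,2) e t])
    moreover have "(C / (4 * \<epsilon>) + C / e\<^sup>2) * X \<epsilon> \<le> \<delta> / 8"
    proof -
      have "C / e\<^sup>2 \<le> C / e\<^sup>2 / \<epsilon>"
        using \<epsilon> C e by (simp add: pos_le_divide_eq mult_left_le)
      then have "C / (4 * \<epsilon>) + C / e\<^sup>2 \<le> c / \<epsilon>" by (simp add: c_def add_divide_distrib)
      then have "(C / (4 * \<epsilon>) + C / e\<^sup>2) * X \<epsilon> \<le> c / \<epsilon> * X \<epsilon>" by (rule mult_right_mono[OF _ X0])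
      also have "\<dots> = c * (X \<epsilon> / \<epsilon>)" by simp
      also have "\<dots> \<le> c * (\<delta> / (8 * c))" using b(2)[OF \<epsilon>(1,5)] c by (intro mult_left_mono) auto
      also have "\<dots> = \<delta> / 8" using c by simp
      finally show ?thesis .
    qed
    \<comment> \<open>A quarter of \<delta> each from the modulus and the mass; the other two
      quarters pay for removing the mollifier at the times \<open>t\<close> and 0.\<close>
    ultimately have "\<bar>Q t - Q 0\<bar> \<le> \<delta> / 2"
      using eU unfolding distrib_left by linarith
    moreover have "\<bar>Q t - A t\<bar> \<le> \<delta> / 4"
      unfolding Q_def A_def using d1(2) \<epsilon>(2,3) \<rho> by blast
    moreover have "\<bar>Q 0 - A 0\<bar> \<le> \<delta> / 4"
      unfolding Q_def A_def using d2(2) \<epsilon>(2,4) \<rho> by blast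
    ultimately show ?thesis by linarith
  qed
  then have "A t = A 0" using field_le_epsilon[of "\<bar>A t - A 0\<bar>" 0] by simp
  then show "magnetic_helicity (H t) = magnetic_helicity (H 0)"
    using magnetic_helicity_eq[OF H_inv[OF t]] magnetic_helicity_eq[OF H_inv[OF z]] by (simp add: A_def)
qed

end
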